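(* Let $Y$ be a complex manifold, $E\subset Y$ a divisor with simple normal crossings, and $\mathcal{M}$ a coherent $\mathscr{D}_Y$-module. Then any two multivariate $V$-filtrations on $\mathcal{M}$ along $E$ coincide.
   Context: Conventions. All $\mathscr{D}$-modules are left modules over the sheaf $\mathscr{D}_Y$ of holomorphic differential operators on a complex manifold $Y$. $\mathbb{R}^r$ carries the componentwise partial order; $\boldsymbol{\alpha}=(\alpha_1,\dots,\alpha_r)$; $\boldsymbol{1}_i$ is the $i$-th standard basis vector, $\boldsymbol{1}=(1,\dots,1)$; for $\boldsymbol{L}\in\mathbb{Q}_{\ge0}^r$, $\boldsymbol{L}(\boldsymbol{\alpha})=\sum_iL_i\alpha_i$. "Locally on $Y$" means on each member of some open cover. Filtration on $\mathscr{D}_Y$. Let $E\subset Y$ be a simple normal crossings divisor with irreducible components $E_1,\dots,E_r$; locally $E_i=\{t_i=0\}$ with $t_1,\dots,t_r$ part of a local coordinate system with partial derivatives $\partial_{t_i}$. For $m\in\mathbb{Z}$ let $V^m_{E_i}\mathscr{D}_Y=\{P\mid P(t_i^k\mathcal{O}_Y)\subset t_i^{k+m}\mathcal{O}_Y\ \forall k\ge0\}$ (with $t_i^l\mathcal{O}_Y:=\mathcal{O}_Y$ for $l<0$), and for $\boldsymbol{n}\in\mathbb{Z}^r$ let $V^{\boldsymbol{n}}\mathscr{D}_Y=\bigcap_iV^{n_i}_{E_i}\mathscr{D}_Y$. Put $s_i=-\partial_{t_i}t_i\in V^{\boldsymbol{0}}\mathscr{D}_Y$ and $\boldsymbol{L}(\boldsymbol{s})=\sum_iL_is_i$.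 Walls. A set of walls is a set $\mathcal{W}$ of affine hyperplanes (walls) in $\mathbb{R}^r$, finite modulo translation by $\mathbb{Z}^r$, each of the form $\boldsymbol{L}^{-1}(\gamma)=\{\boldsymbol{\alpha}\mid\boldsymbol{L}(\boldsymbol{\alpha})=\gamma\}$ with $0\ne\boldsymbol{L}\in\mathbb{Q}_{\ge0}^r$, $\gamma\in\mathbb{R}$. The wall $\boldsymbol{L}^{-1}(\gamma)$ separates $\boldsymbol{\alpha},\boldsymbol{\beta}$ if $\boldsymbol{L}(\boldsymbol{\alpha})\le\gamma<\boldsymbol{L}(\boldsymbol{\beta})$ or vice versa; two points are in the same chamber of $\mathcal{W}$ if no wall of $\mathcal{W}$ separates them. A decreasing $\mathbb{R}^r$-indexed filtration $U^\bullet\mathcal{M}$ by subsheaves is a wall and chamber filtration if, locally on $Y$, there is a set of walls $\mathcal{W}$ (then called a set of walls of the filtration) such that $U^{\boldsymbol{\alpha}}\mathcal{M}=U^{\boldsymbol{\beta}}\mathcal{M}$ whenever $\boldsymbol{\alpha},\boldsymbol{\beta}$ lie in the same chamber. Good. A wall and chamber filtration $U^\bullet\mathcal{M}$ of a coherent $\mathscr{D}_Y$-module is good over $V^\bullet\mathscr{D}_Y$ if (1) $\mathcal{M}=\bigcup_{\boldsymbol{\alpha}}U^{\boldsymbol{\alpha}}\mathcal{M}$; (2) $V^{\boldsymbol{n}}\mathscr{D}_Y\cdot U^{\boldsymbol{\alpha}}\mathcal{M}\subset U^{\boldsymbol{n}+\boldsymbol{\alpha}}\mathcal{M}$ for all $\boldsymbol{n}\in\mathbb{Z}^r$,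 $\boldsymbol{\alpha}\in\mathbb{R}^r$; (3) each $U^{\boldsymbol{\alpha}}\mathcal{M}$ is a coherent $V^{\boldsymbol{0}}\mathscr{D}_Y$-module; (4) locally on $Y$ there is a bounded interval $[A,B]$ with $U^{\boldsymbol{\alpha}}\mathcal{M}=\sum V^{\boldsymbol{n}}\mathscr{D}_Y\cdot U^{\boldsymbol{\gamma}}\mathcal{M}$ for all $\boldsymbol{\alpha}$, the sum being over $\boldsymbol{n}\in\mathbb{Z}^r$, $\boldsymbol{\gamma}\in[A,B]^r$ with $\boldsymbol{n}+\boldsymbol{\gamma}\ge\boldsymbol{\alpha}$. Multivariate $V$-filtration. A multivariate $V$-filtration on $\mathcal{M}$ along $E$ is a good wall and chamber filtration $V^\bullet\mathcal{M}$ over $V^\bullet\mathscr{D}_Y$ such that, if $\mathcal{W}$ is a set of walls of it and $\boldsymbol{\alpha}\le\boldsymbol{\beta}$ are separated by a single wall $\boldsymbol{L}^{-1}(\gamma)\in\mathcal{W}$, there exist (not necessarily distinct) $\gamma_1,\dots,\gamma_k\in\mathbb{C}$ with $\mathrm{Re}\,\gamma_j=\gamma$ such that $\prod_j(\boldsymbol{L}(\boldsymbol{s})+\gamma_j)$ acts by zero on $V^{\boldsymbol{\alpha}}\mathcal{M}/V^{\boldsymbol{\beta}}\mathcal{M}$. *)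

theory Defs
  imports "HOL-Analysis.Analysis" "HOL-Algebra.Module"
begin

text \<open>
  \<open>\<complex>\<^sup>n\<close> is the set of sequences supported on \<open>{..<n}\<close>, with the subspace topology of the product
  topology; this keeps \<open>n = 0\<close> available. Likewise for \<open>\<real>\<^sup>r\<close> and \<open>\<int>\<^sup>r\<close> further below.
\<close>

definition cspace :: "nat \<Rightarrow> (nat \<Rightarrow> complex) set" where
  "cspace n = {z. \<forall>i\<ge>n. z i = 0}"

text \<open>Continuous and holomorphic in each variable; only used for \<open>S\<close> relatively open in \<open>cspace n\<close>.\<close>

definition hol_on :: "nat \<Rightarrow> (nat \<Rightarrow> complex) set \<Rightarrow> ((nat \<Rightarrow> complex) \<Rightarrow> complex) \<Rightarrow> bool" where
  "hol_on n S f \<longleftrightarrow> continuous_on S f \<and>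
     (\<forall>z\<in>S. \<forall>i<n. (\<lambda>w. f (z(i := w))) field_differentiable (at (z i)))"

type_synonym 'y chart = "nat \<times> 'y set \<times> ('y \<Rightarrow> nat \<Rightarrow> complex)"

definition is_chart :: "'y::topological_space chart \<Rightarrow> bool" where
  "is_chart c = (case c of (n, U, x) \<Rightarrow> open U \<and> openin (top_of_set (cspace n)) (x ` U) \<and>
     homeomorphism U (x ` U) x (inv_into U x))"

definition hol_transition :: "'y chart \<Rightarrow> 'y chart \<Rightarrow> bool" where
  "hol_transition c d = (case c of (n, U, x) \<Rightarrow> case d of (m, V, y) \<Rightarrow>
     \<forall>j<m. hol_on n (x ` (U \<inter> V)) (\<lambda>z. y (inv_into U x z) j))"

definition complex_manifold :: "'y::{t2_space, second_countable_topology} chart set \<Rightarrow> bool" where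
  "complex_manifold A \<longleftrightarrow>
     (\<forall>c\<in>A. is_chart c) \<and> (\<forall>c\<in>A. \<forall>d\<in>A. hol_transition c d) \<and>
     (\<forall>y. \<exists>(n, U, x)\<in>A. y \<in> U)"

definition coordinate_system :: "'y::topological_space chart set \<Rightarrow> 'y chart \<Rightarrow> bool" where
  "coordinate_system A c \<longleftrightarrow>
     is_chart c \<and> (\<forall>d\<in>A. hol_transition c d \<and> hol_transition d c)"

definition opens :: "'y::topological_space set \<Rightarrow> 'y set set" where
  "opens U = {W. open W \<and> W \<subseteq> U}"

text \<open>Sections of the structure sheaf are made \<open>extensional\<close>, so that they are equal iff they agree on \<open>U\<close>.\<close>

definition hol_funs :: "'y::topological_space chart set \<Rightarrow> 'y set \<Rightarrow> ('y \<Rightarrow> complex) set" where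
  "hol_funs A U = {f \<in> extensional U.
     \<forall>(n, V, x)\<in>A. hol_on n (x ` (U \<inter> V)) (\<lambda>z. f (inv_into V x z))}"

text \<open>
  A section over \<open>U\<close> of the sheaf of \<open>\<complex>\<close>-linear endomorphisms of the structure sheaf is a family
  \<open>P W\<close>, indexed by the open \<open>W \<subseteq> U\<close>, of maps that commute with restriction.
\<close>

type_synonym 'y oper = "'y set \<Rightarrow> ('y \<Rightarrow> complex) \<Rightarrow> 'y \<Rightarrow> complex"

definition mk_op :: "'y::topological_space chart set \<Rightarrow> 'y set \<Rightarrow>
    ('y set \<Rightarrow> ('y \<Rightarrow> complex) \<Rightarrow> 'y \<Rightarrow> complex) \<Rightarrow> 'y oper" where
  "mk_op A U F = (\<lambda>W\<in>opens U. \<lambda>f\<in>hol_funs A W. \<lambda>y\<in>W. F W f y)"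

definition lin_endos :: "'y::topological_space chart set \<Rightarrow> 'y set \<Rightarrow> 'y oper set" where
  "lin_endos A U = {P \<in> extensional (opens U). \<forall>W\<in>opens U.
     P W \<in> hol_funs A W \<rightarrow>\<^sub>E hol_funs A W \<and>
     (\<forall>f\<in>hol_funs A W. \<forall>g\<in>hol_funs A W. \<forall>c.
        P W (\<lambda>y\<in>W. c * f y + g y) = (\<lambda>y\<in>W. c * P W f y + P W g y)) \<and>
     (\<forall>W'\<in>opens W. \<forall>f\<in>hol_funs A W. P W' (restrict f W') = restrict (P W f) W')}"

definition vector_fields :: "'y::topological_space chart set \<Rightarrow> 'y set \<Rightarrow> 'y oper set" where
  "vector_fields A U = {P \<in> lin_endos A U. \<forall>W\<in>opens U. \<forall>f\<in>hol_funs A W. \<forall>g\<in>hol_funs A W.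
     P W (\<lambda>y\<in>W. f y * g y) = (\<lambda>y\<in>W. f y * P W g y + P W f y * g y)}"

definition mult_op :: "'y::topological_space chart set \<Rightarrow> 'y set \<Rightarrow> ('y \<Rightarrow> complex) \<Rightarrow> 'y oper" where
  "mult_op A U h = mk_op A U (\<lambda>W f y. h y * f y)"

definition const_op :: "'y::topological_space chart set \<Rightarrow> 'y set \<Rightarrow> complex \<Rightarrow> 'y oper" where
  "const_op A U c = mult_op A U (\<lambda>y. c)"

definition add_op :: "'y::topological_space chart set \<Rightarrow> 'y set \<Rightarrow> 'y oper \<Rightarrow> 'y oper \<Rightarrow> 'y oper" where
  "add_op A U P Q = mk_op A U (\<lambda>W f y. P W f y + Q W f y)"

definition comp_op :: "'y::topological_space chart set \<Rightarrow> 'y set \<Rightarrow> 'y oper \<Rightarrow> 'y oper \<Rightarrow> 'y oper" where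
  "comp_op A U P Q = mk_op A U (\<lambda>W f y. P W (Q W f) y)"

text \<open>The \<open>U\<close> is unused; it gives this the type of the restriction maps of a sheaf.\<close>

definition res_op :: "'y::topological_space set \<Rightarrow> 'y set \<Rightarrow> 'y oper \<Rightarrow> 'y oper" where
  "res_op U W P = restrict P (opens W)"

inductive_set diff_gen :: "'y::topological_space chart set \<Rightarrow> 'y set \<Rightarrow> 'y oper set"
  for A U where
  "h \<in> hol_funs A U \<Longrightarrow> mult_op A U h \<in> diff_gen A U"
| "P \<in> vector_fields A U \<Longrightarrow> P \<in> diff_gen A U"
| "P \<in> diff_gen A U \<Longrightarrow> Q \<in> diff_gen A U \<Longrightarrow> add_op A U P Q \<in> diff_gen A U"
| "P \<in> diff_gen A U \<Longrightarrow> Q \<in> diff_gen A U \<Longrightarrow> comp_op A U P Q \<in> diff_gen A U"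

definition diff_ops :: "'y::topological_space chart set \<Rightarrow> 'y set \<Rightarrow> 'y oper set" where
  "diff_ops A U = {P \<in> lin_endos A U.
     \<forall>y\<in>U. \<exists>W\<in>opens U. y \<in> W \<and> res_op U W P \<in> diff_gen A W}"

definition diff_ring :: "'y::topological_space chart set \<Rightarrow> 'y set \<Rightarrow> 'y oper ring" where
  "diff_ring A U = \<lparr>carrier = diff_ops A U, mult = comp_op A U, one = const_op A U 1,
     zero = const_op A U 0, add = add_op A U\<rparr>"

text \<open>The library locale \<open>module\<close> is over commutative rings.\<close>

locale left_module = R?: ring R + M?: abelian_group M
  for R :: "('a, 'c) ring_scheme" (structure) and M :: "('a, 'b, 'd) module_scheme" (structure) +
  assumes smult_closed:
      "\<lbrakk>a \<in> carrier R; x \<in> carrier M\<rbrakk> \<Longrightarrow> a \<odot>\<^bsub>M\<^esub> x \<in> carrier M"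
    and smult_l_distr:
      "\<lbrakk>a \<in> carrier R; b \<in> carrier R; x \<in> carrier M\<rbrakk> \<Longrightarrow>
      (a \<oplus>\<^bsub>R\<^esub> b) \<odot>\<^bsub>M\<^esub> x = a \<odot>\<^bsub>M\<^esub> x \<oplus>\<^bsub>M\<^esub> b \<odot>\<^bsub>M\<^esub> x"
    and smult_r_distr:
      "\<lbrakk>a \<in> carrier R; x \<in> carrier M; y \<in> carrier M\<rbrakk> \<Longrightarrow>
      a \<odot>\<^bsub>M\<^esub> (x \<oplus>\<^bsub>M\<^esub> y) = a \<odot>\<^bsub>M\<^esub> x \<oplus>\<^bsub>M\<^esub> a \<odot>\<^bsub>M\<^esub> y"
    and smult_assoc:
      "\<lbrakk>a \<in> carrier R; b \<in> carrier R; x \<in> carrier M\<rbrakk> \<Longrightarrow>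
      (a \<otimes>\<^bsub>R\<^esub> b) \<odot>\<^bsub>M\<^esub> x = a \<odot>\<^bsub>M\<^esub> (b \<odot>\<^bsub>M\<^esub> x)"
    and smult_one:
      "x \<in> carrier M \<Longrightarrow> \<one>\<^bsub>R\<^esub> \<odot>\<^bsub>M\<^esub> x = x"

text \<open>
  Throughout, \<open>R U\<close> and \<open>M U\<close> are the sections over the open set \<open>U\<close>, and \<open>rR U W\<close>, \<open>rM U W\<close> the
  restriction maps from \<open>U\<close> to \<open>W \<subseteq> U\<close>.
\<close>

definition module_sheaf :: "('y::topological_space set \<Rightarrow> 'a ring) \<Rightarrow> ('y set \<Rightarrow> 'y set \<Rightarrow> 'a \<Rightarrow> 'a) \<Rightarrow>
    ('y set \<Rightarrow> ('a, 'm) module) \<Rightarrow> ('y set \<Rightarrow> 'y set \<Rightarrow> 'm \<Rightarrow> 'm) \<Rightarrow> bool" where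
  "module_sheaf R rR M rM \<longleftrightarrow>
     (\<forall>U. open U \<longrightarrow> left_module (R U) (M U)) \<and>
     (\<forall>U. open U \<longrightarrow> (\<forall>s\<in>carrier (M U). rM U U s = s)) \<and>
     (\<forall>U. open U \<longrightarrow> (\<forall>W\<in>opens U. \<forall>s\<in>carrier (M U).
        rM U W s \<in> carrier (M W) \<and>
        (\<forall>W'\<in>opens W. rM W W' (rM U W s) = rM U W' s) \<and>
        (\<forall>t\<in>carrier (M U). rM U W (s \<oplus>\<^bsub>M U\<^esub> t) = rM U W s \<oplus>\<^bsub>M W\<^esub> rM U W t) \<and>
        (\<forall>a\<in>carrier (R U). rM U W (a \<odot>\<^bsub>M U\<^esub> s) = rR U W a \<odot>\<^bsub>M W\<^esub> rM U W s))) \<and>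
     (\<forall>\<U>. (\<forall>W\<in>\<U>. open W) \<longrightarrow>
        (\<forall>s\<in>carrier (M (\<Union>\<U>)). \<forall>t\<in>carrier (M (\<Union>\<U>)).
           (\<forall>W\<in>\<U>. rM (\<Union>\<U>) W s = rM (\<Union>\<U>) W t) \<longrightarrow> s = t) \<and>
        (\<forall>\<sigma>. (\<forall>W\<in>\<U>. \<sigma> W \<in> carrier (M W)) \<and>
             (\<forall>W\<in>\<U>. \<forall>W'\<in>\<U>. rM W (W \<inter> W') (\<sigma> W) = rM W' (W \<inter> W') (\<sigma> W')) \<longrightarrow>
           (\<exists>s\<in>carrier (M (\<Union>\<U>)). \<forall>W\<in>\<U>. rM (\<Union>\<U>) W s = \<sigma> W)))"

definition generated_on :: "('y::topological_space set \<Rightarrow> 'a ring) \<Rightarrow>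
    ('y set \<Rightarrow> ('a, 'm) module) \<Rightarrow> ('y set \<Rightarrow> 'y set \<Rightarrow> 'm \<Rightarrow> 'm) \<Rightarrow>
    'y set \<Rightarrow> nat \<Rightarrow> (nat \<Rightarrow> 'm) \<Rightarrow> bool" where
  "generated_on R M rM U k g \<longleftrightarrow>
     (\<forall>i<k. g i \<in> carrier (M U)) \<and>
     (\<forall>W\<in>opens U. \<forall>s\<in>carrier (M W). \<forall>y\<in>W. \<exists>W'\<in>opens W. y \<in> W' \<and>
        (\<exists>a \<in> {..<k} \<rightarrow> carrier (R W').
           rM W W' s = (\<Oplus>\<^bsub>M W'\<^esub>i\<in>{..<k}. a i \<odot>\<^bsub>M W'\<^esub> rM U W' (g i))))"

definition finite_type_on :: "('y::topological_space set \<Rightarrow> 'a ring) \<Rightarrow>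
    ('y set \<Rightarrow> ('a, 'm) module) \<Rightarrow> ('y set \<Rightarrow> 'y set \<Rightarrow> 'm \<Rightarrow> 'm) \<Rightarrow> 'y set \<Rightarrow> bool" where
  "finite_type_on R M rM U \<longleftrightarrow>
     (\<forall>y\<in>U. \<exists>W\<in>opens U. y \<in> W \<and> (\<exists>k g. generated_on R M rM W k g))"

text \<open>The kernel of \<open>R\<^sup>k \<rightarrow> M\<close> on \<open>U\<close>, \<open>a \<mapsto> \<Sum>i<k. a\<^sub>i g\<^sub>i\<close>, for sections \<open>g\<^sub>i\<close> of \<open>M\<close> over \<open>U\<close>.\<close>

definition relations :: "('y set \<Rightarrow> 'a ring) \<Rightarrow> ('y set \<Rightarrow> ('a, 'm) module) \<Rightarrow>
    ('y set \<Rightarrow> 'y set \<Rightarrow> 'm \<Rightarrow> 'm) \<Rightarrow> 'y set \<Rightarrow> nat \<Rightarrow> (nat \<Rightarrow> 'm) \<Rightarrow>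
    'y set \<Rightarrow> ('a, nat \<Rightarrow> 'a) module" where
  "relations R M rM U k g W =
    \<lparr>carrier = {a \<in> {..<k} \<rightarrow>\<^sub>E carrier (R W).
       (\<Oplus>\<^bsub>M W\<^esub>i\<in>{..<k}. a i \<odot>\<^bsub>M W\<^esub> rM U W (g i)) = \<zero>\<^bsub>M W\<^esub>},
     mult = undefined, one = undefined,
     zero = (\<lambda>i\<in>{..<k}. \<zero>\<^bsub>R W\<^esub>),
     add = (\<lambda>a b. \<lambda>i\<in>{..<k}. a i \<oplus>\<^bsub>R W\<^esub> b i),
     smult = (\<lambda>c a. \<lambda>i\<in>{..<k}. c \<otimes>\<^bsub>R W\<^esub> a i)\<rparr>"

definition coherent_sheaf :: "('y::topological_space set \<Rightarrow> 'a ring) \<Rightarrow> ('y set \<Rightarrow> 'y set \<Rightarrow> 'a \<Rightarrow> 'a) \<Rightarrow>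
    ('y set \<Rightarrow> ('a, 'm) module) \<Rightarrow> ('y set \<Rightarrow> 'y set \<Rightarrow> 'm \<Rightarrow> 'm) \<Rightarrow> bool" where
  "coherent_sheaf R rR M rM \<longleftrightarrow>
     module_sheaf R rR M rM \<and> finite_type_on R M rM UNIV \<and>
     (\<forall>U k g. open U \<and> (\<forall>i<k. g i \<in> carrier (M U)) \<longrightarrow>
        finite_type_on R (relations R M rM U k g)
          (\<lambda>W W' a. \<lambda>i\<in>{..<k}. rR W W' (a i)) U)"

definition analytic_subset :: "'y::topological_space chart set \<Rightarrow> 'y set \<Rightarrow> bool" where
  "analytic_subset A Z \<longleftrightarrow> (\<forall>y. \<exists>W. open W \<and> y \<in> W \<and>
     (\<exists>F. finite F \<and> F \<subseteq> hol_funs A W \<and> Z \<inter> W = {z\<in>W. \<forall>f\<in>F. f z = 0}))"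

definition irreducible_analytic :: "'y::topological_space chart set \<Rightarrow> 'y set \<Rightarrow> bool" where
  "irreducible_analytic A Z \<longleftrightarrow> analytic_subset A Z \<and> Z \<noteq> {} \<and>
     (\<forall>Z1 Z2. analytic_subset A Z1 \<and> analytic_subset A Z2 \<and> Z = Z1 \<union> Z2 \<longrightarrow> Z1 = Z \<or> Z2 = Z)"

text \<open>
  Coordinates on \<open>U\<close> adapted to the components \<open>E 0, \<dots>, E (r - 1)\<close>: for each component meeting
  \<open>U\<close>, its local equation \<open>t\<^sub>i\<close> is the coordinate with index \<open>\<sigma> i\<close>.
\<close>

definition adapted_coordinates :: "'y::topological_space chart set \<Rightarrow> nat \<Rightarrow> (nat \<Rightarrow> 'y set) \<Rightarrow>
    'y chart \<Rightarrow> (nat \<Rightarrow> nat) \<Rightarrow> bool" where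
  "adapted_coordinates A r E c \<sigma> \<longleftrightarrow> coordinate_system A c \<and> (case c of (n, U, x) \<Rightarrow>
     inj_on \<sigma> {i. i < r \<and> E i \<inter> U \<noteq> {}} \<and>
     (\<forall>i<r. E i \<inter> U \<noteq> {} \<longrightarrow> \<sigma> i < n \<and> E i \<inter> U = {y\<in>U. x y (\<sigma> i) = 0}))"

text \<open>
  \<open>E 0, \<dots>, E (r - 1)\<close> are the irreducible components of the divisor \<open>\<Union>i<r. E i\<close>; they are
  distinct because \<open>\<sigma>\<close> is injective. The empty divisor is \<open>r = 0\<close>.
\<close>

definition snc_divisor :: "'y::topological_space chart set \<Rightarrow> nat \<Rightarrow> (nat \<Rightarrow> 'y set) \<Rightarrow> bool" where
  "snc_divisor A r E \<longleftrightarrow> (\<forall>i<r. irreducible_analytic A (E i)) \<and>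
     (\<forall>y. \<exists>n U x \<sigma>. y \<in> U \<and> adapted_coordinates A r E (n, U, x) \<sigma>)"

definition local_equation :: "'y::topological_space chart set \<Rightarrow> 'y set \<Rightarrow> 'y set \<Rightarrow>
    ('y \<Rightarrow> complex) \<Rightarrow> bool" where
  "local_equation A Z W t \<longleftrightarrow> t \<in> hol_funs A W \<and> Z \<inter> W = {y\<in>W. t y = 0} \<and>
     (Z \<inter> W = {} \<or> (\<exists>n x j. coordinate_system A (n, W, x) \<and> j < n \<and> t = (\<lambda>y\<in>W. x y j)))"

text \<open>
  Sections over \<open>W\<close> of the ideal sheaf generated by the \<open>k\<close>-th power of a local equation of \<open>Z\<close>;
  \<open>nat k\<close> makes this the structure sheaf for \<open>k < 0\<close>.
\<close>

definition ideal_power :: "'y::topological_space chart set \<Rightarrow> 'y set \<Rightarrow> int \<Rightarrow> 'y set \<Rightarrow>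
    ('y \<Rightarrow> complex) set" where
  "ideal_power A Z k W = {f \<in> hol_funs A W. \<forall>y\<in>W. \<exists>W'\<in>opens W. y \<in> W' \<and>
     (\<exists>t g. local_equation A Z W' t \<and> g \<in> hol_funs A W' \<and> (\<forall>z\<in>W'. f z = t z ^ nat k * g z))}"

definition V_ops1 :: "'y::topological_space chart set \<Rightarrow> 'y set \<Rightarrow> int \<Rightarrow> 'y set \<Rightarrow> 'y oper set" where
  "V_ops1 A Z m U = {P \<in> diff_ops A U. \<forall>k\<ge>0. \<forall>W\<in>opens U.
     \<forall>f\<in>ideal_power A Z k W. P W f \<in> ideal_power A Z (k + m) W}"

definition V_ops :: "'y::topological_space chart set \<Rightarrow> nat \<Rightarrow> (nat \<Rightarrow> 'y set) \<Rightarrow>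
    (nat \<Rightarrow> int) \<Rightarrow> 'y set \<Rightarrow> 'y oper set" where
  "V_ops A r E n U = {P \<in> diff_ops A U. \<forall>i<r. P \<in> V_ops1 A (E i) (n i) U}"

definition V0_ring :: "'y::topological_space chart set \<Rightarrow> nat \<Rightarrow> (nat \<Rightarrow> 'y set) \<Rightarrow>
    'y set \<Rightarrow> 'y oper ring" where
  "V0_ring A r E U = (diff_ring A U)\<lparr>carrier := V_ops A r E (\<lambda>i. 0) U\<rparr>"

definition rspace :: "nat \<Rightarrow> (nat \<Rightarrow> real) set" where
  "rspace r = {\<alpha>. \<forall>i\<ge>r. \<alpha> i = 0}"

definition zspace :: "nat \<Rightarrow> (nat \<Rightarrow> int) set" where
  "zspace r = {n. \<forall>i\<ge>r. n i = 0}"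

definition vshift :: "(nat \<Rightarrow> int) \<Rightarrow> (nat \<Rightarrow> real) \<Rightarrow> nat \<Rightarrow> real" where
  "vshift n \<alpha> = (\<lambda>i. of_int (n i) + \<alpha> i)"

definition lin_form :: "nat \<Rightarrow> (nat \<Rightarrow> rat) \<Rightarrow> (nat \<Rightarrow> real) \<Rightarrow> real" where
  "lin_form r L \<alpha> = (\<Sum>i<r. of_rat (L i) * \<alpha> i)"

definition wall_normal :: "nat \<Rightarrow> (nat \<Rightarrow> rat) \<Rightarrow> bool" where
  "wall_normal r L \<longleftrightarrow> (\<forall>i<r. 0 \<le> L i) \<and> (\<exists>i<r. L i \<noteq> 0)"

definition wall :: "nat \<Rightarrow> (nat \<Rightarrow> rat) \<Rightarrow> real \<Rightarrow> (nat \<Rightarrow> real) set" where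
  "wall r L \<gamma> = {\<alpha> \<in> rspace r. lin_form r L \<alpha> = \<gamma>}"

definition set_of_walls :: "nat \<Rightarrow> (nat \<Rightarrow> real) set set \<Rightarrow> bool" where
  "set_of_walls r \<W> \<longleftrightarrow>
     (\<forall>H\<in>\<W>. \<exists>L \<gamma>. wall_normal r L \<and> H = wall r L \<gamma>) \<and>
     (\<exists>F\<subseteq>\<W>. finite F \<and> (\<forall>H\<in>\<W>. \<exists>H0\<in>F. \<exists>n\<in>zspace r. H = vshift n ` H0))"

text \<open>The choice of \<open>(L, \<gamma>)\<close> is immaterial: it is determined by \<open>H\<close> up to a positive factor.\<close>

definition separates :: "nat \<Rightarrow> (nat \<Rightarrow> real) set \<Rightarrow> (nat \<Rightarrow> real) \<Rightarrow> (nat \<Rightarrow> real) \<Rightarrow> bool" where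
  "separates r H \<alpha> \<beta> \<longleftrightarrow> (\<exists>L \<gamma>. wall_normal r L \<and> H = wall r L \<gamma> \<and>
     (lin_form r L \<alpha> \<le> \<gamma> \<and> \<gamma> < lin_form r L \<beta> \<or> lin_form r L \<beta> \<le> \<gamma> \<and> \<gamma> < lin_form r L \<alpha>))"

definition same_chamber :: "nat \<Rightarrow> (nat \<Rightarrow> real) set set \<Rightarrow> (nat \<Rightarrow> real) \<Rightarrow> (nat \<Rightarrow> real) \<Rightarrow> bool" where
  "same_chamber r \<W> \<alpha> \<beta> \<longleftrightarrow> (\<forall>H\<in>\<W>. \<not> separates r H \<alpha> \<beta>)"

text \<open>A filtration \<open>F\<close> assigns to \<open>\<alpha>\<close> and an open \<open>U\<close> the set \<open>F \<alpha> U\<close> of sections over \<open>U\<close> of its \<open>\<alpha>\<close>-th step.\<close>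

type_synonym ('y, 'm) filtr = "(nat \<Rightarrow> real) \<Rightarrow> 'y set \<Rightarrow> 'm set"

definition subsheaf :: "('y::topological_space set \<Rightarrow> ('a, 'm) module) \<Rightarrow>
    ('y set \<Rightarrow> 'y set \<Rightarrow> 'm \<Rightarrow> 'm) \<Rightarrow> ('y set \<Rightarrow> 'm set) \<Rightarrow> bool" where
  "subsheaf M rM S \<longleftrightarrow> (\<forall>U. open U \<longrightarrow>
     subgroup (S U) (add_monoid (M U)) \<and>
     (\<forall>s\<in>S U. \<forall>W\<in>opens U. rM U W s \<in> S W) \<and>
     (\<forall>s\<in>carrier (M U). (\<forall>y\<in>U. \<exists>W\<in>opens U. y \<in> W \<and> rM U W s \<in> S W) \<longrightarrow> s \<in> S U))"

definition walls_of_filtration :: "nat \<Rightarrow> ('y::topological_space, 'm) filtr \<Rightarrow> 'y set \<Rightarrow>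
    (nat \<Rightarrow> real) set set \<Rightarrow> bool" where
  "walls_of_filtration r F U \<W> \<longleftrightarrow> set_of_walls r \<W> \<and>
     (\<forall>\<alpha>\<in>rspace r. \<forall>\<beta>\<in>rspace r. same_chamber r \<W> \<alpha> \<beta> \<longrightarrow> (\<forall>W\<in>opens U. F \<alpha> W = F \<beta> W))"

definition wall_chamber_filtration :: "nat \<Rightarrow> ('y::topological_space set \<Rightarrow> ('a, 'm) module) \<Rightarrow>
    ('y set \<Rightarrow> 'y set \<Rightarrow> 'm \<Rightarrow> 'm) \<Rightarrow> ('y, 'm) filtr \<Rightarrow> bool" where
  "wall_chamber_filtration r M rM F \<longleftrightarrow>
     (\<forall>\<alpha>\<in>rspace r. subsheaf M rM (F \<alpha>)) \<and>
     (\<forall>\<alpha>\<in>rspace r. \<forall>\<beta>\<in>rspace r. \<alpha> \<le> \<beta> \<longrightarrow> (\<forall>U. open U \<longrightarrow> F \<beta> U \<subseteq> F \<alpha> U)) \<and>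
     (\<forall>y. \<exists>U. open U \<and> y \<in> U \<and> (\<exists>\<W>. walls_of_filtration r F U \<W>))"

definition box_combinations :: "'y::topological_space chart set \<Rightarrow> nat \<Rightarrow> (nat \<Rightarrow> 'y set) \<Rightarrow>
    ('y set \<Rightarrow> ('y oper, 'm) module) \<Rightarrow> ('y, 'm) filtr \<Rightarrow> real \<Rightarrow> real \<Rightarrow> (nat \<Rightarrow> real) \<Rightarrow>
    'y set \<Rightarrow> 'm set" where
  "box_combinations A r E M F a b \<alpha> U =
     {(\<Oplus>\<^bsub>M U\<^esub>j\<in>{..<k}. P j \<odot>\<^bsub>M U\<^esub> u j) | (k::nat) P u.
        \<forall>j<k. \<exists>n\<in>zspace r. \<exists>\<gamma>\<in>rspace r. (\<forall>i<r. \<gamma> i \<in> {a..b}) \<and> \<alpha> \<le> vshift n \<gamma> \<and>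
          P j \<in> V_ops A r E n U \<and> u j \<in> F \<gamma> U}"

definition good_filtration :: "'y::topological_space chart set \<Rightarrow> nat \<Rightarrow> (nat \<Rightarrow> 'y set) \<Rightarrow>
    ('y set \<Rightarrow> ('y oper, 'm) module) \<Rightarrow> ('y set \<Rightarrow> 'y set \<Rightarrow> 'm \<Rightarrow> 'm) \<Rightarrow> ('y, 'm) filtr \<Rightarrow> bool" where
  "good_filtration A r E M rM F \<longleftrightarrow>
     wall_chamber_filtration r M rM F \<and>
     (\<forall>U. open U \<longrightarrow> (\<forall>s\<in>carrier (M U). \<forall>y\<in>U. \<exists>W\<in>opens U. y \<in> W \<and>
        (\<exists>\<alpha>\<in>rspace r. rM U W s \<in> F \<alpha> W))) \<and>
     (\<forall>n\<in>zspace r. \<forall>\<alpha>\<in>rspace r. \<forall>U. open U \<longrightarrow>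
        (\<forall>P\<in>V_ops A r E n U. \<forall>u\<in>F \<alpha> U. P \<odot>\<^bsub>M U\<^esub> u \<in> F (vshift n \<alpha>) U)) \<and>
     (\<forall>\<alpha>\<in>rspace r.
        coherent_sheaf (V0_ring A r E) res_op (\<lambda>U. (M U)\<lparr>carrier := F \<alpha> U\<rparr>) rM) \<and>
     (\<forall>y. \<exists>U a b. open U \<and> y \<in> U \<and> a \<le> b \<and>
        (\<forall>\<alpha>\<in>rspace r. \<forall>W\<in>opens U.
           F \<alpha> W = {s\<in>carrier (M W). \<forall>z\<in>W. \<exists>W'\<in>opens W. z \<in> W' \<and>
                      rM W W' s \<in> box_combinations A r E M F a b \<alpha> W'}))"

definition partial_op :: "'y::topological_space chart set \<Rightarrow> 'y chart \<Rightarrow> nat \<Rightarrow> 'y oper" where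
  "partial_op A c j = (case c of (n, U, x) \<Rightarrow>
     mk_op A U (\<lambda>W f y. deriv (\<lambda>w. f (inv_into U x ((x y)(j := w)))) (x y j)))"

definition s_op :: "'y::topological_space chart set \<Rightarrow> 'y chart \<Rightarrow> nat \<Rightarrow> 'y oper" where
  "s_op A c j = (case c of (n, U, x) \<Rightarrow>
     \<ominus>\<^bsub>diff_ring A U\<^esub> (partial_op A c j \<otimes>\<^bsub>diff_ring A U\<^esub> mult_op A U (\<lambda>y\<in>U. x y j)))"

text \<open>
  The operator \<open>L(s)\<close>. A component \<open>E i\<close> that does not meet \<open>U\<close> has a unit as local equation there,
  all \<open>V_ops1 A (E i) m U\<close> are equal to \<open>diff_ops A U\<close>, and \<open>s\<^sub>i\<close> is taken to be \<open>0\<close>.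
\<close>

definition L_op :: "'y::topological_space chart set \<Rightarrow> nat \<Rightarrow> (nat \<Rightarrow> 'y set) \<Rightarrow> 'y chart \<Rightarrow>
    (nat \<Rightarrow> nat) \<Rightarrow> (nat \<Rightarrow> rat) \<Rightarrow> 'y oper" where
  "L_op A r E c \<sigma> L = (case c of (n, U, x) \<Rightarrow>
     (\<Oplus>\<^bsub>diff_ring A U\<^esub>i\<in>{i. i < r \<and> E i \<inter> U \<noteq> {}}.
        const_op A U (of_rat (L i)) \<otimes>\<^bsub>diff_ring A U\<^esub> s_op A c (\<sigma> i)))"

definition L_prod :: "'y::topological_space chart set \<Rightarrow> nat \<Rightarrow> (nat \<Rightarrow> 'y set) \<Rightarrow> 'y chart \<Rightarrow>
    (nat \<Rightarrow> nat) \<Rightarrow> (nat \<Rightarrow> rat) \<Rightarrow> complex list \<Rightarrow> 'y oper" where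
  "L_prod A r E c \<sigma> L gs = (case c of (n, U, x) \<Rightarrow>
     foldr (\<lambda>g P. (L_op A r E c \<sigma> L \<oplus>\<^bsub>diff_ring A U\<^esub> const_op A U g) \<otimes>\<^bsub>diff_ring A U\<^esub> P)
       gs \<one>\<^bsub>diff_ring A U\<^esub>)"

text \<open>
  The nilpotency condition is local: \<open>s\<close> needs adapted coordinates on an open set \<open>U\<close>, \<open>\<W>\<close> is a
  set of walls on \<open>U\<close>, and the \<open>\<gamma>\<^sub>j\<close> exist near each point of \<open>U\<close>. An operator acts by zero on
  the quotient sheaf iff it maps the sections of \<open>F \<alpha>\<close> into \<open>F \<beta>\<close>.
\<close>

definition multivariate_V_filtration :: "'y::topological_space chart set \<Rightarrow> nat \<Rightarrow>
    (nat \<Rightarrow> 'y set) \<Rightarrow> ('y set \<Rightarrow> ('y oper, 'm) module) \<Rightarrow> ('y set \<Rightarrow> 'y set \<Rightarrow> 'm \<Rightarrow> 'm) \<Rightarrow>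
    ('y, 'm) filtr \<Rightarrow> bool" where
  "multivariate_V_filtration A r E M rM F \<longleftrightarrow>
     good_filtration A r E M rM F \<and>
     (\<forall>n U x \<sigma> \<W> \<alpha> \<beta> L \<gamma>.
        adapted_coordinates A r E (n, U, x) \<sigma> \<and> walls_of_filtration r F U \<W> \<and>
        \<alpha> \<in> rspace r \<and> \<beta> \<in> rspace r \<and> \<alpha> \<le> \<beta> \<and>
        wall_normal r L \<and> {H\<in>\<W>. separates r H \<alpha> \<beta>} = {wall r L \<gamma>} \<longrightarrow>
        (\<forall>y\<in>U. \<exists>U'\<in>opens U. y \<in> U' \<and> (\<exists>gs. (\<forall>g\<in>set gs. Re g = \<gamma>) \<and>
           (\<forall>W\<in>opens U'. \<forall>u\<in>F \<alpha> W.
              res_op U W (L_prod A r E (n, U, x) \<sigma> L gs) \<odot>\<^bsub>M W\<^esub> u \<in> F \<beta> W))))"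

end

theory Submission
  imports Defs "HOL-Algebra.Ring_Divisibility" "HOL-Algebra.Subrings"
    "HOL-Complex_Analysis.Cauchy_Integral_Formula"
begin

text \<open>
  Let \<open>V\<close> and \<open>V'\<close> be two multivariate \<open>V\<close>-filtrations. Both are good, so near a given point there is an
  \<open>N\<close> with \<open>V\<^sup>\<mu> \<subseteq> V'\<^sup>\<mu>\<^sup>-\<^sup>N\<close> for all \<open>\<mu>\<close> (subtracting \<open>N\<close> from every coordinate). For a germ \<open>u\<close> of \<open>V\<^sup>\<alpha>\<close>
  consider the ideal of those \<open>P\<close> in the commutative algebra of the \<open>s\<^sub>i\<close> for which \<open>P u\<close> lies in \<open>V'\<^sup>\<alpha>\<close>.
  If it is proper, it is contained in a prime ideal \<open>J\<close>, and \<open>J\<close> determines a point \<open>l\<close> of \<open>\<real>\<^sup>r\<close> such that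
  \<open>L(s) + c\<close> can lie in \<open>J\<close> only if \<open>L(l) = Re c\<close>. Hence the operators attached to the walls that avoid
  \<open>l\<close> are outside \<open>J\<close>. Moving radially away from or towards \<open>l\<close> crosses only such walls. Move \<open>\<alpha>\<close> away
  from \<open>l\<close> by a large factor \<open>k\<close> in \<open>V\<close>, pass to \<open>V'\<close> at the cost of a shift by \<open>N\<close>, and move back by the
  factor \<open>1/k\<close>: some operator outside \<open>J\<close> maps \<open>u\<close> into the step of \<open>V'\<close> at \<open>\<alpha>\<close> shifted by \<open>N/k\<close>, which is
  \<open>V'\<^sup>\<alpha>\<close> for large \<open>k\<close>. This is a contradiction.
\<close>

section \<open>Walls and chambers\<close>

text \<open>The nilpotency condition speaks only of comparable points separated by exactly one wall,
  whereas a radial move joins arbitrary points and may meet several walls at once. Its end points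
  are therefore perturbed inside their chambers until the walls are crossed one at a time. An upward
  crossing costs one of the given operators, a downward crossing costs nothing because filtrations
  decrease; primality of J keeps the product of the collected operators outside J. A wall through l
  is invariant under dilations about l, so radial moves never cross it. The side L(\<alpha>) \<le>
  \<gamma> of a wall is the closed one, so a small decrease of \<alpha> stays in its chamber, and
  this absorbs N/k. Germs are used because the operators are given only near each point. On the
  analytic side the s_i must commute and lie in degree 0 of the filtration on differential
  operators. Since holomorphic means continuous and holomorphic in each variable, this rests on the
  symmetry of second derivatives, the chain rule and division by a coordinate.\<close>

definition diag_shift :: "nat \<Rightarrow> real \<Rightarrow> (nat \<Rightarrow> real) \<Rightarrow> nat \<Rightarrow> real" where
  "diag_shift r c \<alpha> = (\<lambda>i. if i < r then \<alpha> i + c else \<alpha> i)"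

lemma diag_shift_rspace [simp]: "diag_shift r c \<alpha> \<in> rspace r \<longleftrightarrow> \<alpha> \<in> rspace r"
  by (auto simp: diag_shift_def rspace_def)

lemma diag_shift_mono: "c \<le> d \<Longrightarrow> \<alpha> \<le> \<beta> \<Longrightarrow> diag_shift r c \<alpha> \<le> diag_shift r d \<beta>"
  by (auto simp: diag_shift_def le_fun_def intro: add_mono)

lemma diag_shift_0 [simp]: "diag_shift r 0 \<alpha> = \<alpha>"
  by (auto simp: diag_shift_def)

lemma rspace_lincomb [simp]:
  "\<alpha> \<in> rspace r \<Longrightarrow> \<beta> \<in> rspace r \<Longrightarrow> (\<lambda>i. a * \<alpha> i + b * \<beta> i) \<in> rspace r"
  by (auto simp: rspace_def)

lemma lin_form_lincomb:
  "lin_form r L (\<lambda>i. a * \<alpha> i + b * \<beta> i) = a * lin_form r L \<alpha> + b * lin_form r L \<beta>"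
  by (simp add: lin_form_def sum.distrib sum_distrib_left algebra_simps)

lemma lin_form_mono: "wall_normal r L \<Longrightarrow> \<alpha> \<le> \<beta> \<Longrightarrow> lin_form r L \<alpha> \<le> lin_form r L \<beta>"
  unfolding lin_form_def wall_normal_def le_fun_def
  by (intro sum_mono mult_left_mono) auto

text \<open>Value of the form at (1,...,1), that is, its rate of growth under
  \<open>diag_shift\<close>. Its positivity makes diagonal moves transverse to every wall.\<close>

definition lin_norm :: "nat \<Rightarrow> (nat \<Rightarrow> rat) \<Rightarrow> real" where
  "lin_norm r L = (\<Sum>i<r. of_rat (L i))"

lemma lin_form_diag_shift:
  "lin_form r L (diag_shift r c \<alpha>) = lin_form r L \<alpha> + c * lin_norm r L"
  by (simp add: lin_form_def lin_norm_def diag_shift_def sum.distrib sum_distrib_left algebra_simps)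

lemma lin_norm_pos: "wall_normal r L \<Longrightarrow> 0 < lin_norm r L"
  unfolding wall_normal_def lin_norm_def
  by (auto intro!: sum_pos2)

text \<open>The coefficients of \<open>L\<close> are nonnegative, so the lower side of a wall can be
  described by the wall as a point set, without its equation. The point of the wall above \<alpha>
  is reached along the diagonal.\<close>

lemma lin_form_le_iff_below_wall:
  assumes "wall_normal r L" and "\<alpha> \<in> rspace r"
  shows "lin_form r L \<alpha> \<le> \<gamma> \<longleftrightarrow> (\<exists>h\<in>wall r L \<gamma>. \<alpha> \<le> h)"
proof
  assume le: "lin_form r L \<alpha> \<le> \<gamma>"
  define c where "c = (\<gamma> - lin_form r L \<alpha>) / lin_norm r L"
  have "0 \<le> c" and eq: "c * lin_norm r L = \<gamma> - lin_form r L \<alpha>"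
    using lin_norm_pos[OF assms(1)] le by (auto simp: c_def)
  then have "diag_shift r c \<alpha> \<in> wall r L \<gamma>"
    using assms by (simp add: wall_def lin_form_diag_shift)
  moreover have "\<alpha> \<le> diag_shift r c \<alpha>"
    using diag_shift_mono[OF \<open>0 \<le> c\<close> order.refl, of r \<alpha>] by simp
  ultimately show "\<exists>h\<in>wall r L \<gamma>. \<alpha> \<le> h" by blast
next
  assume "\<exists>h\<in>wall r L \<gamma>. \<alpha> \<le> h"
  then show "lin_form r L \<alpha> \<le> \<gamma>"
    using lin_form_mono[OF assms(1)] by (auto simp: wall_def)
qed

text \<open>\<open>separates\<close> admits any equation of the wall. The side of a point depends
  only on the wall as a set, so every equation gives the same answer and one may be fixed.\<close>

lemma separates_wall_iff:
  assumes "wall_normal r L" and "\<alpha> \<in> rspace r" and "\<beta> \<in> rspace r"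
  shows "separates r (wall r L \<gamma>) \<alpha> \<beta> \<longleftrightarrow> (lin_form r L \<alpha> \<le> \<gamma>) \<noteq> (lin_form r L \<beta> \<le> \<gamma>)"
proof
  assume "separates r (wall r L \<gamma>) \<alpha> \<beta>"
  then obtain L' \<gamma>' where "wall_normal r L'" "wall r L \<gamma> = wall r L' \<gamma>'"
      "(lin_form r L' \<alpha> \<le> \<gamma>') \<noteq> (lin_form r L' \<beta> \<le> \<gamma>')"
    unfolding separates_def by (metis not_le)
  then show "(lin_form r L \<alpha> \<le> \<gamma>) \<noteq> (lin_form r L \<beta> \<le> \<gamma>)"
    using assms(1-3) lin_form_le_iff_below_wall by (metis (no_types))
next
  assume "(lin_form r L \<alpha> \<le> \<gamma>) \<noteq> (lin_form r L \<beta> \<le> \<gamma>)"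
  then show "separates r (wall r L \<gamma>) \<alpha> \<beta>"
    unfolding separates_def by (intro exI[of _ L] exI[of _ \<gamma>] conjI) (use assms(1) in auto)
qed

lemma mem_wall_iff: "\<alpha> \<in> rspace r \<Longrightarrow> \<alpha> \<in> wall r L \<gamma> \<longleftrightarrow> lin_form r L \<alpha> = \<gamma>"
  by (simp add: wall_def)

lemma separates_imp_wall:
  "separates r H \<alpha> \<beta> \<Longrightarrow> \<exists>L \<gamma>. wall_normal r L \<and> H = wall r L \<gamma>"
  by (auto simp: separates_def)

lemma separates_sym: "separates r H \<alpha> \<beta> \<longleftrightarrow> separates r H \<beta> \<alpha>"
  by (auto simp: separates_def)

lemma separates_cases:
  assumes "\<alpha> \<in> rspace r" "\<beta> \<in> rspace r" "\<gamma> \<in> rspace r" "separates r H \<alpha> \<gamma>"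
  shows "separates r H \<alpha> \<beta> \<or> separates r H \<beta> \<gamma>"
proof -
  obtain L g where "wall_normal r L" "H = wall r L g"
    using separates_imp_wall[OF assms(4)] by blast
  then show ?thesis
    using assms by (auto simp: separates_wall_iff)
qed

lemma same_chamber_sym: "same_chamber r \<W> \<alpha> \<beta> \<longleftrightarrow> same_chamber r \<W> \<beta> \<alpha>"
  by (simp add: same_chamber_def separates_sym)

lemma same_chamber_separates_eq:
  assumes "\<alpha> \<in> rspace r" "\<beta> \<in> rspace r" "\<alpha>' \<in> rspace r" "\<beta>' \<in> rspace r"
    and "same_chamber r \<W> \<alpha> \<alpha>'" "same_chamber r \<W> \<beta> \<beta>'"
  shows "{H\<in>\<W>. separates r H \<alpha> \<beta>} = {H\<in>\<W>. separates r H \<alpha>' \<beta>'}"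
proof -
  have "separates r H x' y'"
    if "H \<in> \<W>" "separates r H x y" "x \<in> rspace r" "y \<in> rspace r" "x' \<in> rspace r" "y' \<in> rspace r"
      "same_chamber r \<W> x x'" "same_chamber r \<W> y y'" for H x y x' y'
  proof -
    have n: "\<not> separates r H x x'" "\<not> separates r H y' y"
      using that(1,7,8) separates_sym[of r H y y'] unfolding same_chamber_def by auto
    have "separates r H x' y"
      using separates_cases[OF that(3,5,4,2)] n by simp
    from separates_cases[OF that(5,6,4) this] n show ?thesis by simp
  qed
  from this[of _ \<alpha> \<beta> \<alpha>' \<beta>'] this[of _ \<alpha>' \<beta>' \<alpha> \<beta>]
  show ?thesis
    using assms same_chamber_sym[of r \<W> \<alpha> \<alpha>'] same_chamber_sym[of r \<W> \<beta> \<beta>'] by auto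
qed

section \<open>Discreteness of a set of walls\<close>

lemma common_denominator:
  fixes L :: "nat \<Rightarrow> rat"
  obtains q :: nat where "q > 0" and "\<And>i. i < r \<Longrightarrow> real q * of_rat (L i) \<in> \<int>"
proof -
  have "\<exists>q::nat. q > 0 \<and> (\<forall>i<r. real q * of_rat (L i) \<in> \<int>)"
  proof (induction r)
    case 0
    then show ?case by (auto intro: exI[of _ 1])
  next
    case (Suc r)
    then obtain q where q: "q > 0" "\<forall>i<r. real q * of_rat (L i) \<in> \<int>" by blast
    obtain a b where ab: "quotient_of (L r) = (a, b)" by fastforce
    then have b: "b > 0" and eq: "L r = of_int a / of_int b"
      using quotient_of_denom_pos quotient_of_div by blast+
    have "real (q * nat b) * of_rat (L i) \<in> \<int>" if "i < Suc r" for i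
    proof (cases "i = r")
      case True
      have "real (q * nat b) * of_rat (L i) = of_int (int q * a)"
        using b by (simp add: True eq of_rat_divide)
      then show ?thesis by (metis Ints_of_int)
    next
      case False
      have "real (q * nat b) * of_rat (L i) = of_int b * (real q * of_rat (L i))"
        using b by simp
      then show ?thesis using q False that by (metis Ints_mult Ints_of_int less_SucE)
    qed
    then show ?case using q b by (intro exI[of _ "q * nat b"]) auto
  qed
  then show ?thesis using that by blast
qed

lemma lin_form_vshift:
  "lin_form r L (vshift n \<alpha>) = lin_form r L (\<lambda>i. of_int (n i)) + lin_form r L \<alpha>"
  by (simp add: lin_form_def vshift_def algebra_simps sum.distrib)

lemma vshift_rspace: "n \<in> zspace r \<Longrightarrow> \<alpha> \<in> rspace r \<Longrightarrow> vshift n \<alpha> \<in> rspace r"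
  by (simp add: vshift_def zspace_def rspace_def)

lemma vshift_wall:
  assumes "n \<in> zspace r"
  shows "vshift n ` wall r L \<gamma> = wall r L (\<gamma> + lin_form r L (\<lambda>i. of_int (n i)))"
proof
  show "vshift n ` wall r L \<gamma> \<subseteq> wall r L (\<gamma> + lin_form r L (\<lambda>i. of_int (n i)))"
    using assms by (auto simp: wall_def lin_form_vshift vshift_rspace)
next
  show "wall r L (\<gamma> + lin_form r L (\<lambda>i. of_int (n i))) \<subseteq> vshift n ` wall r L \<gamma>"
  proof
    fix h assume h: "h \<in> wall r L (\<gamma> + lin_form r L (\<lambda>i. of_int (n i)))"
    define g where "g = (\<lambda>i. h i - of_int (n i))"
    have hg: "h = vshift n g" by (auto simp: g_def vshift_def)
    have "g \<in> rspace r" using h assms by (auto simp: g_def wall_def rspace_def zspace_def)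
    moreover have "lin_form r L g = \<gamma>"
      using h lin_form_vshift[of r L n g] by (simp add: hg wall_def)
    ultimately show "h \<in> vshift n ` wall r L \<gamma>" by (auto simp: hg wall_def)
  qed
qed

text \<open>Rationality enters here: an integral translation changes \<open>lin_form r L\<close> by
  a multiple of 1/q, where q is a common denominator of the coefficients. Each of the finitely many
  classes of walls thus lies in a discrete family of parallel hyperplanes; such a family may also
  contain hyperplanes that are not walls.\<close>

lemma set_of_walls_lattice:
  assumes "set_of_walls r \<W>"
  obtains F :: "((nat \<Rightarrow> rat) \<times> real \<times> nat) set"
  where "finite F" and "\<forall>L \<gamma> q. (L, \<gamma>, q) \<in> F \<longrightarrow> wall_normal r L \<and> q > 0"
    and "\<forall>H\<in>\<W>. \<exists>L \<gamma> q (m::int). (L, \<gamma>, q) \<in> F \<and> H = wall r L (\<gamma> + m / q)"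
proof -
  have W: "\<forall>H\<in>\<W>. \<exists>L \<gamma>. wall_normal r L \<and> H = wall r L \<gamma>"
    using assms by (simp add: set_of_walls_def)
  obtain F where F: "F \<subseteq> \<W>" "finite F" "\<forall>H\<in>\<W>. \<exists>H0\<in>F. \<exists>n\<in>zspace r. H = vshift n ` H0"
    using assms unfolding set_of_walls_def by (elim conjE exE) auto
  have "\<exists>d. wall_normal r (fst d) \<and> H = wall r (fst d) (fst (snd d)) \<and> snd (snd d) > 0 \<and>
      (\<forall>i<r. real (snd (snd d)) * of_rat (fst d i) \<in> \<int>)" if HF: "H \<in> F" for H
  proof -
    obtain L \<gamma> where "wall_normal r L \<and> H = wall r L \<gamma>" using W F(1) HF by (meson subsetD)
    moreover obtain q :: nat where "q > 0" "\<And>i. i < r \<Longrightarrow> real q * of_rat (L i) \<in> \<int>"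
      using common_denominator by blast
    ultimately show ?thesis by (intro exI[of _ "(L, \<gamma>, q)"]) auto
  qed
  then have "\<forall>H\<in>F. \<exists>d. wall_normal r (fst d) \<and> H = wall r (fst d) (fst (snd d)) \<and> snd (snd d) > 0 \<and>
      (\<forall>i<r. real (snd (snd d)) * of_rat (fst d i) \<in> \<int>)" ..
  then have "\<exists>d. \<forall>H\<in>F. wall_normal r (fst (d H)) \<and> H = wall r (fst (d H)) (fst (snd (d H))) \<and>
      snd (snd (d H)) > 0 \<and> (\<forall>i<r. real (snd (snd (d H))) * of_rat (fst (d H) i) \<in> \<int>)"
    by (rule bchoice)
  then obtain d where "\<forall>H\<in>F. wall_normal r (fst (d H)) \<and> H = wall r (fst (d H)) (fst (snd (d H))) \<and>
      snd (snd (d H)) > 0 \<and> (\<forall>i<r. real (snd (snd (d H))) * of_rat (fst (d H) i) \<in> \<int>)" ..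
  note d = bspec[OF this]
  show ?thesis
  proof
    show "finite (d ` F)" using F by blast
    show "\<forall>L \<gamma> q. (L, \<gamma>, q) \<in> d ` F \<longrightarrow> wall_normal r L \<and> q > 0"
    proof (intro allI impI)
      fix L \<gamma> q assume "(L, \<gamma>, q) \<in> d ` F"
      then obtain H where "H \<in> F" "d H = (L, \<gamma>, q)" by auto
      then show "wall_normal r L \<and> q > 0" using d[of H] by simp
    qed
    show "\<forall>H\<in>\<W>. \<exists>L \<gamma> q (m::int). (L, \<gamma>, q) \<in> d ` F \<and> H = wall r L (\<gamma> + m / q)"
    proof
      fix H assume "H \<in> \<W>"
      then obtain H0 n where H0: "H0 \<in> F" "n \<in> zspace r" "H = vshift n ` H0"
        using F(3) by meson
      obtain L \<gamma> q where dH: "d H0 = (L, \<gamma>, q)" by (cases "d H0") auto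
      have q: "q > 0" "H0 = wall r L \<gamma>" "\<And>i. i < r \<Longrightarrow> real q * of_rat (L i) \<in> \<int>"
        using d[OF H0(1)] dH by auto
      have "real q * lin_form r L (\<lambda>i. of_int (n i)) =
          (\<Sum>i<r. (real q * of_rat (L i)) * of_int (n i))"
        by (simp add: lin_form_def sum_distrib_left algebra_simps)
      also have "\<dots> \<in> \<int>" using q(3) by (intro Ints_sum Ints_mult[OF _ Ints_of_int]) auto
      finally obtain m :: int where "real q * lin_form r L (\<lambda>i. of_int (n i)) = of_int m"
        by (auto elim: Ints_cases)
      then have "lin_form r L (\<lambda>i. of_int (n i)) = of_int m / real q"
        using q by (simp add: field_simps)
      then have "H = wall r L (\<gamma> + of_int m / real q)"
        using H0 q vshift_wall by simp
      moreover have "(L, \<gamma>, q) \<in> d ` F" using imageI[OF H0(1), of d] by (simp add: dH)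
      ultimately show "\<exists>L \<gamma> q (m::int). (L, \<gamma>, q) \<in> d ` F \<and> H = wall r L (\<gamma> + m / q)"
        by blast
    qed
  qed
qed

lemma finite_separating_walls:
  assumes "set_of_walls r \<W>" "\<alpha> \<in> rspace r" "\<beta> \<in> rspace r"
  shows "finite {H\<in>\<W>. separates r H \<alpha> \<beta>}"
proof -
  obtain F :: "((nat \<Rightarrow> rat) \<times> real \<times> nat) set" where F: "finite F"
    "\<forall>L \<gamma> q. (L, \<gamma>, q) \<in> F \<longrightarrow> wall_normal r L \<and> q > 0"
    "\<forall>H\<in>\<W>. \<exists>L \<gamma> q (m::int). (L, \<gamma>, q) \<in> F \<and> H = wall r L (\<gamma> + m / q)"
    by (rule set_of_walls_lattice[OF assms(1)]) (rule that)
  define lo where "lo L = min (lin_form r L \<alpha>) (lin_form r L \<beta>)" for L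
  define hi where "hi L = max (lin_form r L \<alpha>) (lin_form r L \<beta>)" for L
  \<comment> \<open>Rounding outwards only enlarges the range of \<open>m\<close>, which is harmless
    for an inclusion into a finite set.\<close>
  define G where "G = (\<lambda>(L, \<gamma>, q). (\<lambda>m::int. wall r L (\<gamma> + m / real q)) `
      {\<lfloor>real q * (lo L - \<gamma>)\<rfloor>..\<lceil>real q * (hi L - \<gamma>)\<rceil>})"
  have "{H\<in>\<W>. separates r H \<alpha> \<beta>} \<subseteq> (\<Union>d\<in>F. G d)"
  proof safe
    fix H assume H: "H \<in> \<W>" "separates r H \<alpha> \<beta>"
    obtain L \<gamma> q and m :: int where d: "(L, \<gamma>, q) \<in> F" "H = wall r L (\<gamma> + m / real q)"
      using bspec[OF F(3) H(1)] by blast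
    then have q: "q > 0" and L: "wall_normal r L" using F(2) by auto
    have "(lin_form r L \<alpha> \<le> \<gamma> + m / q) \<noteq> (lin_form r L \<beta> \<le> \<gamma> + m / q)"
      using H(2) separates_wall_iff[OF L assms(2,3)] d(2) by simp
    then have "lo L \<le> \<gamma> + m / q" "\<gamma> + m / q \<le> hi L"
      unfolding lo_def hi_def by linarith+
    then have "real q * (lo L - \<gamma>) \<le> m" "m \<le> real q * (hi L - \<gamma>)"
      using q by (auto simp: field_simps)
    then have "m \<in> {\<lfloor>real q * (lo L - \<gamma>)\<rfloor>..\<lceil>real q * (hi L - \<gamma>)\<rceil>}" by (auto; linarith)
    then have "H \<in> G (L, \<gamma>, q)" unfolding G_def d by auto
    then show "H \<in> (\<Union>d\<in>F. G d)" using d by blast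
  qed
  moreover have "finite (\<Union>d\<in>F. G d)" using F(1) by (auto simp: G_def)
  ultimately show ?thesis by (rule finite_subset)
qed

text \<open>Serves twice: for the gap between a point and finitely many families of walls, and for
  the radius of a polydisc inside a product of open sets.\<close>

lemma finite_uniform_positive:
  fixes P :: "'b \<Rightarrow> real \<Rightarrow> bool"
  assumes "finite F" and "\<And>d. d \<in> F \<Longrightarrow> \<exists>e>0. P d e"
    and "\<And>d e e'. d \<in> F \<Longrightarrow> P d e \<Longrightarrow> 0 < e' \<Longrightarrow> e' \<le> e \<Longrightarrow> P d e'"
  shows "\<exists>e>0. \<forall>d\<in>F. P d e"
  using assms
proof (induction F rule: finite_induct)
  case empty
  then show ?case by (auto intro: exI[of _ 1])
next
  case (insert d F)
  have "\<exists>e>0. \<forall>d\<in>F. P d e"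
    by (rule insert.IH) (use insert.prems in \<open>blast+\<close>)
  then obtain e where e: "e > 0" "\<forall>d\<in>F. P d e" by blast
  obtain e' where e': "e' > 0" "P d e'" using insert.prems(1)[of d] by blast
  have "P x (min e e')" if x: "x \<in> insert d F" for x
  proof (cases "x = d")
    case True
    then show ?thesis using insert.prems(2)[of d e' "min e e'"] e(1) e' by simp
  next
    case False
    then have "x \<in> F" using x by simp
    then show ?thesis using insert.prems(2)[of x e "min e e'"] e bspec[OF e(2)] e'(1) x by simp
  qed
  then show ?case using e(1) e'(1) by (intro exI[of _ "min e e'"]) simp
qed

text \<open>In a discrete family the levels different from that of \<alpha> keep a positive
  distance, and there are finitely many families. With the distance measured in units of
  \<open>lin_norm\<close>, a diagonal shift of \<alpha> by at most e, up or down, reaches no walls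
  except those through \<alpha>.\<close>

lemma wall_gap:
  assumes "set_of_walls r \<W>"
  obtains e where "e > 0" and "\<forall>H\<in>\<W>. \<exists>L \<gamma>. wall_normal r L \<and> H = wall r L \<gamma> \<and>
    (lin_form r L \<alpha> \<noteq> \<gamma> \<longrightarrow> e * lin_norm r L < \<bar>lin_form r L \<alpha> - \<gamma>\<bar>)"
proof -
  obtain F :: "((nat \<Rightarrow> rat) \<times> real \<times> nat) set" where F: "finite F"
    "\<forall>L \<gamma> q. (L, \<gamma>, q) \<in> F \<longrightarrow> wall_normal r L \<and> q > 0"
    "\<forall>H\<in>\<W>. \<exists>L \<gamma> q (m::int). (L, \<gamma>, q) \<in> F \<and> H = wall r L (\<gamma> + m / q)"
    by (rule set_of_walls_lattice[OF assms(1)]) (rule that)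
  have ex: "\<exists>e>0. \<forall>m::int. lin_form r L \<alpha> \<noteq> \<gamma> + m / q \<longrightarrow>
      e * lin_norm r L < \<bar>lin_form r L \<alpha> - (\<gamma> + m / q)\<bar>" if LF: "(L, \<gamma>, q) \<in> F" for L \<gamma> q
  proof -
    have q: "q > 0" and L: "wall_normal r L" using F(2) LF by auto
    define x where "x = real q * (lin_form r L \<alpha> - \<gamma>)"
    \<comment> \<open>Distances from x to the nearest integers strictly above and strictly below it;
      these stay positive when x itself is an integer.\<close>
    define e1 where "e1 = min (min (1 + \<lfloor>x\<rfloor> - x) (x - (\<lceil>x\<rceil> - 1))) 1"
    have e1: "e1 > 0" unfolding e1_def by linarith
    have gap: "e1 \<le> \<bar>x - m\<bar>" if "x \<noteq> m" for m :: int
    proof (cases "x < m")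
      case True
      then have "\<lfloor>x\<rfloor> + 1 \<le> m" by linarith
      then show ?thesis unfolding e1_def by linarith
    next
      case False
      then have "m \<le> \<lceil>x\<rceil> - 1" using that by linarith
      then show ?thesis unfolding e1_def by linarith
    qed
    show ?thesis
    \<comment> \<open>The factor 2 turns the bound by \<open>e1\<close> into a strict
      inequality.\<close>
    proof (intro exI[of _ "e1 / (2 * q * lin_norm r L)"] conjI allI impI)
      show "0 < e1 / (2 * q * lin_norm r L)" using e1 q lin_norm_pos[OF L] by simp
      fix m :: int assume ne: "lin_form r L \<alpha> \<noteq> \<gamma> + m / q"
      have xm: "x - m = q * (lin_form r L \<alpha> - (\<gamma> + m / q))"
        using q by (simp add: x_def field_simps)
      then have "x \<noteq> m" using ne q by auto
      then have "e1 \<le> \<bar>x - m\<bar>" by (rule gap)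
      then have "e1 \<le> q * \<bar>lin_form r L \<alpha> - (\<gamma> + m / q)\<bar>" unfolding xm by (simp add: abs_mult)
      then have "e1 / 2 < q * \<bar>lin_form r L \<alpha> - (\<gamma> + m / q)\<bar>" using e1 by linarith
      then show "e1 / (2 * q * lin_norm r L) * lin_norm r L < \<bar>lin_form r L \<alpha> - (\<gamma> + m / q)\<bar>"
        using q lin_norm_pos[OF L] by (simp add: field_simps)
    qed
  qed
  define P where "P = (\<lambda>(L, \<gamma>, q) e. \<forall>m::int. lin_form r L \<alpha> \<noteq> \<gamma> + m / real q \<longrightarrow>
      e * lin_norm r L < \<bar>lin_form r L \<alpha> - (\<gamma> + m / real q)\<bar>)"
  have P: "P (L, \<gamma>, q) e \<longleftrightarrow> (\<forall>m::int. lin_form r L \<alpha> \<noteq> \<gamma> + m / real q \<longrightarrow>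
      e * lin_norm r L < \<bar>lin_form r L \<alpha> - (\<gamma> + m / real q)\<bar>)" for L \<gamma> q e
    by (simp add: P_def)
  have "\<exists>e>0. \<forall>d\<in>F. P d e"
  proof (rule finite_uniform_positive[OF F(1)])
    fix d assume d: "d \<in> F"
    obtain L \<gamma> q where "d = (L, \<gamma>, q)" by (cases d) auto
    then show "\<exists>e>0. P d e" using ex d by (simp add: P)
  next
    fix d and e e' :: real assume d: "d \<in> F" and pos: "P d e" "0 < e'" "e' \<le> e"
    obtain L \<gamma> q where eq: "d = (L, \<gamma>, q)" by (cases d) auto
    then have "0 \<le> lin_norm r L" using F(2) d lin_norm_pos[of r L] by auto
    then have "e' * lin_norm r L \<le> e * lin_norm r L" using pos by (intro mult_right_mono)
    then show "P d e'" using pos(1) unfolding eq P by (meson le_less_trans)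
  qed
  then obtain e where e: "e > 0" "\<forall>d\<in>F. P d e" by blast
  show ?thesis
  proof (rule that[OF e(1)], rule ballI)
    fix H assume "H \<in> \<W>"
    from bspec[OF F(3) this] obtain L \<gamma> q and m :: int
      where d: "(L, \<gamma>, q) \<in> F" "H = wall r L (\<gamma> + m / real q)" by blast
    then show "\<exists>L \<gamma>. wall_normal r L \<and> H = wall r L \<gamma> \<and>
        (lin_form r L \<alpha> \<noteq> \<gamma> \<longrightarrow> e * lin_norm r L < \<bar>lin_form r L \<alpha> - \<gamma>\<bar>)"
      using F(2) bspec[OF e(2) d(1)] by (intro exI[of _ L] exI[of _ "\<gamma> + m / real q"]) (simp add: P)
  qed
qed

text \<open>The half-open convention of \<open>separates\<close> is decisive: a wall through
  \<alpha> has \<alpha> on its closed lower side, and going down stays on that side. The other walls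
  are kept away by \<open>wall_gap\<close>.\<close>

lemma same_chamber_below:
  assumes "set_of_walls r \<W>" and "\<alpha> \<in> rspace r"
  obtains e where "e > 0"
    and "\<forall>\<delta>\<in>rspace r. diag_shift r (- e) \<alpha> \<le> \<delta> \<longrightarrow> \<delta> \<le> \<alpha> \<longrightarrow> same_chamber r \<W> \<alpha> \<delta>"
proof -
  obtain e where e: "e > 0" "\<forall>H\<in>\<W>. \<exists>L \<gamma>. wall_normal r L \<and> H = wall r L \<gamma> \<and>
    (lin_form r L \<alpha> \<noteq> \<gamma> \<longrightarrow> e * lin_norm r L < \<bar>lin_form r L \<alpha> - \<gamma>\<bar>)"
    by (rule wall_gap[OF assms(1), of \<alpha>]) (rule that)
  have "same_chamber r \<W> \<alpha> \<delta>"
    if "\<delta> \<in> rspace r" "diag_shift r (- e) \<alpha> \<le> \<delta>" "\<delta> \<le> \<alpha>" for \<delta>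
    unfolding same_chamber_def
  proof
    fix H assume HW: "H \<in> \<W>"
    obtain L \<gamma> where H: "wall_normal r L" "H = wall r L \<gamma>"
      "lin_form r L \<alpha> \<noteq> \<gamma> \<longrightarrow> e * lin_norm r L < \<bar>lin_form r L \<alpha> - \<gamma>\<bar>"
      using bspec[OF e(2) HW] by blast
    have "lin_form r L \<delta> \<le> lin_form r L \<alpha>" "lin_form r L \<alpha> - e * lin_norm r L \<le> lin_form r L \<delta>"
      using lin_form_mono[OF H(1)] that lin_form_diag_shift[of r L "-e" \<alpha>] by fastforce+
    then have "lin_form r L \<alpha> \<le> \<gamma> \<longleftrightarrow> lin_form r L \<delta> \<le> \<gamma>"
      using H(3) by linarith
    then show "\<not> separates r H \<alpha> \<delta>" using H assms(2) that by (simp add: separates_wall_iff)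
  qed
  then show ?thesis using e(1) that by blast
qed

text \<open>Going up from a point of a wall leaves the closed lower side at once, while
  \<open>wall_gap\<close> prevents any other wall from being met.\<close>

lemma separates_diag_shift:
  assumes "set_of_walls r \<W>" and "\<alpha> \<in> rspace r"
  obtains e where "e > 0"
    and "\<forall>H\<in>\<W>. separates r H \<alpha> (diag_shift r e \<alpha>) \<longleftrightarrow> \<alpha> \<in> H"
proof -
  obtain e where e: "e > 0" "\<forall>H\<in>\<W>. \<exists>L \<gamma>. wall_normal r L \<and> H = wall r L \<gamma> \<and>
    (lin_form r L \<alpha> \<noteq> \<gamma> \<longrightarrow> e * lin_norm r L < \<bar>lin_form r L \<alpha> - \<gamma>\<bar>)"
    by (rule wall_gap[OF assms(1), of \<alpha>]) (rule that)
  have "separates r H \<alpha> (diag_shift r e \<alpha>) \<longleftrightarrow> \<alpha> \<in> H" if HW: "H \<in> \<W>" for H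
  proof -
    obtain L \<gamma> where H: "wall_normal r L" "H = wall r L \<gamma>"
      "lin_form r L \<alpha> \<noteq> \<gamma> \<longrightarrow> e * lin_norm r L < \<bar>lin_form r L \<alpha> - \<gamma>\<bar>"
      using bspec[OF e(2) HW] by blast
    have "0 < e * lin_norm r L" using e(1) lin_norm_pos[OF H(1)] by simp
    then show ?thesis
      using H assms(2) by (auto simp: separates_wall_iff mem_wall_iff lin_form_diag_shift)
  qed
  then show ?thesis using e(1) that by blast
qed

text \<open>A wall through the lowered point would have \<alpha> strictly above it and would
  separate the two points, although they share a chamber.\<close>

lemma off_walls_below:
  assumes "set_of_walls r \<W>" and "\<alpha> \<in> rspace r"
  obtains \<delta> where "\<delta> \<in> rspace r" and "same_chamber r \<W> \<alpha> \<delta>" and "\<forall>H\<in>\<W>. \<delta> \<notin> H"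
proof -
  obtain e where e: "e > 0"
    "\<forall>\<delta>\<in>rspace r. diag_shift r (- e) \<alpha> \<le> \<delta> \<longrightarrow> \<delta> \<le> \<alpha> \<longrightarrow> same_chamber r \<W> \<alpha> \<delta>"
    by (rule same_chamber_below[OF assms]) (rule that)
  let ?d = "diag_shift r (- e) \<alpha>" and ?d2 = "diag_shift r (- (e/2)) \<alpha>"
  have sc: "same_chamber r \<W> \<alpha> ?d" "same_chamber r \<W> \<alpha> ?d2"
    using e assms(2) diag_shift_mono[of _ 0 \<alpha> \<alpha> r] diag_shift_mono[of "-e" "-(e/2)" \<alpha> \<alpha> r] by auto
  have "?d2 \<notin> H" if HW: "H \<in> \<W>" for H
  proof
    assume mem: "?d2 \<in> H"
    obtain L \<gamma> where H: "wall_normal r L" "H = wall r L \<gamma>"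
      using HW assms(1) unfolding set_of_walls_def by meson
    have "\<not> separates r H \<alpha> ?d2" using sc that unfolding same_chamber_def by blast
    then have "lin_form r L \<alpha> \<le> \<gamma>"
      using mem H assms(2) by (auto simp: separates_wall_iff mem_wall_iff)
    moreover have "0 < e * lin_norm r L" using e(1) lin_norm_pos[OF H(1)] by simp
    ultimately show False using mem H assms(2) by (auto simp: mem_wall_iff lin_form_diag_shift)
  qed
  then show ?thesis using that[of ?d2] sc assms(2) by simp
qed

section \<open>Crossing walls along segments\<close>

definition segment_point :: "(nat \<Rightarrow> real) \<Rightarrow> (nat \<Rightarrow> real) \<Rightarrow> real \<Rightarrow> nat \<Rightarrow> real" where
  "segment_point \<alpha> \<beta> t = (\<lambda>i. (1 - t) * \<alpha> i + t * \<beta> i)"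

lemma segment_point_rspace [simp]:
  "\<alpha> \<in> rspace r \<Longrightarrow> \<beta> \<in> rspace r \<Longrightarrow> segment_point \<alpha> \<beta> t \<in> rspace r"
  by (simp add: segment_point_def)

lemma lin_form_segment_point:
  "lin_form r L (segment_point \<alpha> \<beta> t) = (1 - t) * lin_form r L \<alpha> + t * lin_form r L \<beta>"
  by (simp add: segment_point_def lin_form_lincomb)

lemma convex_comb_bounds:
  fixes a b t :: real
  assumes "0 \<le> t" "t \<le> 1"
  shows "min a b \<le> (1 - t) * a + t * b" "(1 - t) * a + t * b \<le> max a b"
proof -
  have "(1 - t) * min a b + t * min a b \<le> (1 - t) * a + t * b"
    using assms by (intro add_mono mult_left_mono) auto
  then show "min a b \<le> (1 - t) * a + t * b" by (simp add: algebra_simps)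
  have "(1 - t) * a + t * b \<le> (1 - t) * max a b + t * max a b"
    using assms by (intro add_mono mult_left_mono) auto
  then show "(1 - t) * a + t * b \<le> max a b" by (simp add: algebra_simps)
qed

lemma separates_segment:
  assumes "\<alpha> \<in> rspace r" "\<beta> \<in> rspace r" "0 \<le> t" "t \<le> 1"
    and "separates r H \<alpha> (segment_point \<alpha> \<beta> t) \<or> separates r H (segment_point \<alpha> \<beta> t) \<beta>"
  shows "separates r H \<alpha> \<beta>"
proof -
  obtain L \<gamma> where H: "wall_normal r L" "H = wall r L \<gamma>"
    using assms(5) separates_imp_wall by blast
  show ?thesis
    using assms(5) convex_comb_bounds[OF assms(3,4), of "lin_form r L \<alpha>" "lin_form r L \<beta>"] H assms(1,2)
    by (auto simp: separates_wall_iff lin_form_segment_point)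
qed

text \<open>The time at which the form reaches the level \<gamma> on the segment. It is meaningful
  for a separating wall, whose form takes different values at the end points.\<close>

definition crossing_time :: "nat \<Rightarrow> (nat \<Rightarrow> rat) \<Rightarrow> real \<Rightarrow> (nat \<Rightarrow> real) \<Rightarrow> (nat \<Rightarrow> real) \<Rightarrow> real" where
  "crossing_time r L \<gamma> \<alpha> \<beta> = (\<gamma> - lin_form r L \<alpha>) / (lin_form r L \<beta> - lin_form r L \<alpha>)"

text \<open>At the crossing time itself the point lies on the wall, and the direction of travel
  decides from which end it is separated; hence the strict inequalities on t.\<close>

lemma crossing_time:
  assumes "wall_normal r L" "\<alpha> \<in> rspace r" "\<beta> \<in> rspace r" "separates r (wall r L \<gamma>) \<alpha> \<beta>"
  shows "0 \<le> crossing_time r L \<gamma> \<alpha> \<beta>" "crossing_time r L \<gamma> \<alpha> \<beta> \<le> 1"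
    and "t < crossing_time r L \<gamma> \<alpha> \<beta> \<Longrightarrow> \<not> separates r (wall r L \<gamma>) \<alpha> (segment_point \<alpha> \<beta> t)"
    and "crossing_time r L \<gamma> \<alpha> \<beta> < t \<Longrightarrow> \<not> separates r (wall r L \<gamma>) (segment_point \<alpha> \<beta> t) \<beta>"
proof -
  let ?a = "lin_form r L \<alpha>" and ?b = "lin_form r L \<beta>" and ?t = "crossing_time r L \<gamma> \<alpha> \<beta>"
  have s: "?a \<le> \<gamma> \<and> \<gamma> < ?b \<or> ?b \<le> \<gamma> \<and> \<gamma> < ?a"
    using assms by (auto simp: separates_wall_iff)
  then have ne: "?b - ?a \<noteq> 0" by auto
  have tt: "?t * (?b - ?a) = \<gamma> - ?a" using ne by (simp add: crossing_time_def)
  show "0 \<le> ?t" "?t \<le> 1" using s by (auto simp: crossing_time_def field_simps)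
  \<comment> \<open>The excess over \<gamma> factors as time since crossing times slope, so its sign
    is known before and after the crossing.\<close>
  have eq: "(1 - t) * ?a + t * ?b = \<gamma> + (t - ?t) * (?b - ?a)"
    using tt by (simp add: algebra_simps)
  show "\<not> separates r (wall r L \<gamma>) \<alpha> (segment_point \<alpha> \<beta> t)" if "t < ?t"
  proof -
    have "(t - ?t) * (?b - ?a) \<le> 0 \<longleftrightarrow> ?a \<le> \<gamma>"
      using s that by (auto simp: mult_le_0_iff)
    then show ?thesis using assms by (simp add: separates_wall_iff lin_form_segment_point eq)
  qed
  show "\<not> separates r (wall r L \<gamma>) (segment_point \<alpha> \<beta> t) \<beta>" if "?t < t"
  proof -
    have "(t - ?t) * (?b - ?a) \<le> 0 \<longleftrightarrow> ?b \<le> \<gamma>"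
      using s that by (auto simp: mult_le_0_iff)
    then show ?thesis using assms by (simp add: separates_wall_iff lin_form_segment_point eq)
  qed
qed

lemma separates_imp_neq:
  assumes "wall_normal r L" "H = wall r L \<gamma>" "\<alpha> \<in> rspace r" "\<beta> \<in> rspace r" "separates r H \<alpha> \<beta>"
  shows "lin_form r L \<alpha> \<noteq> lin_form r L \<beta>"
  using assms by (auto simp: separates_wall_iff)

text \<open>Equal rates make the two forms proportional, and equal crossing times then make the
  levels proportional with the same factor. Read contrapositively, distinct walls crossed
  simultaneously have different rates in some coordinate.\<close>

lemma wall_eq_of_equal_crossing:
  assumes L: "wall_normal r L" "wall_normal r L'" and "\<alpha> \<in> rspace r" "\<beta> \<in> rspace r"
    and sep: "separates r (wall r L \<gamma>) \<alpha> \<beta>" "separates r (wall r L' \<gamma>') \<alpha> \<beta>"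
    and t: "crossing_time r L \<gamma> \<alpha> \<beta> = crossing_time r L' \<gamma>' \<alpha> \<beta>"
    and rate: "\<And>i. i < r \<Longrightarrow> of_rat (L i) / (lin_form r L \<beta> - lin_form r L \<alpha>) =
      (of_rat (L' i) / (lin_form r L' \<beta> - lin_form r L' \<alpha>) :: real)"
  shows "wall r L \<gamma> = wall r L' \<gamma>'"
proof -
  define a where "a = lin_form r L \<beta> - lin_form r L \<alpha>"
  define a' where "a' = lin_form r L' \<beta> - lin_form r L' \<alpha>"
  have a: "a \<noteq> 0" "a' \<noteq> 0"
    using separates_imp_neq[OF L(1) refl assms(3,4) sep(1)] separates_imp_neq[OF L(2) refl assms(3,4) sep(2)]
    by (auto simp: a_def a'_def)
  have form: "lin_form r L x / a = lin_form r L' x / a'" for x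
  proof -
    have "lin_form r L x / a = (\<Sum>i<r. (of_rat (L i) / a) * x i)"
      by (simp add: lin_form_def sum_divide_distrib)
    also have "\<dots> = (\<Sum>i<r. (of_rat (L' i) / a') * x i)"
      using rate by (simp add: a_def a'_def)
    also have "\<dots> = lin_form r L' x / a'"
      by (simp add: lin_form_def sum_divide_distrib)
    finally show ?thesis .
  qed
  have "(\<gamma> - lin_form r L \<alpha>) / a = (\<gamma>' - lin_form r L' \<alpha>) / a'"
    using t by (simp add: crossing_time_def a_def a'_def)
  then have "\<gamma> / a = \<gamma>' / a'" using form[of \<alpha>] by (simp add: diff_divide_distrib)
  then have "lin_form r L x = \<gamma> \<longleftrightarrow> lin_form r L' x = \<gamma>'" for x
    using form[of x] a by (metis nonzero_divide_eq_eq times_divide_eq_left nonzero_eq_divide_eq)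
  then show ?thesis by (simp add: wall_def)
qed

definition lower_coord :: "nat \<Rightarrow> real \<Rightarrow> (nat \<Rightarrow> real) \<Rightarrow> nat \<Rightarrow> real" where
  "lower_coord i e \<alpha> = \<alpha>(i := \<alpha> i - e)"

lemma lin_form_lower_coord:
  "i < r \<Longrightarrow> lin_form r L (lower_coord i e \<alpha>) = lin_form r L \<alpha> - e * of_rat (L i)"
proof -
  assume i: "i < r"
  have "lin_form r L (lower_coord i e \<alpha>) =
      (\<Sum>j<r. of_rat (L j) * \<alpha> j - (if j = i then e * of_rat (L i) else 0))"
    unfolding lin_form_def lower_coord_def by (intro sum.cong) (auto simp: algebra_simps)
  then show ?thesis using i by (simp add: sum_subtractf lin_form_def)
qed

lemma lower_coord_rspace: "i < r \<Longrightarrow> \<alpha> \<in> rspace r \<Longrightarrow> lower_coord i e \<alpha> \<in> rspace r"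
  by (auto simp: lower_coord_def rspace_def)

lemma same_chamber_lower_coord:
  assumes "set_of_walls r \<W>" and "\<alpha> \<in> rspace r" and "i < r"
  obtains d where "d > 0" and "\<forall>e. 0 \<le> e \<longrightarrow> e \<le> d \<longrightarrow> same_chamber r \<W> \<alpha> (lower_coord i e \<alpha>)"
proof -
  obtain d where d: "d > 0"
    "\<forall>\<delta>\<in>rspace r. diag_shift r (- d) \<alpha> \<le> \<delta> \<longrightarrow> \<delta> \<le> \<alpha> \<longrightarrow> same_chamber r \<W> \<alpha> \<delta>"
    by (rule same_chamber_below[OF assms(1,2)]) (rule that)
  have "\<forall>e. 0 \<le> e \<longrightarrow> e \<le> d \<longrightarrow> same_chamber r \<W> \<alpha> (lower_coord i e \<alpha>)"
    using assms(2,3) d(1) by (intro allI impI d(2)[rule_format] lower_coord_rspace) (auto simp: lower_coord_def diag_shift_def le_fun_def)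
  with d(1) show ?thesis by (rule that)
qed

text \<open>
  Lowering a coordinate of both end points shifts the crossing times of two distinct walls at
  different rates, so they can be crossed one after the other.
\<close>

lemma split_crossing:
  assumes W: "set_of_walls r \<W>" and ab: "\<alpha> \<in> rspace r" "\<beta> \<in> rspace r"
    and H: "H \<in> \<W>" "H' \<in> \<W>" "H \<noteq> H'" "separates r H \<alpha> \<beta>" "separates r H' \<alpha> \<beta>"
  obtains \<alpha>' \<beta>' t where "\<alpha>' \<in> rspace r" "\<beta>' \<in> rspace r" "0 \<le> t" "t \<le> 1"
    "same_chamber r \<W> \<alpha> \<alpha>'" "same_chamber r \<W> \<beta> \<beta>'"
    "\<exists>H0\<in>{H, H'}. \<not> separates r H0 \<alpha>' (segment_point \<alpha>' \<beta>' t)"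
    "\<exists>H0\<in>{H, H'}. \<not> separates r H0 (segment_point \<alpha>' \<beta>' t) \<beta>'"
proof -
  obtain L \<gamma> where L: "wall_normal r L" "H = wall r L \<gamma>" using separates_imp_wall[OF H(4)] by blast
  obtain L' \<gamma>' where L': "wall_normal r L'" "H' = wall r L' \<gamma>'" using separates_imp_wall[OF H(5)] by blast
  define D where "D \<alpha>' \<beta>' = (crossing_time r L \<gamma> \<alpha>' \<beta>' \<noteq> crossing_time r L' \<gamma>' \<alpha>' \<beta>')" for \<alpha>' \<beta>'
  have "\<exists>\<alpha>' \<beta>'. \<alpha>' \<in> rspace r \<and> \<beta>' \<in> rspace r \<and> same_chamber r \<W> \<alpha> \<alpha>' \<and> same_chamber r \<W> \<beta> \<beta>' \<and> D \<alpha>' \<beta>'"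
  proof (cases "D \<alpha> \<beta>")
    case True
    moreover have "same_chamber r \<W> \<alpha> \<alpha>" "same_chamber r \<W> \<beta> \<beta>"
      using ab by (auto simp: same_chamber_def separates_def)
    ultimately show ?thesis using ab by blast
  next
    case False
    let ?a = "lin_form r L \<beta> - lin_form r L \<alpha>" and ?a' = "lin_form r L' \<beta> - lin_form r L' \<alpha>"
    \<comment> \<open>If all rates agreed, the equal crossing times would force the two walls to
      coincide.\<close>
    obtain i where i: "i < r" "of_rat (L i) / ?a \<noteq> (of_rat (L' i) / ?a' :: real)"
      using wall_eq_of_equal_crossing[OF L(1) L'(1) ab] H False L L' unfolding D_def by blast
    obtain d where d: "d > 0" "\<forall>e. 0 \<le> e \<longrightarrow> e \<le> d \<longrightarrow> same_chamber r \<W> \<alpha> (lower_coord i e \<alpha>)"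
      by (rule same_chamber_lower_coord[OF W ab(1) i(1)]) (rule that)
    obtain d' where d': "d' > 0" "\<forall>e. 0 \<le> e \<longrightarrow> e \<le> d' \<longrightarrow> same_chamber r \<W> \<beta> (lower_coord i e \<beta>)"
      by (rule same_chamber_lower_coord[OF W ab(2) i(1)]) (rule that)
    define e where "e = min d d'"
    have e: "e > 0" "e \<le> d" "e \<le> d'" using d d' by (auto simp: e_def)
    let ?\<alpha> = "lower_coord i e \<alpha>" and ?\<beta> = "lower_coord i e \<beta>"
    \<comment> \<open>Both end points are lowered equally, so the slope is unchanged and the
      crossing time moves linearly in \<open>e\<close>, at the rate of coordinate
      \<open>i\<close>.\<close>
    have shift: "crossing_time r K g ?\<alpha> ?\<beta> = crossing_time r K g \<alpha> \<beta> +
        e * (of_rat (K i) / (lin_form r K \<beta> - lin_form r K \<alpha>))" for K g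
      by (simp add: crossing_time_def lin_form_lower_coord i(1) diff_divide_distrib add_divide_distrib)
    have "D ?\<alpha> ?\<beta>" using False i(2) e(1) unfolding D_def shift by (simp del: times_divide_eq_right)
    moreover have "?\<alpha> \<in> rspace r" "?\<beta> \<in> rspace r" using ab i lower_coord_rspace by auto
    ultimately show ?thesis using d(2) d'(2) e by (meson less_imp_le)
  qed
  then obtain \<alpha>' \<beta>' where ab': "\<alpha>' \<in> rspace r" "\<beta>' \<in> rspace r"
    and sc: "same_chamber r \<W> \<alpha> \<alpha>'" "same_chamber r \<W> \<beta> \<beta>'" and D: "D \<alpha>' \<beta>'" by blast
  have s: "separates r (wall r L \<gamma>) \<alpha>' \<beta>'" "separates r (wall r L' \<gamma>') \<alpha>' \<beta>'"
    using same_chamber_separates_eq[OF ab ab' sc] H L L' by blast+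
  let ?t = "crossing_time r L \<gamma> \<alpha>' \<beta>'" and ?t' = "crossing_time r L' \<gamma>' \<alpha>' \<beta>'"
  \<comment> \<open>Between the two crossing times one wall has been passed and the other has not,
    so each part of the segment misses one of them.\<close>
  define t where "t = (?t + ?t') / 2"
  note c = crossing_time[OF L(1) ab' s(1)] and c' = crossing_time[OF L'(1) ab' s(2)]
  have "0 \<le> t" "t \<le> 1" using c(1,2) c'(1,2) by (auto simp: t_def)
  moreover have "t < ?t \<and> ?t' < t \<or> t < ?t' \<and> ?t < t"
    using D unfolding D_def t_def by (auto simp: field_simps)
  then have "\<exists>H0\<in>{H, H'}. \<not> separates r H0 \<alpha>' (segment_point \<alpha>' \<beta>' t)"
    "\<exists>H0\<in>{H, H'}. \<not> separates r H0 (segment_point \<alpha>' \<beta>' t) \<beta>'"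
    using c(3,4)[of t] c'(3,4)[of t] L(2) L'(2) by blast+
  ultimately show ?thesis using that[OF ab' _ _ sc] by blast
qed

text \<open>Replaces end points in arbitrary position by comparable ones, as the nilpotency
  condition demands. Once the end points are moved off all walls, the point \<mu> where the segment
  meets the separating wall lies on no other wall, and a short diagonal step up from \<mu> crosses
  that wall alone.\<close>

lemma single_crossing:
  assumes W: "set_of_walls r \<W>" and ab: "\<alpha> \<in> rspace r" "\<beta> \<in> rspace r"
    and L: "wall_normal r L" and one: "{H\<in>\<W>. separates r H \<alpha> \<beta>} = {wall r L \<gamma>}"
  obtains \<mu> \<nu> where "\<mu> \<in> rspace r" "\<nu> \<in> rspace r" "\<mu> \<le> \<nu>" "{H\<in>\<W>. separates r H \<mu> \<nu>} = {wall r L \<gamma>}"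
    "same_chamber r \<W> \<alpha> \<mu> \<and> same_chamber r \<W> \<nu> \<beta> \<or> same_chamber r \<W> \<beta> \<mu> \<and> same_chamber r \<W> \<nu> \<alpha>"
proof -
  obtain \<alpha>' where \<alpha>': "\<alpha>' \<in> rspace r" "same_chamber r \<W> \<alpha> \<alpha>'" "\<forall>H\<in>\<W>. \<alpha>' \<notin> H"
    by (rule off_walls_below[OF W ab(1)]) (rule that)
  obtain \<beta>' where \<beta>': "\<beta>' \<in> rspace r" "same_chamber r \<W> \<beta> \<beta>'" "\<forall>H\<in>\<W>. \<beta>' \<notin> H"
    by (rule off_walls_below[OF W ab(2)]) (rule that)
  have one': "{H\<in>\<W>. separates r H \<alpha>' \<beta>'} = {wall r L \<gamma>}"
    using same_chamber_separates_eq[OF ab \<alpha>'(1) \<beta>'(1) \<alpha>'(2) \<beta>'(2)] one by simp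
  then have LW: "wall r L \<gamma> \<in> \<W>" and sep: "separates r (wall r L \<gamma>) \<alpha>' \<beta>'" by blast+
  define t where "t = crossing_time r L \<gamma> \<alpha>' \<beta>'"
  have t: "0 \<le> t" "t \<le> 1" using crossing_time(1,2)[OF L \<alpha>'(1) \<beta>'(1) sep] by (auto simp: t_def)
  define \<mu> where "\<mu> = segment_point \<alpha>' \<beta>' t"
  have \<mu>: "\<mu> \<in> rspace r" using \<alpha>'(1) \<beta>'(1) by (simp add: \<mu>_def)
  have form_\<mu>: "lin_form r L \<mu> = \<gamma>"
  proof -
    have ne: "lin_form r L \<beta>' - lin_form r L \<alpha>' \<noteq> 0"
      using separates_imp_neq[OF L refl \<alpha>'(1) \<beta>'(1) sep] by auto
    have "lin_form r L \<mu> = lin_form r L \<alpha>' + t * (lin_form r L \<beta>' - lin_form r L \<alpha>')"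
      by (simp add: \<mu>_def lin_form_segment_point algebra_simps)
    also have "\<dots> = \<gamma>" using ne by (simp add: t_def crossing_time_def)
    finally show ?thesis .
  qed
  \<comment> \<open>Another wall has both end points on the same side and passes through neither of
    them, so every point between them is strictly on that side as well.\<close>
  have mem_\<mu>: "\<mu> \<in> H \<longleftrightarrow> H = wall r L \<gamma>" if HW: "H \<in> \<W>" for H
  proof
    assume "H = wall r L \<gamma>"
    then show "\<mu> \<in> H" using \<mu> form_\<mu> by (simp add: mem_wall_iff)
  next
    assume mem: "\<mu> \<in> H"
    show "H = wall r L \<gamma>"
    proof (rule ccontr)
      assume "H \<noteq> wall r L \<gamma>"
      then have ns: "\<not> separates r H \<alpha>' \<beta>'" using one' HW by blast
      obtain K g where K: "wall_normal r K" "H = wall r K g"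
        using HW W unfolding set_of_walls_def by meson
      have ne: "lin_form r K \<alpha>' \<noteq> g" "lin_form r K \<beta>' \<noteq> g"
        using bspec[OF \<alpha>'(3) HW] bspec[OF \<beta>'(3) HW] \<alpha>'(1) \<beta>'(1) K(2) by (auto simp: mem_wall_iff)
      have "(lin_form r K \<alpha>' \<le> g) = (lin_form r K \<beta>' \<le> g)"
        using ns K \<alpha>'(1) \<beta>'(1) by (simp add: separates_wall_iff)
      then have "g < min (lin_form r K \<alpha>') (lin_form r K \<beta>') \<or> max (lin_form r K \<alpha>') (lin_form r K \<beta>') < g"
        using ne by auto
      then have "lin_form r K \<mu> \<noteq> g"
        using convex_comb_bounds[OF t, of "lin_form r K \<alpha>'" "lin_form r K \<beta>'"]
        unfolding \<mu>_def lin_form_segment_point by linarith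
      then show False using mem K \<mu> by (simp add: mem_wall_iff)
    qed
  qed
  obtain e where e: "e > 0" "\<forall>H\<in>\<W>. separates r H \<mu> (diag_shift r e \<mu>) \<longleftrightarrow> \<mu> \<in> H"
    by (rule separates_diag_shift[OF W \<mu>]) (rule that)
  define \<nu> where "\<nu> = diag_shift r e \<mu>"
  have \<nu>: "\<nu> \<in> rspace r" "\<mu> \<le> \<nu>"
    using \<mu> diag_shift_mono[of 0 e \<mu> \<mu> r] e(1) by (auto simp: \<nu>_def)
  have one\<mu>: "{H\<in>\<W>. separates r H \<mu> \<nu>} = {wall r L \<gamma>}"
    using e(2) mem_\<mu> LW by (auto simp: \<nu>_def)
  have other: "\<not> separates r H \<mu> x \<and> \<not> separates r H \<nu> x"
    if HW: "H \<in> \<W>" "H \<noteq> wall r L \<gamma>" and x: "x \<in> {\<alpha>', \<beta>'}" for H x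
  proof -
    have ns: "\<not> separates r H \<alpha>' \<beta>'" using one' HW by blast
    have "\<not> separates r H \<mu> x"
      using separates_segment[OF \<alpha>'(1) \<beta>'(1) t, of H] ns x separates_sym[of r H \<mu>] by (auto simp: \<mu>_def)
    moreover have "\<not> separates r H \<nu> \<mu>" using one\<mu> HW separates_sym[of r H \<nu>] by blast
    ultimately show ?thesis using separates_cases[of \<nu> r \<mu> x H] \<nu> \<mu> \<alpha>'(1) \<beta>'(1) x by blast
  qed
  have chamber: "same_chamber r \<W> \<mu> x \<and> same_chamber r \<W> \<nu> y"
    if xy: "x \<in> {\<alpha>', \<beta>'}" "y \<in> {\<alpha>', \<beta>'}" "lin_form r L x \<le> \<gamma>" "\<not> lin_form r L y \<le> \<gamma>" for x y
  proof -
    have r: "x \<in> rspace r" "y \<in> rspace r" using xy \<alpha>'(1) \<beta>'(1) by auto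
    have "\<not> separates r (wall r L \<gamma>) \<mu> x" using xy(3) form_\<mu> \<mu> r L by (simp add: separates_wall_iff)
    moreover have "\<not> lin_form r L \<nu> \<le> \<gamma>"
      using form_\<mu> mult_pos_pos[OF e(1) lin_norm_pos[OF L]] by (simp add: \<nu>_def lin_form_diag_shift not_le)
    then have "\<not> separates r (wall r L \<gamma>) \<nu> y" using xy(4) \<nu> r L by (simp add: separates_wall_iff)
    ultimately show ?thesis using other xy unfolding same_chamber_def by metis
  qed
  have trans: "same_chamber r \<W> x z" if "same_chamber r \<W> x y" "same_chamber r \<W> y z"
    "x \<in> rspace r" "y \<in> rspace r" "z \<in> rspace r" for x y z
    using separates_cases[of x r y z] that unfolding same_chamber_def by metis
  have "same_chamber r \<W> \<alpha> \<mu> \<and> same_chamber r \<W> \<nu> \<beta> \<or> same_chamber r \<W> \<beta> \<mu> \<and> same_chamber r \<W> \<nu> \<alpha>"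
  proof (cases "lin_form r L \<alpha>' \<le> \<gamma>")
    case True
    then have "\<not> lin_form r L \<beta>' \<le> \<gamma>" using sep \<alpha>'(1) \<beta>'(1) L by (simp add: separates_wall_iff)
    then have "same_chamber r \<W> \<mu> \<alpha>'" "same_chamber r \<W> \<nu> \<beta>'" using chamber True by blast+
    then show ?thesis
      using trans[OF \<alpha>'(2), of \<mu>] trans[of \<nu> \<beta>' \<beta>] \<alpha>' \<beta>' ab \<mu> \<nu> same_chamber_sym by metis
  next
    case False
    then have "lin_form r L \<beta>' \<le> \<gamma>" using sep \<alpha>'(1) \<beta>'(1) L by (simp add: separates_wall_iff)
    then have "same_chamber r \<W> \<mu> \<beta>'" "same_chamber r \<W> \<nu> \<alpha>'" using chamber False by blast+
    then show ?thesis
      using trans[OF \<beta>'(2), of \<mu>] trans[of \<nu> \<alpha>' \<alpha>] \<alpha>' \<beta>' ab \<mu> \<nu> same_chamber_sym by metis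
  qed
  then show ?thesis using that \<mu> \<nu> one\<mu> by blast
qed

text \<open>Induction on the number of separating walls. If there are at least two,
  \<open>split_crossing\<close> yields an intermediate point such that each part is separated by a
  proper subset of them. The set \<open>T\<close> records which walls may be crossed, and
  \<open>Q\<close> is kept abstract so that it can later mean transport by an operator outside a
  prime ideal.\<close>

lemma chamber_path:
  assumes W: "set_of_walls r \<W>"
    and same: "\<And>\<mu> \<nu>. \<mu> \<in> rspace r \<Longrightarrow> \<nu> \<in> rspace r \<Longrightarrow> same_chamber r \<W> \<mu> \<nu> \<Longrightarrow> Q \<mu> \<nu>"
    and trans: "\<And>\<mu> \<nu> \<xi>. Q \<mu> \<nu> \<Longrightarrow> Q \<nu> \<xi> \<Longrightarrow> Q \<mu> \<xi>"
    and step: "\<And>\<mu> \<nu> L \<gamma>. \<mu> \<in> rspace r \<Longrightarrow> \<nu> \<in> rspace r \<Longrightarrow> \<mu> \<le> \<nu> \<Longrightarrow> wall_normal r L \<Longrightarrow>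
      wall r L \<gamma> \<in> T \<Longrightarrow> {H\<in>\<W>. separates r H \<mu> \<nu>} = {wall r L \<gamma>} \<Longrightarrow> Q \<mu> \<nu> \<and> Q \<nu> \<mu>"
    and ab: "\<alpha> \<in> rspace r" "\<beta> \<in> rspace r" and T: "{H\<in>\<W>. separates r H \<alpha> \<beta>} \<subseteq> T"
  shows "Q \<alpha> \<beta>"
  using ab T
proof (induction "card {H\<in>\<W>. separates r H \<alpha> \<beta>}" arbitrary: \<alpha> \<beta> rule: less_induct)
  case less
  note ab = less.prems(1,2)
  let ?S = "{H\<in>\<W>. separates r H \<alpha> \<beta>}"
  consider "?S = {}" | H where "?S = {H}" | H H' where "H \<in> ?S" "H' \<in> ?S" "H \<noteq> H'" by blast
  then show ?case
  proof cases
    case 1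
    then show ?thesis using same ab unfolding same_chamber_def by blast
  next
    case 2
    then obtain L \<gamma> where L: "wall_normal r L" "H = wall r L \<gamma>" using separates_imp_wall[of r H \<alpha> \<beta>] by blast
    have one: "?S = {wall r L \<gamma>}" using 2 L by simp
    obtain \<mu> \<nu> where mn: "\<mu> \<in> rspace r" "\<nu> \<in> rspace r" "\<mu> \<le> \<nu>" "{H\<in>\<W>. separates r H \<mu> \<nu>} = {wall r L \<gamma>}"
      "same_chamber r \<W> \<alpha> \<mu> \<and> same_chamber r \<W> \<nu> \<beta> \<or> same_chamber r \<W> \<beta> \<mu> \<and> same_chamber r \<W> \<nu> \<alpha>"
      by (rule single_crossing[OF W ab L(1) one]) (rule that)
    have "Q \<mu> \<nu>" "Q \<nu> \<mu>" using step[OF mn(1-3) L(1) _ mn(4)] less.prems(3) one by blast+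
    then show ?thesis using mn(5) same[OF ab(1) mn(1)] same[OF mn(2) ab(2)] same[OF ab(1) mn(2)]
        same[OF mn(1) ab(2)] same_chamber_sym trans by metis
  next
    case 3
    obtain \<alpha>' \<beta>' t where a': "\<alpha>' \<in> rspace r" "\<beta>' \<in> rspace r" and t: "0 \<le> t" "t \<le> 1"
      and sc: "same_chamber r \<W> \<alpha> \<alpha>'" "same_chamber r \<W> \<beta> \<beta>'"
      and n: "\<exists>H0\<in>{H, H'}. \<not> separates r H0 \<alpha>' (segment_point \<alpha>' \<beta>' t)"
        "\<exists>H0\<in>{H, H'}. \<not> separates r H0 (segment_point \<alpha>' \<beta>' t) \<beta>'"
      using 3 by (elim CollectE conjE split_crossing[OF W ab, of H H']) (assumption | rule that)+
    define \<mu> where "\<mu> = segment_point \<alpha>' \<beta>' t"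
    have \<mu>: "\<mu> \<in> rspace r" using a' by (simp add: \<mu>_def)
    have eq: "?S = {H\<in>\<W>. separates r H \<alpha>' \<beta>'}" by (rule same_chamber_separates_eq[OF ab a' sc])
    have sub: "{H\<in>\<W>. separates r H \<alpha>' \<mu>} \<subseteq> ?S" "{H\<in>\<W>. separates r H \<mu> \<beta>'} \<subseteq> ?S"
      using separates_segment[OF a' t] unfolding eq \<mu>_def by blast+
    have "{H\<in>\<W>. separates r H \<alpha>' \<mu>} \<subset> ?S" "{H\<in>\<W>. separates r H \<mu> \<beta>'} \<subset> ?S"
      using sub n 3 unfolding \<mu>_def by blast+
    then have c: "card {H\<in>\<W>. separates r H \<alpha>' \<mu>} < card ?S" "card {H\<in>\<W>. separates r H \<mu> \<beta>'} < card ?S"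
      using finite_separating_walls[OF W ab] by (simp_all add: psubset_card_mono)
    have "Q \<alpha>' \<mu>" "Q \<mu> \<beta>'"
      using less.hyps[OF c(1) a'(1) \<mu>] less.hyps[OF c(2) \<mu> a'(2)] sub less.prems(3) by blast+
    moreover have "Q \<alpha> \<alpha>'" "Q \<beta>' \<beta>"
      using same[OF ab(1) a'(1) sc(1)] same[OF a'(2) ab(2)] sc(2) same_chamber_sym by blast+
    ultimately show ?thesis using trans by blast
  qed
qed

section \<open>Affine forms and prime ideals\<close>

text \<open>Zorn's lemma for ideals that avoid the unit: this condition survives unions of chains,
  and an ideal maximal with respect to it is a maximal ideal.\<close>

lemma (in cring) exists_maximalideal:
  assumes "ideal I R" "\<one> \<notin> I"
  obtains J where "maximalideal J R" "I \<subseteq> J" "\<one> \<notin> J"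
proof -
  let ?A = "{J. ideal J R \<and> I \<subseteq> J \<and> \<one> \<notin> J}"
  have "\<exists>J\<in>?A. \<forall>K\<in>?A. J \<subseteq> K \<longrightarrow> K = J"
  proof (rule subset_Zorn_nonempty)
    show "?A \<noteq> {}" using assms by blast
  next
    fix C assume C: "C \<noteq> {}" "subset.chain ?A C"
    then have "subset.chain {J. ideal J R} C" unfolding subset_chain_def by blast
    from chain_Union_is_ideal[OF this] have "ideal (\<Union>C) R" using C(1) by simp
    then show "\<Union>C \<in> ?A" using C unfolding subset_chain_def by blast
  qed
  then obtain J where J: "ideal J R" "I \<subseteq> J" "\<one> \<notin> J"
    and max: "\<forall>K\<in>?A. J \<subseteq> K \<longrightarrow> K = J" by blast
  have "maximalideal J R"
  proof (rule maximalidealI[OF J(1)])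
    show "carrier R \<noteq> J" using J(3) by auto
  next
    fix K assume K: "ideal K R" "J \<subseteq> K" "K \<subseteq> carrier R"
    show "K = J \<or> K = carrier R"
    proof (cases "\<one> \<in> K")
      case True
      then show ?thesis using ideal.one_imp_carrier[OF K(1)] by blast
    next
      case False
      then show ?thesis using max K J by blast
    qed
  qed
  then show ?thesis using J that by blast
qed

text \<open>Hahn-Banach in coordinates: \<open>X\<close> is the graph of a linear functional on a subspace of \<open>\<real>\<^sup>r\<close>.\<close>

lemma linear_graph_extension:
  fixes X :: "(nat \<Rightarrow> real) \<Rightarrow> real \<Rightarrow> bool"
  assumes "\<And>a c a' c' k. X a c \<Longrightarrow> X a' c' \<Longrightarrow> X (\<lambda>i. a i + k * a' i) (c + k * c')"
    and "\<And>a c. X a c \<Longrightarrow> \<forall>i<r. a i = 0 \<Longrightarrow> c = 0"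
  shows "\<exists>l\<in>rspace r. \<forall>a c. X a c \<longrightarrow> (\<Sum>i<r. a i * l i) = c"
  using assms
proof (induction r arbitrary: X)
  case 0
  have "(\<lambda>i. 0) \<in> rspace 0" by (simp add: rspace_def)
  then show ?case using "0.prems"(2) by auto
next
  case (Suc r)
  \<comment> \<open>The value l is forced by any vector of the subspace supported on the last
    coordinate; if that coordinate is always zero on such vectors, l = 0 is chosen.\<close>
  have "\<exists>l. \<forall>a c. X a c \<longrightarrow> (\<forall>i<r. a i = 0) \<longrightarrow> c = a r * l"
  proof (cases "\<exists>a c. X a c \<and> (\<forall>i<r. a i = 0) \<and> a r \<noteq> 0")
    case True
    then obtain a0 c0 where a0: "X a0 c0" "\<forall>i<r. a0 i = 0" "a0 r \<noteq> 0" by blast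
    have "c = a r * (c0 / a0 r)" if a: "X a c" "\<forall>i<r. a i = 0" for a c
    proof -
      have "X (\<lambda>i. a i + (- a r / a0 r) * a0 i) (c + (- a r / a0 r) * c0)"
        by (rule Suc.prems(1)[OF a(1) a0(1)])
      moreover have "\<forall>i<Suc r. a i + (- a r / a0 r) * a0 i = 0"
        using a a0 by (auto simp: less_Suc_eq)
      ultimately have "c + (- a r / a0 r) * c0 = 0" by (rule Suc.prems(2))
      then show ?thesis by simp
    qed
    then show ?thesis by blast
  next
    case False
    then have "c = a r * 0" if "X a c" "\<forall>i<r. a i = 0" for a c
      using Suc.prems(2)[of a c] that by (auto simp: less_Suc_eq)
    then show ?thesis by blast
  qed
  then obtain l where l: "\<And>a c. X a c \<Longrightarrow> \<forall>i<r. a i = 0 \<Longrightarrow> c = a r * l" by blast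
  \<comment> \<open>Subtracting the contribution of the last coordinate leaves the graph of a
    functional of the first \<open>r\<close> coordinates, as the induction hypothesis
    requires.\<close>
  let ?X = "\<lambda>a c. X a (c + a r * l)"
  have "\<exists>m\<in>rspace r. \<forall>a c. ?X a c \<longrightarrow> (\<Sum>i<r. a i * m i) = c"
  proof (rule Suc.IH)
    fix a c a' c' k assume "?X a c" "?X a' c'"
    from Suc.prems(1)[OF this, of k]
    show "X (\<lambda>i. a i + k * a' i) (c + k * c' + (a r + k * a' r) * l)"
      by (simp add: algebra_simps)
  next
    fix a c assume "?X a c" "\<forall>i<r. a i = 0"
    from l[OF this] show "c = 0" by simp
  qed
  then obtain m where m: "m \<in> rspace r" "\<And>a c. ?X a c \<Longrightarrow> (\<Sum>i<r. a i * m i) = c" by blast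
  have "(\<Sum>i<Suc r. a i * (m(r := l)) i) = c" if "X a c" for a c
    using m(2)[of a "c - a r * l"] that by simp
  moreover have "m(r := l) \<in> rspace (Suc r)" using m(1) by (auto simp: rspace_def)
  ultimately show ?case by blast
qed

text \<open>Separates the algebraic argument from sheaves and operators. \<open>S\<close> stands for
  a commutative ring of differential operators over a fixed open set, \<open>X\<close> for the
  sections there, and \<open>cst\<close> for the scalars, given as a unital homomorphism from the
  complex numbers.\<close>

locale affine_forms = left_module S X + cring S
  for S :: "'a ring" (structure) and X :: "('a, 'x, 'e) module_scheme" (structure) +
  fixes r :: nat and s :: "nat \<Rightarrow> 'a" and cst :: "complex \<Rightarrow> 'a"
  assumes s_closed [simp]: "i < r \<Longrightarrow> s i \<in> carrier S"
    and cst_closed [simp]: "cst c \<in> carrier S"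
    and cst_add: "cst (c + d) = cst c \<oplus>\<^bsub>S\<^esub> cst d"
    and cst_mult: "cst (c * d) = cst c \<otimes>\<^bsub>S\<^esub> cst d"
    and cst_1: "cst 1 = \<one>\<^bsub>S\<^esub>"
begin

text \<open>Real coefficients are enough because walls have real normals; the constant stays complex
  because the \<gamma>_j are complex numbers with prescribed real part.\<close>

definition form :: "(nat \<Rightarrow> real) \<Rightarrow> complex \<Rightarrow> 'a" where
  "form a c = (\<Oplus>\<^bsub>S\<^esub>i\<in>{..<r}. cst (of_real (a i)) \<otimes>\<^bsub>S\<^esub> s i) \<oplus>\<^bsub>S\<^esub> cst c"

lemma linear_part_closed [simp]: "(\<Oplus>\<^bsub>S\<^esub>i\<in>{..<r}. cst (a i) \<otimes>\<^bsub>S\<^esub> s i) \<in> carrier S"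
  by (rule R.finsum_closed) auto

lemma form_closed [simp]: "form a c \<in> carrier S"
  by (simp add: form_def)

lemma form_lincomb:
  "form (\<lambda>i. a i + k * a' i) (c + of_real k * c') = form a c \<oplus>\<^bsub>S\<^esub> cst (of_real k) \<otimes>\<^bsub>S\<^esub> form a' c'"
proof -
  have "(\<Oplus>\<^bsub>S\<^esub>i\<in>{..<r}. cst (of_real (a i + k * a' i)) \<otimes>\<^bsub>S\<^esub> s i) =
      (\<Oplus>\<^bsub>S\<^esub>i\<in>{..<r}. cst (of_real (a i)) \<otimes>\<^bsub>S\<^esub> s i \<oplus>\<^bsub>S\<^esub>
        cst (of_real k) \<otimes>\<^bsub>S\<^esub> (cst (of_real (a' i)) \<otimes>\<^bsub>S\<^esub> s i))"
    by (rule R.finsum_cong') (auto simp: cst_add cst_mult R.l_distr R.m_assoc)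
  also have "\<dots> = (\<Oplus>\<^bsub>S\<^esub>i\<in>{..<r}. cst (of_real (a i)) \<otimes>\<^bsub>S\<^esub> s i) \<oplus>\<^bsub>S\<^esub>
      cst (of_real k) \<otimes>\<^bsub>S\<^esub> (\<Oplus>\<^bsub>S\<^esub>i\<in>{..<r}. cst (of_real (a' i)) \<otimes>\<^bsub>S\<^esub> s i)"
    by (subst R.finsum_addf) (auto simp: R.finsum_rdistr)
  finally show ?thesis
    by (simp add: form_def cst_add cst_mult R.r_distr R.a_ac)
qed

lemma form_zero: "\<forall>i<r. a i = 0 \<Longrightarrow> form a c = cst c"
proof -
  assume a: "\<forall>i<r. a i = 0"
  have "cst 0 \<oplus>\<^bsub>S\<^esub> cst 0 = cst 0" using cst_add[of 0 0] by simp
  then have "cst 0 = \<zero>\<^bsub>S\<^esub>" using R.add.l_cancel_one[of "cst 0" "cst 0"] by simp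
  then have "(\<Oplus>\<^bsub>S\<^esub>i\<in>{..<r}. cst (of_real (a i)) \<otimes>\<^bsub>S\<^esub> s i) = (\<Oplus>\<^bsub>S\<^esub>i\<in>{..<r}. \<zero>\<^bsub>S\<^esub>)"
    using a by (intro R.finsum_cong') auto
  then show ?thesis by (simp add: form_def)
qed

text \<open>
  A substitute for the Nullstellensatz: instead of a complex zero \<open>s\<close> of \<open>J\<close>, only a point \<open>l\<close> in the
  role of \<open>-Re s\<close> is needed, since walls are real.
\<close>

lemma ideal_real_point:
  assumes J: "ideal J S" and "\<one>\<^bsub>S\<^esub> \<notin> J"
  obtains l where "l \<in> rspace r" "\<forall>a c. form a c \<in> J \<longrightarrow> (\<Sum>i<r. a i * l i) = Re c"
proof -
  interpret J: ideal J S by fact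
  \<comment> \<open>Only real parts of constants are recorded. By \<open>form_lincomb\<close> this
    is a real subspace; it is a graph because a nonzero constant is a unit and lies in no proper
    ideal.\<close>
  let ?X = "\<lambda>a q. \<exists>c. form a c \<in> J \<and> Re c = q"
  have "\<exists>l\<in>rspace r. \<forall>a q. ?X a q \<longrightarrow> (\<Sum>i<r. a i * l i) = q"
  proof (rule linear_graph_extension)
    fix a c a' c' and k :: real
    assume "?X a c" "?X a' c'"
    then obtain z z' where z: "form a z \<in> J" "Re z = c" "form a' z' \<in> J" "Re z' = c'" by blast
    have "form (\<lambda>i. a i + k * a' i) (z + of_real k * z') \<in> J"
      unfolding form_lincomb using z by (intro J.a_closed J.I_l_closed) auto
    then show "?X (\<lambda>i. a i + k * a' i) (c + k * c')"
      using z by (intro exI[of _ "z + of_real k * z'"]) simp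
  next
    fix a q assume "?X a q" and a: "\<forall>i<r. a i = 0"
    then obtain c where c: "form a c \<in> J" "Re c = q" by blast
    show "q = 0"
    proof (rule ccontr)
      assume "q \<noteq> 0"
      then have "c \<noteq> 0" using c by auto
      then have "\<one>\<^bsub>S\<^esub> = cst (1 / c) \<otimes>\<^bsub>S\<^esub> cst c" using cst_mult[of "1/c" c] by (simp add: cst_1)
      moreover have "cst (1 / c) \<otimes>\<^bsub>S\<^esub> cst c \<in> J"
        using c(1) a by (intro J.I_l_closed) (simp_all add: form_zero)
      ultimately show False using assms(2) by simp
    qed
  qed
  then show ?thesis using that by blast
qed

definition form_prod :: "(nat \<Rightarrow> rat) \<Rightarrow> complex list \<Rightarrow> 'a" where
  "form_prod L gs = foldr (\<lambda>g P. form (\<lambda>i. of_rat (L i)) g \<otimes>\<^bsub>S\<^esub> P) gs \<one>\<^bsub>S\<^esub>"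

lemma form_prod_closed [simp]: "form_prod L gs \<in> carrier S"
  by (induction gs) (auto simp: form_prod_def)

lemma form_prod_notin_prime:
  assumes "primeideal J S" and "\<And>g. g \<in> set gs \<Longrightarrow> form (\<lambda>i. of_rat (L i)) g \<notin> J"
  shows "form_prod L gs \<notin> J"
  using assms(2)
proof (induction gs)
  case Nil
  interpret primeideal J S by fact
  show ?case using I_notcarr one_imp_carrier by (auto simp: form_prod_def)
next
  case (Cons g gs)
  interpret primeideal J S by fact
  have eq: "form_prod L (g # gs) = form (\<lambda>i. of_rat (L i)) g \<otimes>\<^bsub>S\<^esub> form_prod L gs"
    by (simp add: form_prod_def)
  have "form_prod L gs \<notin> J" using Cons by simp
  then show ?case
    unfolding eq using I_prime[OF form_closed form_prod_closed] Cons.prems[of g] by auto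
qed

text \<open>What a multivariate V-filtration provides at one point, stripped of sheaves and
  differential operators. The last clause is the nilpotency condition, written with
  \<open>form_prod\<close>.\<close>

definition wall_filtration :: "(nat \<Rightarrow> real) set set \<Rightarrow> ((nat \<Rightarrow> real) \<Rightarrow> 'x set) \<Rightarrow> bool" where
  "wall_filtration \<W> G \<longleftrightarrow> set_of_walls r \<W> \<and> (\<forall>\<mu>\<in>rspace r. G \<mu> \<subseteq> carrier X) \<and>
     (\<forall>\<mu>\<in>rspace r. \<forall>\<nu>\<in>rspace r. same_chamber r \<W> \<mu> \<nu> \<longrightarrow> G \<mu> = G \<nu>) \<and>
     (\<forall>\<mu>\<in>rspace r. \<forall>\<nu>\<in>rspace r. \<mu> \<le> \<nu> \<longrightarrow> G \<nu> \<subseteq> G \<mu>) \<and>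
     (\<forall>\<mu>\<in>rspace r. \<forall>\<nu>\<in>rspace r. \<forall>L \<gamma>. \<mu> \<le> \<nu> \<longrightarrow> wall_normal r L \<longrightarrow>
       {H\<in>\<W>. separates r H \<mu> \<nu>} = {wall r L \<gamma>} \<longrightarrow>
       (\<exists>gs. (\<forall>g\<in>set gs. Re g = \<gamma>) \<and> (\<forall>v\<in>G \<mu>. form_prod L gs \<odot>\<^bsub>X\<^esub> v \<in> G \<nu>)))"

text \<open>Crossing a wall upwards is done by a product of forms, crossing it downwards by the
  unit. The walls crossed avoid l, so each operator is outside \<open>J\<close>, and so is their
  product because \<open>J\<close> is prime.\<close>

lemma wall_filtration_path:
  assumes G: "wall_filtration \<W> G" and J: "primeideal J S"
    and l: "l \<in> rspace r" "\<forall>a c. form a c \<in> J \<longrightarrow> (\<Sum>i<r. a i * l i) = Re c"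
    and mn: "\<mu> \<in> rspace r" "\<nu> \<in> rspace r" "\<forall>H\<in>\<W>. separates r H \<mu> \<nu> \<longrightarrow> l \<notin> H"
  obtains P where "P \<in> carrier S" "P \<notin> J" "\<forall>v\<in>G \<mu>. P \<odot>\<^bsub>X\<^esub> v \<in> G \<nu>"
proof -
  interpret J: primeideal J S by fact
  have W: "set_of_walls r \<W>" and GX: "\<And>\<mu>. \<mu> \<in> rspace r \<Longrightarrow> G \<mu> \<subseteq> carrier X"
    and same: "\<And>\<mu> \<nu>. \<mu> \<in> rspace r \<Longrightarrow> \<nu> \<in> rspace r \<Longrightarrow> same_chamber r \<W> \<mu> \<nu> \<Longrightarrow> G \<mu> = G \<nu>"
    and anti: "\<And>\<mu> \<nu>. \<mu> \<in> rspace r \<Longrightarrow> \<nu> \<in> rspace r \<Longrightarrow> \<mu> \<le> \<nu> \<Longrightarrow> G \<nu> \<subseteq> G \<mu>"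
    and cross: "\<And>\<mu> \<nu> L \<gamma>. \<mu> \<in> rspace r \<Longrightarrow> \<nu> \<in> rspace r \<Longrightarrow> \<mu> \<le> \<nu> \<Longrightarrow> wall_normal r L \<Longrightarrow>
       {H\<in>\<W>. separates r H \<mu> \<nu>} = {wall r L \<gamma>} \<Longrightarrow>
       (\<exists>gs. (\<forall>g\<in>set gs. Re g = \<gamma>) \<and> (\<forall>v\<in>G \<mu>. form_prod L gs \<odot>\<^bsub>X\<^esub> v \<in> G \<nu>))"
    using G unfolding wall_filtration_def by simp_all
  have one: "\<one>\<^bsub>S\<^esub> \<notin> J" using J.I_notcarr J.one_imp_carrier by auto
  \<comment> \<open>Membership of \<mu> in \<open>rspace r\<close> is part of \<open>Q\<close>,
    since the composition of two steps needs \<open>G \<mu>\<close> to consist of elements of the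
    module.\<close>
  define Q where "Q \<mu> \<nu> \<longleftrightarrow> \<mu> \<in> rspace r \<and> (\<exists>P\<in>carrier S - J. \<forall>v\<in>G \<mu>. P \<odot>\<^bsub>X\<^esub> v \<in> G \<nu>)" for \<mu> \<nu>
  have sub: "Q \<mu> \<nu>" if mn: "\<mu> \<in> rspace r" "G \<mu> \<subseteq> G \<nu>" for \<mu> \<nu>
  proof -
    have "\<one>\<^bsub>S\<^esub> \<odot>\<^bsub>X\<^esub> v \<in> G \<nu>" if v: "v \<in> G \<mu>" for v
    proof -
      have "v \<in> carrier X" by (rule subsetD[OF GX[OF mn(1)] v])
      moreover have "v \<in> G \<nu>" by (rule subsetD[OF mn(2) v])
      ultimately show ?thesis by (simp add: smult_one)
    qed
    then show ?thesis unfolding Q_def using mn(1) one by (intro conjI bexI[of _ "\<one>\<^bsub>S\<^esub>"]) auto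
  qed
  have "Q \<mu> \<nu>"
  proof (rule chamber_path[OF W, where T = "{H. l \<notin> H}"])
    fix \<mu> \<nu> assume "\<mu> \<in> rspace r" "\<nu> \<in> rspace r" "same_chamber r \<W> \<mu> \<nu>"
    then show "Q \<mu> \<nu>" using same sub by blast
  next
    fix \<mu> \<nu> \<xi> assume "Q \<mu> \<nu>" "Q \<nu> \<xi>"
    then obtain P P' where m: "\<mu> \<in> rspace r" and P: "P \<in> carrier S" "P \<notin> J" "\<forall>v\<in>G \<mu>. P \<odot>\<^bsub>X\<^esub> v \<in> G \<nu>"
      and P': "P' \<in> carrier S" "P' \<notin> J" "\<forall>v\<in>G \<nu>. P' \<odot>\<^bsub>X\<^esub> v \<in> G \<xi>" unfolding Q_def by (elim conjE bexE DiffE) (rule that)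
    have "\<forall>v\<in>G \<mu>. (P' \<otimes>\<^bsub>S\<^esub> P) \<odot>\<^bsub>X\<^esub> v \<in> G \<xi>"
    proof
      fix v assume v: "v \<in> G \<mu>"
      then have "(P' \<otimes>\<^bsub>S\<^esub> P) \<odot>\<^bsub>X\<^esub> v = P' \<odot>\<^bsub>X\<^esub> (P \<odot>\<^bsub>X\<^esub> v)" using GX[OF m] P(1) P'(1) smult_assoc by auto
      then show "(P' \<otimes>\<^bsub>S\<^esub> P) \<odot>\<^bsub>X\<^esub> v \<in> G \<xi>" using v P(3) P'(3) by simp
    qed
    moreover have "P' \<otimes>\<^bsub>S\<^esub> P \<in> carrier S - J" using P P' J.I_prime by auto
    ultimately show "Q \<mu> \<xi>" unfolding Q_def using m by blast
  next
    fix \<mu> \<nu> L \<gamma> assume A: "\<mu> \<in> rspace r" "\<nu> \<in> rspace r" "\<mu> \<le> \<nu>" "wall_normal r L"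
      "wall r L \<gamma> \<in> {H. l \<notin> H}" "{H\<in>\<W>. separates r H \<mu> \<nu>} = {wall r L \<gamma>}"
    obtain gs where gs: "\<forall>g\<in>set gs. Re g = \<gamma>" "\<forall>v\<in>G \<mu>. form_prod L gs \<odot>\<^bsub>X\<^esub> v \<in> G \<nu>"
      using cross[OF A(1-4,6)] by blast
    \<comment> \<open>A factor in \<open>J\<close> would put l on the wall, by the choice of l and
      because the real part of every \<open>g\<close> is the level \<gamma>.\<close>
    have "form (\<lambda>i. of_rat (L i)) g \<notin> J" if g: "g \<in> set gs" for g
    proof
      assume "form (\<lambda>i. of_rat (L i)) g \<in> J"
      then have "lin_form r L l = \<gamma>" using l(2) gs(1) g unfolding lin_form_def by fastforce
      then show False using A(5) l(1) by (simp add: mem_wall_iff)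
    qed
    then have "form_prod L gs \<notin> J" by (rule form_prod_notin_prime[OF J])
    then have "Q \<mu> \<nu>" unfolding Q_def using gs(2) A(1) form_prod_closed by blast
    moreover have "Q \<nu> \<mu>" using sub[OF A(2) anti[OF A(1-3)]] .
    ultimately show "Q \<mu> \<nu> \<and> Q \<nu> \<mu>" ..
  qed (use mn in auto)
  then show ?thesis using that unfolding Q_def by blast
qed

text \<open>Here \<open>segment_point l \<alpha> k\<close> is the dilation of \<alpha> about l by
  the factor k, which may exceed 1. If the wall passed through l, the dilation would multiply the
  excess of the form over \<gamma> by k > 0 and hence preserve sides.\<close>

lemma radial_separates:
  assumes "l \<in> rspace r" "\<alpha> \<in> rspace r" "k > 0" "separates r H \<alpha> (segment_point l \<alpha> k)"
  shows "l \<notin> H"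
proof
  assume l: "l \<in> H"
  obtain L \<gamma> where L: "wall_normal r L" "H = wall r L \<gamma>" using separates_imp_wall[OF assms(4)] by blast
  have "lin_form r L l = \<gamma>" using l L assms(1) by (simp add: mem_wall_iff)
  then have "lin_form r L (segment_point l \<alpha> k) = \<gamma> + k * (lin_form r L \<alpha> - \<gamma>)"
    by (simp add: lin_form_segment_point algebra_simps)
  then have "lin_form r L (segment_point l \<alpha> k) \<le> \<gamma> \<longleftrightarrow> lin_form r L \<alpha> \<le> \<gamma>"
    using assms(3) by (auto simp: mult_le_0_iff)
  then show False using assms L by (simp add: separates_wall_iff)
qed

text \<open>The steps of \<open>G'\<close> are stable under \<open>S\<close>, which makes the
  operators sending u into \<open>G' \<alpha>\<close> an ideal. The conclusion is one inclusion;
  equality of two filtrations comes from exchanging their roles.\<close>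

theorem wall_filtration_subset:
  assumes G: "wall_filtration \<W> G" and G': "wall_filtration \<W>' G'"
    and sub: "\<And>\<mu>. \<mu> \<in> rspace r \<Longrightarrow> subgroup (G' \<mu>) (add_monoid X)"
    and stable: "\<And>\<mu> P v. \<mu> \<in> rspace r \<Longrightarrow> P \<in> carrier S \<Longrightarrow> v \<in> G' \<mu> \<Longrightarrow> P \<odot>\<^bsub>X\<^esub> v \<in> G' \<mu>"
    and N: "N \<ge> 0" "\<And>\<mu>. \<mu> \<in> rspace r \<Longrightarrow> G \<mu> \<subseteq> G' (diag_shift r (- N) \<mu>)"
    and \<alpha>: "\<alpha> \<in> rspace r"
  shows "G \<alpha> \<subseteq> G' \<alpha>"
proof
  fix u assume u: "u \<in> G \<alpha>"
  have "\<forall>\<mu>\<in>rspace r. G \<mu> \<subseteq> carrier X" using G unfolding wall_filtration_def by (elim conjE)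
  then have uX: "u \<in> carrier X" using u \<alpha> by auto
  define I where "I = {P \<in> carrier S. P \<odot>\<^bsub>X\<^esub> u \<in> G' \<alpha>}"
  have \<alpha>_sub: "subgroup (G' \<alpha>) (add_monoid X)" by (rule sub[OF \<alpha>])
  have addc: "x \<oplus>\<^bsub>X\<^esub> y \<in> G' \<alpha>" if "x \<in> G' \<alpha>" "y \<in> G' \<alpha>" for x y
    using subgroup.m_closed[OF \<alpha>_sub that] by simp
  have "ideal I S"
  proof (rule idealI[OF R.ring_axioms])
    show "subgroup I (add_monoid S)"
    proof (rule R.add.subgroupI)
      show "I \<subseteq> carrier S" by (auto simp: I_def)
      have "(\<zero>\<^bsub>S\<^esub> \<oplus>\<^bsub>S\<^esub> \<zero>\<^bsub>S\<^esub>) \<odot>\<^bsub>X\<^esub> u = \<zero>\<^bsub>S\<^esub> \<odot>\<^bsub>X\<^esub> u \<oplus>\<^bsub>X\<^esub> \<zero>\<^bsub>S\<^esub> \<odot>\<^bsub>X\<^esub> u"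
        by (rule smult_l_distr) (auto simp: uX)
      then have z: "\<zero>\<^bsub>S\<^esub> \<odot>\<^bsub>X\<^esub> u = \<zero>\<^bsub>X\<^esub>"
        using M.add.l_cancel_one[of "\<zero>\<^bsub>S\<^esub> \<odot>\<^bsub>X\<^esub> u" "\<zero>\<^bsub>S\<^esub> \<odot>\<^bsub>X\<^esub> u"] smult_closed uX by simp
      have "\<zero>\<^bsub>X\<^esub> \<in> G' \<alpha>" using subgroup.one_closed[OF \<alpha>_sub] by simp
      then show "I \<noteq> {}" using z by (auto simp: I_def)
    next
      fix a assume a: "a \<in> I"
      have "\<ominus>\<^bsub>S\<^esub> a = (\<ominus>\<^bsub>S\<^esub> \<one>\<^bsub>S\<^esub>) \<otimes>\<^bsub>S\<^esub> a" using a by (simp add: I_def R.l_minus)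
      then have "(\<ominus>\<^bsub>S\<^esub> a) \<odot>\<^bsub>X\<^esub> u = (\<ominus>\<^bsub>S\<^esub> \<one>\<^bsub>S\<^esub>) \<odot>\<^bsub>X\<^esub> (a \<odot>\<^bsub>X\<^esub> u)"
        using a smult_assoc[of "\<ominus>\<^bsub>S\<^esub> \<one>\<^bsub>S\<^esub>" a u] uX by (simp add: I_def)
      then show "\<ominus>\<^bsub>S\<^esub> a \<in> I" using a stable[OF \<alpha>, of "\<ominus>\<^bsub>S\<^esub> \<one>\<^bsub>S\<^esub>"] by (simp add: I_def)
    next
      fix a b assume "a \<in> I" "b \<in> I"
      then show "a \<oplus>\<^bsub>S\<^esub> b \<in> I"
        using addc smult_l_distr[of a b u] uX by (simp add: I_def)
    qed
    show "x \<otimes>\<^bsub>S\<^esub> a \<in> I" if "a \<in> I" "x \<in> carrier S" for a x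
      using that smult_assoc[of x a u] uX stable[OF \<alpha>] by (simp add: I_def)
    then show "a \<otimes>\<^bsub>S\<^esub> x \<in> I" if "a \<in> I" "x \<in> carrier S" for a x
      using that m_comm by (simp add: I_def)
  qed
  show "u \<in> G' \<alpha>"
  proof (rule ccontr)
    assume "u \<notin> G' \<alpha>"
    then have "\<one>\<^bsub>S\<^esub> \<notin> I" using smult_one[OF uX] by (simp add: I_def)
    then obtain J where J: "maximalideal J S" "I \<subseteq> J" "\<one>\<^bsub>S\<^esub> \<notin> J"
      using exists_maximalideal[OF \<open>ideal I S\<close>] by blast
    then have prime: "primeideal J S" by (intro maximalideal_prime)
    interpret J: primeideal J S by fact
    obtain l where l: "l \<in> rspace r" "\<forall>a c. form a c \<in> J \<longrightarrow> (\<Sum>i<r. a i * l i) = Re c"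
      by (rule ideal_real_point[OF J.is_ideal J(3)]) (rule that)
    have W': "set_of_walls r \<W>'" using G' unfolding wall_filtration_def by (elim conjE)
    obtain e where e: "e > 0"
      "\<forall>\<delta>\<in>rspace r. diag_shift r (- e) \<alpha> \<le> \<delta> \<longrightarrow> \<delta> \<le> \<alpha> \<longrightarrow> same_chamber r \<W>' \<alpha> \<delta>"
      by (rule same_chamber_below[OF W' \<alpha>]) (rule that)
    \<comment> \<open>Chosen so that N/k \<le> e, which keeps \<alpha> lowered by N/k in its
      chamber; the summand 1 keeps k positive when N = 0.\<close>
    define k where "k = N / e + 1"
    have k: "k > 0" "N / k \<le> e"
      using N(1) e(1) by (auto simp: k_def field_simps add_nonneg_pos intro: add_nonneg_pos)
    define \<alpha>' where "\<alpha>' = diag_shift r (- (N / k)) \<alpha>"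
    have \<alpha>': "\<alpha>' \<in> rspace r" using \<alpha> by (simp add: \<alpha>'_def)
    have "diag_shift r (- e) \<alpha> \<le> \<alpha>'" "\<alpha>' \<le> \<alpha>"
      using k N(1) diag_shift_mono[of "-e" "-(N/k)" \<alpha> \<alpha> r] diag_shift_mono[of "-(N/k)" 0 \<alpha> \<alpha> r]
      by (auto simp: \<alpha>'_def)
    then have "same_chamber r \<W>' \<alpha> \<alpha>'" using e(2) \<alpha>' by blast
    moreover have "\<forall>\<mu>\<in>rspace r. \<forall>\<nu>\<in>rspace r. same_chamber r \<W>' \<mu> \<nu> \<longrightarrow> G' \<mu> = G' \<nu>"
      using G' unfolding wall_filtration_def by (elim conjE)
    ultimately have eq: "G' \<alpha> = G' \<alpha>'" using \<alpha> \<alpha>' by simp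
    let ?\<beta> = "segment_point l \<alpha> k" and ?\<beta>' = "segment_point l \<alpha>' k"
    have \<beta>: "?\<beta> \<in> rspace r" "?\<beta>' \<in> rspace r" using l \<alpha> \<alpha>' by auto
    \<comment> \<open>Dilation by k magnifies the shift N/k to N: the loss in passing from
      \<open>G\<close> to \<open>G'\<close> at the far point is exactly accounted for by starting
      the way back towards \<alpha>'.\<close>
    have shift: "diag_shift r (- N) ?\<beta> = ?\<beta>'"
      using k(1) by (auto simp: segment_point_def diag_shift_def \<alpha>'_def algebra_simps)
    obtain P where P: "P \<in> carrier S" "P \<notin> J" "\<forall>v\<in>G \<alpha>. P \<odot>\<^bsub>X\<^esub> v \<in> G ?\<beta>"
      by (rule wall_filtration_path[OF G prime l \<alpha> \<beta>(1)])
        (use radial_separates[OF l(1) \<alpha> k(1)] in blast, rule that)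
    obtain P' where P': "P' \<in> carrier S" "P' \<notin> J" "\<forall>v\<in>G' ?\<beta>'. P' \<odot>\<^bsub>X\<^esub> v \<in> G' \<alpha>'"
      by (rule wall_filtration_path[OF G' prime l \<beta>(2) \<alpha>'])
        (use radial_separates[OF l(1) \<alpha>' k(1)] separates_sym in blast, rule that)
    have "P \<odot>\<^bsub>X\<^esub> u \<in> G' ?\<beta>'" using P(3) u N(2)[OF \<beta>(1)] unfolding shift by blast
    then have "P' \<odot>\<^bsub>X\<^esub> (P \<odot>\<^bsub>X\<^esub> u) \<in> G' \<alpha>" using P'(3) eq by simp
    then have "P' \<otimes>\<^bsub>S\<^esub> P \<in> I" using smult_assoc[OF P'(1) P(1) uX] P(1) P'(1) by (simp add: I_def)
    then show False using J(2) J.I_prime[OF P'(1) P(1)] P(2) P'(2) by blast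
  qed
qed

end

section \<open>Holomorphic functions of several variables\<close>

lemma cball_subset_ball:
  fixes x :: "'a::metric_space"
  assumes "x \<in> ball a e"
  obtains d where "d > 0" "cball x d \<subseteq> ball a e"
  using assms open_ball open_contains_cball by blast

text \<open>By compactness of a closed disc, f p is uniformly close to f p0 on it for p near p0;
  Cauchy's estimate turns this into closeness of the derivatives.\<close>

lemma continuous_on_deriv_param:
  fixes f :: "'p::topological_space \<Rightarrow> complex \<Rightarrow> complex"
  assumes cont: "continuous_on (P \<times> ball a e) (\<lambda>(p, t). f p t)"
    and hol: "\<And>p. p \<in> P \<Longrightarrow> f p holomorphic_on ball a e"
  shows "continuous_on (P \<times> ball a e) (\<lambda>(p, t). deriv (f p) t)"
  unfolding continuous_on_def tendsto_iff
proof (intro ballI allI impI, clarify)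
  fix p0 t0 and eps :: real
  assume p0: "p0 \<in> P" and t0: "t0 \<in> ball a e" and eps: "eps > 0"
  obtain d where d: "d > 0" "cball t0 d \<subseteq> ball a e"
    by (rule cball_subset_ball[OF t0]) (rule that)
  \<comment> \<open>Half the radius, so that closed discs of radius \<rho> about points within
    \<rho> of t0 stay inside the compact disc of radius d.\<close>
  define \<rho> where "\<rho> = d / 2"
  have \<rho>: "\<rho> > 0" using d by (simp add: \<rho>_def)
  have "continuous_on (P \<times> cball t0 d) (\<lambda>(p, t). f p t)"
    by (rule continuous_on_subset[OF cont]) (use d in auto)
  \<comment> \<open>The tolerance contains \<rho> because Cauchy's estimate will divide by the
    radius.\<close>
  then obtain X where X: "p0 \<in> X" "open X"
    "\<forall>p\<in>X \<inter> P. \<forall>t\<in>cball t0 d. dist ((\<lambda>(p, t). f p t) (p, t)) ((\<lambda>(p, t). f p t) (p0, t)) \<le> eps * \<rho> / 2"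
    by (rule continuous_on_prod_compactE[where e = "eps * \<rho> / 2"]) (use p0 eps \<rho> in auto)
  have "deriv (f p0) holomorphic_on ball a e"
    using hol[OF p0] by (intro holomorphic_deriv) auto
  then have "continuous (at t0) (deriv (f p0))"
    using t0 holomorphic_on_imp_continuous_on continuous_on_eq_continuous_at open_ball by blast
  then obtain \<delta> where \<delta>: "\<delta> > 0" "\<And>t. dist t t0 < \<delta> \<Longrightarrow> dist (deriv (f p0) t) (deriv (f p0) t0) < eps / 2"
    using eps unfolding continuous_at_eps_delta by (metis half_gt_zero)
  have near: "dist (deriv (f p) t) (deriv (f p0) t0) < eps"
    if p: "p \<in> X" "p \<in> P" and t: "t \<in> ball t0 (min \<rho> \<delta>)" for p t
  proof -
    have sub: "cball t \<rho> \<subseteq> cball t0 d"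
    proof
      fix x assume "x \<in> cball t \<rho>"
      moreover have "dist t0 t < \<rho>" using t by simp
      ultimately show "x \<in> cball t0 d" using dist_triangle[of t0 x t] by (simp add: \<rho>_def)
    qed
    then have sub': "cball t \<rho> \<subseteq> ball a e" using d(2) by blast
    let ?g = "\<lambda>w. f p w - f p0 w"
    have holg: "?g holomorphic_on ball a e" using hol p(2) p0 by (intro holomorphic_intros) auto
    have tb: "t \<in> ball a e" by (rule subsetD[OF sub']) (use \<rho> in simp)
    have diff: "f q field_differentiable at t" if "q \<in> P" for q
      by (rule holomorphic_on_imp_differentiable_at[OF hol[OF that] open_ball tb])
    have "cmod ((deriv ^^ 1) ?g t) \<le> fact 1 * (eps * \<rho> / 2) / \<rho> ^ 1"
    proof (rule Cauchy_inequality[OF _ _ \<rho>])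
      show "?g holomorphic_on ball t \<rho>"
        by (rule holomorphic_on_subset[OF holg]) (use sub' ball_subset_cball in blast)
      show "continuous_on (cball t \<rho>) ?g"
        by (rule holomorphic_on_imp_continuous_on[OF holomorphic_on_subset[OF holg sub']])
      show "cmod (?g x) \<le> eps * \<rho> / 2" if "cmod (t - x) = \<rho>" for x
      proof -
        have "x \<in> cball t \<rho>" using that by (simp add: dist_norm)
        then have "x \<in> cball t0 d" using sub by blast
        then show ?thesis using X(3) p by (auto simp: dist_norm)
      qed
    qed
    also have "fact 1 * (eps * \<rho> / 2) / \<rho> ^ 1 = eps / 2" using \<rho> by simp
    also have "(deriv ^^ 1) ?g t = deriv (f p) t - deriv (f p0) t"
      using diff[OF p(2)] diff[OF p0] by simp
    finally have "dist (deriv (f p) t) (deriv (f p0) t) \<le> eps / 2" by (simp add: dist_norm)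
    moreover have "dist (deriv (f p0) t) (deriv (f p0) t0) < eps / 2"
      using \<delta>(2)[of t] t by (simp add: dist_commute)
    ultimately show ?thesis
      using dist_triangle[of "deriv (f p) t" "deriv (f p0) t0" "deriv (f p0) t"] by linarith
  qed
  show "\<forall>\<^sub>F x in at (p0, t0) within P \<times> ball a e.
      dist (case x of (p, t) \<Rightarrow> deriv (f p) t) (deriv (f p0) t0) < eps"
    unfolding eventually_at_topological
    by (rule exI[of _ "X \<times> ball t0 (min \<rho> \<delta>)"]) (use near X \<rho> \<delta>(1) in \<open>auto intro: open_Times\<close>)
qed

text \<open>Mean value inequality for \<open>g t - c * t\<close>, whose derivative is small on the
  convex set.\<close>

lemma field_differentiable_approx:
  fixes g :: "complex \<Rightarrow> complex"
  assumes "convex B" "\<And>t. t \<in> B \<Longrightarrow> g field_differentiable at t" "\<And>t. t \<in> B \<Longrightarrow> cmod (deriv g t - c) \<le> eps"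
    and "x \<in> B" "y \<in> B"
  shows "cmod (g x - g y - c * (x - y)) \<le> eps * cmod (x - y)"
proof -
  have "cmod ((\<lambda>t. g t - c * t) x - (\<lambda>t. g t - c * t) y) \<le> eps * cmod (x - y)"
  proof (rule field_differentiable_bound[OF assms(1)])
    fix t assume t: "t \<in> B"
    have "(g has_field_derivative deriv g t) (at t)"
      using assms(2)[OF t] field_differentiable_derivI by blast
    then show "((\<lambda>t. g t - c * t) has_field_derivative deriv g t - c) (at t within B)"
      by (rule has_field_derivative_at_within[OF DERIV_diff[OF _ DERIV_cmult_Id]])
    show "cmod (deriv g t - c) \<le> eps" by (rule assms(3)[OF t])
  qed (use assms in auto)
  then show ?thesis by (simp add: algebra_simps)
qed

text \<open>Models a function of several variables in which all but two coordinates are frozen.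
  Joint continuity makes estimates in one variable uniform in the other.\<close>

locale two_variable_holomorphic =
  fixes f :: "complex \<Rightarrow> complex \<Rightarrow> complex" and a b :: complex and e :: real
  assumes cont: "continuous_on (ball a e \<times> ball b e) (\<lambda>(w, t). f w t)"
    and hol1: "t \<in> ball b e \<Longrightarrow> (\<lambda>w. f w t) holomorphic_on ball a e"
    and hol2: "w \<in> ball a e \<Longrightarrow> f w holomorphic_on ball b e"
begin

text \<open>The difference quotients in t are holomorphic in w and converge locally uniformly to the
  t-derivative. Weierstrass' theorem makes the limit holomorphic in w and lets w-derivatives pass to
  the limit; \<open>g'\<close> is the mixed derivative.\<close>

lemma deriv_quotient_limit:
  assumes t: "t \<in> ball b e" and h: "h \<longlonglongrightarrow> 0" "\<And>n. h n \<noteq> 0" "\<And>n. t + h n \<in> ball b e"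
  shows "\<exists>g'. \<forall>w\<in>ball a e. ((\<lambda>w. deriv (f w) t) has_field_derivative g' w) (at w) \<and>
    (\<lambda>n. (deriv (\<lambda>w. f w (t + h n)) w - deriv (\<lambda>w. f w t) w) / h n) \<longlonglongrightarrow> g' w"
proof (rule has_complex_derivative_uniform_sequence[OF open_ball, where f = "\<lambda>n w. (f w (t + h n) - f w t) / h n"])
  fix n w assume w: "w \<in> ball a e"
  have "((\<lambda>w. f w \<tau>) has_field_derivative deriv (\<lambda>w. f w \<tau>) w) (at w)" if "\<tau> \<in> ball b e" for \<tau>
    using hol1[OF that] w holomorphic_derivI open_ball by blast
  from this[OF h(3)] this[OF t]
  show "((\<lambda>w. (f w (t + h n) - f w t) / h n) has_field_derivative
      (deriv (\<lambda>w. f w (t + h n)) w - deriv (\<lambda>w. f w t) w) / h n) (at w)"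
    by (intro DERIV_cdivide DERIV_diff)
next
  fix w0 assume w0: "w0 \<in> ball a e"
  obtain d where d: "d > 0" "cball w0 d \<subseteq> ball a e"
    by (rule cball_subset_ball[OF w0]) (rule that)
  have "uniform_limit (cball w0 d) (\<lambda>n w. (f w (t + h n) - f w t) / h n) (\<lambda>w. deriv (f w) t) sequentially"
    unfolding uniform_limit_iff
  proof (intro allI impI)
    fix eps :: real assume eps: "eps > 0"
    have "continuous_on (ball a e \<times> ball b e) (\<lambda>(w, t). deriv (f w) t)"
      by (rule continuous_on_deriv_param[OF cont hol2])
    then have "continuous_on (ball b e \<times> cball w0 d) (\<lambda>x. (\<lambda>(w, t). deriv (f w) t) (snd x, fst x))"
      by (rule continuous_on_compose2) (use d in \<open>auto intro!: continuous_intros\<close>)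
    then obtain X where X: "t \<in> X" "open X"
      "\<forall>\<tau>\<in>X \<inter> ball b e. \<forall>w\<in>cball w0 d. dist ((\<lambda>x. (\<lambda>(w, t). deriv (f w) t) (snd x, fst x)) (\<tau>, w))
        ((\<lambda>x. (\<lambda>(w, t). deriv (f w) t) (snd x, fst x)) (t, w)) \<le> eps / 2"
      by (rule continuous_on_prod_compactE[where e = "eps / 2"]) (use t eps in auto)
    have "open (X \<inter> ball b e)" "t \<in> X \<inter> ball b e" using X t by auto
    then obtain \<delta> where \<delta>: "\<delta> > 0" "ball t \<delta> \<subseteq> X \<inter> ball b e" by (rule openE)
    have "\<forall>\<^sub>F n in sequentially. dist (h n) 0 < \<delta>" using h(1) \<delta>(1) by (simp add: tendsto_iff)
    then show "\<forall>\<^sub>F n in sequentially. \<forall>w\<in>cball w0 d.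
        dist ((f w (t + h n) - f w t) / h n) (deriv (f w) t) < eps"
    proof eventually_elim
      case (elim n)
      show ?case
      proof
        fix w assume w: "w \<in> cball w0 d"
        have "cmod (f w (t + h n) - f w t - deriv (f w) t * (t + h n - t)) \<le> eps / 2 * cmod (t + h n - t)"
        proof (rule field_differentiable_approx[of "ball t \<delta>"])
          show "f w field_differentiable at \<tau>" if "\<tau> \<in> ball t \<delta>" for \<tau>
          proof -
            have "\<tau> \<in> ball b e" using that \<delta>(2) by blast
            moreover have "f w holomorphic_on ball b e" using hol2 w d(2) by blast
            ultimately show ?thesis using holomorphic_on_imp_differentiable_at open_ball by blast
          qed
          show "cmod (deriv (f w) \<tau> - deriv (f w) t) \<le> eps / 2" if "\<tau> \<in> ball t \<delta>" for \<tau>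
          proof -
            have "\<tau> \<in> X \<inter> ball b e" using that \<delta>(2) by blast
            from bspec[OF bspec[OF X(3) this] w] show ?thesis by (simp add: dist_norm)
          qed
        qed (use elim \<delta>(1) in \<open>auto simp: dist_norm\<close>)
        then have "cmod (f w (t + h n) - f w t - deriv (f w) t * h n) \<le> eps / 2 * cmod (h n)" by simp
        moreover have "(f w (t + h n) - f w t) / h n - deriv (f w) t =
            (f w (t + h n) - f w t - deriv (f w) t * h n) / h n"
          using h(2)[of n] by (simp add: field_simps)
        ultimately have "dist ((f w (t + h n) - f w t) / h n) (deriv (f w) t) \<le> eps / 2"
          using h(2)[of n] by (simp add: dist_norm norm_divide divide_le_eq)
        then show "dist ((f w (t + h n) - f w t) / h n) (deriv (f w) t) < eps" using eps by linarith
      qed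
    qed
  qed
  then show "\<exists>d>0. cball w0 d \<subseteq> ball a e \<and>
      uniform_limit (cball w0 d) (\<lambda>n w. (f w (t + h n) - f w t) / h n) (\<lambda>w. deriv (f w) t) sequentially"
    using d by blast
qed

lemma null_sequence:
  assumes t: "t \<in> ball b e"
  obtains h :: "nat \<Rightarrow> complex" where "h \<longlonglongrightarrow> 0" "\<forall>n. h n \<noteq> 0" "\<forall>n. t + h n \<in> ball b e"
proof -
  obtain d where d: "d > 0" "cball t d \<subseteq> ball b e"
    by (rule cball_subset_ball[OF t]) (rule that)
  define h :: "nat \<Rightarrow> complex" where "h n = of_real (d * inverse (real (Suc n)))" for n
  have "(\<lambda>n. d * inverse (real (Suc n))) \<longlonglongrightarrow> d * 0"
    by (intro tendsto_mult LIMSEQ_inverse_real_of_nat tendsto_const)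
  then have "h \<longlonglongrightarrow> of_real 0" unfolding h_def by (intro tendsto_of_real) simp
  moreover have "\<forall>n. h n \<noteq> 0" unfolding h_def of_real_eq_0_iff using d by simp
  moreover have "\<forall>n. t + h n \<in> ball b e"
  proof
    fix n
    have "d * inverse (real (Suc n)) \<le> d * 1"
      using d by (intro mult_left_mono) (auto simp: inverse_le_1_iff)
    moreover have "0 \<le> d * inverse (real (Suc n))" using d by simp
    then have "cmod (h n) = d * inverse (real (Suc n))" unfolding h_def norm_of_real by (rule abs_of_nonneg)
    ultimately have "cmod (h n) \<le> d" by simp
    then have "t + h n \<in> cball t d" by (simp add: dist_norm)
    then show "t + h n \<in> ball b e" using d(2) by blast
  qed
  ultimately show ?thesis using that by simp
qed

lemma holomorphic_deriv_snd:
  assumes t: "t \<in> ball b e"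
  shows "(\<lambda>w. deriv (f w) t) holomorphic_on ball a e"
proof -
  obtain h where h: "h \<longlonglongrightarrow> 0" "\<forall>n. h n \<noteq> 0" "\<forall>n. t + h n \<in> ball b e"
    by (rule null_sequence[OF t]) (rule that)
  obtain g' where g': "\<forall>w\<in>ball a e. ((\<lambda>w. deriv (f w) t) has_field_derivative g' w) (at w) \<and>
    (\<lambda>n. (deriv (\<lambda>w. f w (t + h n)) w - deriv (\<lambda>w. f w t) w) / h n) \<longlonglongrightarrow> g' w"
    using deriv_quotient_limit[OF t, of h] h by blast
  show ?thesis
  proof (rule holomorphic_onI)
    fix w assume "w \<in> ball a e"
    then have "((\<lambda>w. deriv (f w) t) has_field_derivative g' w) (at w)" using g' by blast
    then show "(\<lambda>w. deriv (f w) t) field_differentiable at w within ball a e"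
      unfolding field_differentiable_def using has_field_derivative_at_within by blast
  qed
qed

lemma flip: "two_variable_holomorphic (\<lambda>t w. f w t) b a e"
proof
  have "continuous_on (ball b e \<times> ball a e) (\<lambda>x. (\<lambda>(w, t). f w t) (snd x, fst x))"
    by (rule continuous_on_compose2[OF cont]) (auto intro!: continuous_intros)
  then show "continuous_on (ball b e \<times> ball a e) (\<lambda>(w, t). f t w)" by (simp add: case_prod_beta)
qed (use hol1 hol2 in auto)

text \<open>Both sides are limits of one sequence of difference quotients of the w-derivative: the
  left side by \<open>deriv_quotient_limit\<close>, the right side because the w-derivative is
  itself holomorphic in t, by symmetry of the hypotheses.\<close>

lemma deriv_deriv_commute:
  assumes w: "w \<in> ball a e" and t: "t \<in> ball b e"
  shows "deriv (\<lambda>w. deriv (f w) t) w = deriv (\<lambda>t. deriv (\<lambda>w. f w t) w) t"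
proof -
  obtain h where h: "h \<longlonglongrightarrow> 0" "\<forall>n. h n \<noteq> 0" "\<forall>n. t + h n \<in> ball b e"
    by (rule null_sequence[OF t]) (rule that)
  let ?D = "\<lambda>t. deriv (\<lambda>w. f w t) w"
  obtain g' where g': "\<forall>w\<in>ball a e. ((\<lambda>w. deriv (f w) t) has_field_derivative g' w) (at w) \<and>
    (\<lambda>n. (deriv (\<lambda>w. f w (t + h n)) w - deriv (\<lambda>w. f w t) w) / h n) \<longlonglongrightarrow> g' w"
    using deriv_quotient_limit[OF t, of h] h by blast
  interpret flip: two_variable_holomorphic "\<lambda>t w. f w t" b a e by (rule flip)
  have "(?D has_field_derivative deriv ?D t) (at t)"
    using flip.holomorphic_deriv_snd[OF w] t holomorphic_derivI open_ball by blast
  then have "((\<lambda>k. (?D (t + k) - ?D t) / k) \<longlongrightarrow> deriv ?D t) (at 0)" by (simp add: DERIV_def)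
  then have "(\<lambda>n. (?D (t + h n) - ?D t) / h n) \<longlonglongrightarrow> deriv ?D t"
    by (rule filterlim_compose) (use h in \<open>auto simp: filterlim_at\<close>)
  moreover have "(\<lambda>n. (?D (t + h n) - ?D t) / h n) \<longlonglongrightarrow> g' w" using g' w by blast
  ultimately have "g' w = deriv ?D t" using LIMSEQ_unique by blast
  moreover have "((\<lambda>w. deriv (f w) t) has_field_derivative g' w) (at w)" using g' w by blast
  ultimately show ?thesis using DERIV_imp_deriv by metis
qed

end

section \<open>Polydiscs and holomorphic functions on open subsets of
  \<open>cspace n\<close>\<close>

definition polydisc :: "nat \<Rightarrow> (nat \<Rightarrow> complex) \<Rightarrow> real \<Rightarrow> (nat \<Rightarrow> complex) set" where
  "polydisc n a e = {z \<in> cspace n. \<forall>i<n. z i \<in> ball (a i) e}"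

lemma openin_polydisc: "openin (top_of_set (cspace n)) (polydisc n a e)"
proof -
  have "open ((\<lambda>z :: nat \<Rightarrow> complex. z i) -` ball (a i) e)" for i
    by (rule open_vimage[OF open_ball continuous_on_product_coordinates])
  then have "open (\<Inter>i\<in>{..<n}. (\<lambda>z :: nat \<Rightarrow> complex. z i) -` ball (a i) e)" by (intro open_INT) auto
  moreover have "polydisc n a e = cspace n \<inter> (\<Inter>i\<in>{..<n}. (\<lambda>z. z i) -` ball (a i) e)"
    by (auto simp: polydisc_def)
  ultimately show ?thesis by (auto simp: openin_open)
qed

lemma centre_in_polydisc: "a \<in> cspace n \<Longrightarrow> e > 0 \<Longrightarrow> a \<in> polydisc n a e"
  by (simp add: polydisc_def)

lemma polydisc_upd: "z \<in> polydisc n a e \<Longrightarrow> j < n \<Longrightarrow> w \<in> ball (a j) e \<Longrightarrow> z(j := w) \<in> polydisc n a e"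
  by (auto simp: polydisc_def cspace_def)

lemma polydisc_coord: "z \<in> polydisc n a e \<Longrightarrow> j < n \<Longrightarrow> z j \<in> ball (a j) e"
  by (simp add: polydisc_def)

text \<open>The coordinates from n on are constant on \<open>cspace n\<close>, so only n of the open
  factors matter and a single radius serves them all.\<close>

lemma openin_contains_polydisc:
  assumes S: "openin (top_of_set (cspace n)) S" and a: "a \<in> S"
  obtains e where "e > 0" "polydisc n a e \<subseteq> S"
proof -
  obtain T where T: "open T" "S = cspace n \<inter> T" using S by (auto simp: openin_open)
  then have "openin (product_topology (\<lambda>i. euclidean) UNIV) T" by (simp add: open_fun_def)
  from product_topology_open_contains_basis[OF this, of a]
  obtain X where X: "a \<in> (\<Pi>\<^sub>E i\<in>UNIV. X i)" "\<forall>i. openin euclidean (X i)" "(\<Pi>\<^sub>E i\<in>UNIV. X i) \<subseteq> T"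
    using a T by blast
  have "\<exists>e>0. \<forall>i\<in>{..<n}. ball (a i) e \<subseteq> X i"
  proof (rule finite_uniform_positive)
    fix i
    have "open (X i)" "a i \<in> X i" using X by (auto simp: PiE_iff)
    then show "\<exists>e>0. ball (a i) e \<subseteq> X i" by (meson openE)
  next
    fix i and e e' :: real assume "ball (a i) e \<subseteq> X i" "e' \<le> e"
    then show "ball (a i) e' \<subseteq> X i" using subset_ball by blast
  qed simp
  then obtain e where e: "e > 0" "\<forall>i\<in>{..<n}. ball (a i) e \<subseteq> X i" by blast
  have "polydisc n a e \<subseteq> S"
  proof
    fix z assume z: "z \<in> polydisc n a e"
    have "z i \<in> X i" for i
    proof (cases "i < n")
      case True
      then show ?thesis using z e(2) polydisc_coord by blast
    next
      case False
      then have "z i = a i" using z a T(2) by (auto simp: polydisc_def cspace_def)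
      then show ?thesis using X(1) by (auto simp: PiE_iff)
    qed
    then have "z \<in> T" using X(3) by (auto simp: PiE_iff)
    then show "z \<in> S" using z T(2) by (auto simp: polydisc_def)
  qed
  with e(1) show ?thesis by (rule that)
qed

lemma hol_on_subset: "hol_on n S f \<Longrightarrow> T \<subseteq> S \<Longrightarrow> hol_on n T f"
  unfolding hol_on_def using continuous_on_subset by blast

lemma at_within_openin:
  assumes "openin (top_of_set C) S" "S \<subseteq> T" "T \<subseteq> C" "x \<in> S"
  shows "at x within T = at x within S"
proof -
  obtain U where U: "open U" "S = C \<inter> U" using assms(1) by (auto simp: openin_open)
  show ?thesis by (rule at_within_nhd[of x U]) (use U assms in auto)
qed

text \<open>Openness of \<open>T\<close> relative to \<open>cspace n\<close> makes limits within
  \<open>T\<close> and within \<open>S\<close> agree, so continuity can be checked locally.\<close>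

lemma hol_on_local:
  assumes "S \<subseteq> cspace n"
    and "\<And>a. a \<in> S \<Longrightarrow> \<exists>T. openin (top_of_set (cspace n)) T \<and> a \<in> T \<and> T \<subseteq> S \<and> hol_on n T f"
  shows "hol_on n S f"
  unfolding hol_on_def continuous_on_def
proof (intro conjI ballI)
  fix a assume a: "a \<in> S"
  obtain T where T: "openin (top_of_set (cspace n)) T" "a \<in> T" "T \<subseteq> S" "hol_on n T f"
    using assms(2)[OF a] by blast
  show "(f \<longlongrightarrow> f a) (at a within S)"
    using T(2,4) at_within_openin[OF T(1,3) assms(1) T(2)] by (simp add: hol_on_def continuous_on_def)
  show "\<forall>i<n. (\<lambda>w. f (a(i := w))) field_differentiable at (a i)"
    using T(2,4) by (simp add: hol_on_def)
qed

text \<open>Makes a partial derivative at a point of \<open>S\<close> depend only on the values on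
  \<open>S\<close>.\<close>

lemma eventually_upd_in:
  assumes S: "openin (top_of_set (cspace n)) S" and a: "a \<in> S" and j: "j < n"
  shows "\<forall>\<^sub>F w in nhds (a j). a(j := w) \<in> S"
proof -
  obtain e where e: "e > 0" "polydisc n a e \<subseteq> S" by (rule openin_contains_polydisc[OF S a]) (rule that)
  have "a \<in> polydisc n a e"
    using a e(1) openin_imp_subset[OF S] by (intro centre_in_polydisc) auto
  then have "a(j := w) \<in> S" if "w \<in> ball (a j) e" for w
    using polydisc_upd[of a n a e j w] j that e(2) by blast
  then show ?thesis
    unfolding eventually_nhds using e(1) by (intro exI[of _ "ball (a j) e"]) auto
qed

lemma hol_on_cong:
  assumes S: "openin (top_of_set (cspace n)) S" and eq: "\<And>z. z \<in> S \<Longrightarrow> f z = g z" and f: "hol_on n S f"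
  shows "hol_on n S g"
  unfolding hol_on_def
proof (intro conjI ballI allI impI)
  show "continuous_on S g" using f eq continuous_on_cong unfolding hol_on_def by metis
  fix a i assume a: "a \<in> S" "i < n"
  have ev: "\<forall>\<^sub>F w in nhds (a i). f (a(i := w)) = g (a(i := w))"
    using eventually_upd_in[OF S a] by eventually_elim (rule eq)
  have "(\<lambda>w. f (a(i := w))) field_differentiable at (a i)" using f a by (simp add: hol_on_def)
  then show "(\<lambda>w. g (a(i := w))) field_differentiable at (a i)"
    unfolding field_differentiable_def DERIV_cong_ev[OF refl ev refl] .
qed

lemma hol_on_const: "hol_on n S (\<lambda>z. c)"
  by (simp add: hol_on_def)

lemma hol_on_coord: "hol_on n S (\<lambda>z. z j)"
  unfolding hol_on_def
proof (intro conjI ballI allI impI)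
  show "continuous_on S (\<lambda>z. z j)" by (rule continuous_on_subset[OF continuous_on_product_coordinates]) simp
  fix a :: "nat \<Rightarrow> complex" and i
  show "(\<lambda>w. (a(i := w)) j) field_differentiable at (a i)" by (cases "i = j") simp_all
qed

lemma hol_on_add: "hol_on n S f \<Longrightarrow> hol_on n S g \<Longrightarrow> hol_on n S (\<lambda>z. f z + g z)"
  unfolding hol_on_def by (auto intro!: continuous_intros field_differentiable_add)

lemma hol_on_mult: "hol_on n S f \<Longrightarrow> hol_on n S g \<Longrightarrow> hol_on n S (\<lambda>z. f z * g z)"
  unfolding hol_on_def by (auto intro!: continuous_intros field_differentiable_mult)

lemma hol_on_power: "hol_on n S f \<Longrightarrow> hol_on n S (\<lambda>z. f z ^ k)"
  by (induction k) (simp_all add: hol_on_const hol_on_mult)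

lemma hol_on_divide:
  assumes "hol_on n S f" "hol_on n S g" "\<And>z. z \<in> S \<Longrightarrow> g z \<noteq> 0"
  shows "hol_on n S (\<lambda>z. f z / g z)"
  using assms unfolding hol_on_def by (auto intro!: continuous_intros field_differentiable_divide)

section \<open>Partial derivatives, division by a coordinate, chain rule\<close>

definition cpartial :: "nat \<Rightarrow> ((nat \<Rightarrow> complex) \<Rightarrow> complex) \<Rightarrow> (nat \<Rightarrow> complex) \<Rightarrow> complex" where
  "cpartial j f z = deriv (\<lambda>w. f (z(j := w))) (z j)"

lemma hol_on_holomorphic_slice:
  assumes f: "hol_on n S f" and z: "z \<in> polydisc n a e" "polydisc n a e \<subseteq> S" and j: "j < n"
  shows "(\<lambda>w. f (z(j := w))) holomorphic_on ball (a j) e"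
proof (rule holomorphic_onI, rule field_differentiable_at_within)
  fix w assume "w \<in> ball (a j) e"
  then have "z(j := w) \<in> S" using polydisc_upd[OF z(1) j] z(2) by blast
  then have "(\<lambda>v. f ((z(j := w))(j := v))) field_differentiable at ((z(j := w)) j)"
    using f j unfolding hol_on_def by blast
  then show "(\<lambda>w. f (z(j := w))) field_differentiable at w" by simp
qed

lemma continuous_on_slice:
  assumes f: "hol_on n S f" "polydisc n a e \<subseteq> S" and j: "j < n"
  shows "continuous_on (polydisc n a e \<times> ball (a j) e) (\<lambda>(z, w). f (z(j := w)))"
proof -
  have "continuous_on (polydisc n a e \<times> ball (a j) e) (\<lambda>x. f ((fst x)(j := snd x)))"
  proof (rule continuous_on_compose2[of S f])
    show "continuous_on S f" using f by (simp add: hol_on_def)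
    show "(\<lambda>x. (fst x)(j := snd x)) ` (polydisc n a e \<times> ball (a j) e) \<subseteq> S"
      using polydisc_upd[OF _ j] f(2) by fastforce
    show "continuous_on (polydisc n a e \<times> ball (a j) e) (\<lambda>x. (fst x)(j := snd x))"
    proof (rule continuous_on_coordinatewise_then_product)
      fix i
      show "continuous_on (polydisc n a e \<times> ball (a j) e) (\<lambda>x. ((fst x)(j := snd x)) i)"
      proof (cases "i = j")
        case True
        then show ?thesis by (simp add: continuous_on_snd continuous_on_id)
      next
        case False
        have "continuous_on (polydisc n a e \<times> ball (a j) e) (\<lambda>x. fst x i)"
          by (rule continuous_on_product_then_coordinatewise) (intro continuous_intros)
        then show ?thesis using False by simp
      qed
    qed
  qed
  then show ?thesis by (simp add: case_prod_beta)
qed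

lemma two_variable_slice:
  assumes f: "hol_on n S f" "polydisc n a e \<subseteq> S" and a: "a \<in> polydisc n a e" and ij: "i < n" "j < n" "i \<noteq> j"
  shows "two_variable_holomorphic (\<lambda>w t. f (a(i := w, j := t))) (a i) (a j) e"
proof
  have "continuous_on (ball (a i) e \<times> ball (a j) e) (\<lambda>x. f (a(i := fst x, j := snd x)))"
  proof (rule continuous_on_compose2[of S f])
    show "continuous_on S f" using f by (simp add: hol_on_def)
    show "(\<lambda>x. a(i := fst x, j := snd x)) ` (ball (a i) e \<times> ball (a j) e) \<subseteq> S"
    proof clarify
      fix w t assume "w \<in> ball (a i) e" "t \<in> ball (a j) e"
      then have "a(i := w, j := t) \<in> polydisc n a e" using a ij by (intro polydisc_upd)
      then show "a(i := fst (w, t), j := snd (w, t)) \<in> S" using f(2) by auto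
    qed
    show "continuous_on (ball (a i) e \<times> ball (a j) e) (\<lambda>x. a(i := fst x, j := snd x))"
    proof (rule continuous_on_coordinatewise_then_product)
      fix k
      show "continuous_on (ball (a i) e \<times> ball (a j) e) (\<lambda>x. (a(i := fst x, j := snd x)) k)"
        by (cases "k = j"; cases "k = i") (auto intro!: continuous_intros)
    qed
  qed
  then show "continuous_on (ball (a i) e \<times> ball (a j) e) (\<lambda>(w, t). f (a(i := w, j := t)))"
    by (simp add: case_prod_beta)
next
  fix t assume "t \<in> ball (a j) e"
  then have "a(j := t) \<in> polydisc n a e" using a ij by (intro polydisc_upd)
  from hol_on_holomorphic_slice[OF f(1) this f(2) ij(1)]
  show "(\<lambda>w. f (a(i := w, j := t))) holomorphic_on ball (a i) e"
    using ij(3) by (simp add: fun_upd_twist)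
next
  fix w assume "w \<in> ball (a i) e"
  then have "a(i := w) \<in> polydisc n a e" using a ij by (intro polydisc_upd)
  from hol_on_holomorphic_slice[OF f(1) this f(2) ij(2)]
  show "(\<lambda>t. f (a(i := w, j := t))) holomorphic_on ball (a j) e" .
qed

lemma polydisc_around:
  assumes S: "openin (top_of_set (cspace n)) S" and a: "a \<in> S"
  obtains e where "e > 0" "polydisc n a e \<subseteq> S" "a \<in> polydisc n a e"
  using openin_contains_polydisc[OF S a] centre_in_polydisc openin_imp_subset[OF S] a by (metis subsetD)

text \<open>Continuity comes from \<open>continuous_on_deriv_param\<close>, with the whole point as
  parameter. In direction j holomorphy is that of a derivative in one variable; in any other
  direction it is the two-variable statement \<open>holomorphic_deriv_snd\<close>.\<close>

lemma hol_on_cpartial: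
  assumes S: "openin (top_of_set (cspace n)) S" and f: "hol_on n S f" and j: "j < n"
  shows "hol_on n S (cpartial j f)"
proof (rule hol_on_local)
  show "S \<subseteq> cspace n" by (rule openin_imp_subset[OF S])
  fix b assume "b \<in> S"
  then obtain e where e: "e > 0" "polydisc n b e \<subseteq> S" "b \<in> polydisc n b e"
    by (rule polydisc_around[OF S]) (rule that)
  have "hol_on n (polydisc n b e) (cpartial j f)"
    unfolding hol_on_def
  proof (intro conjI ballI allI impI)
    have "continuous_on (polydisc n b e \<times> ball (b j) e) (\<lambda>(z, w). deriv (\<lambda>w. f (z(j := w))) w)"
      by (rule continuous_on_deriv_param[OF continuous_on_slice[OF f e(2) j] hol_on_holomorphic_slice[OF f _ e(2) j]])
    then have "continuous_on (polydisc n b e)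
        (\<lambda>z. (\<lambda>(z, w). deriv (\<lambda>w. f (z(j := w))) w) (z, z j))"
    proof (rule continuous_on_compose2)
      show "continuous_on (polydisc n b e) (\<lambda>z. (z, z j))"
        by (intro continuous_on_Pair continuous_on_id continuous_on_product_then_coordinatewise[OF continuous_on_id])
    qed (auto simp: polydisc_def j)
    then show "continuous_on (polydisc n b e) (cpartial j f)" by (simp add: cpartial_def)
  next
    fix a i assume "a \<in> polydisc n b e" and i: "i < n"
    then have "a \<in> S" using e(2) by blast
    then obtain d where d: "d > 0" "polydisc n a d \<subseteq> S" "a \<in> polydisc n a d"
      by (rule polydisc_around[OF S]) (rule that)
    show "(\<lambda>w. cpartial j f (a(i := w))) field_differentiable at (a i)"
    proof (cases "i = j")
      case True
      have "deriv (\<lambda>w. f (a(j := w))) holomorphic_on ball (a j) d"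
        by (rule holomorphic_deriv[OF hol_on_holomorphic_slice[OF f d(3,2) j] open_ball])
      then show ?thesis
        using holomorphic_on_imp_differentiable_at[of _ "ball (a j) d" "a j"] d(1) True by (simp add: cpartial_def)
    next
      case False
      interpret two_variable_holomorphic "\<lambda>w t. f (a(i := w, j := t))" "a i" "a j" d
        by (rule two_variable_slice[OF f d(2,3) i j False])
      have "(\<lambda>w. deriv (\<lambda>t. f (a(i := w, j := t))) (a j)) holomorphic_on ball (a i) d"
        by (rule holomorphic_deriv_snd) (use d(1) in simp)
      then show ?thesis
        using holomorphic_on_imp_differentiable_at[of _ "ball (a i) d" "a i"] d(1) False by (simp add: cpartial_def)
    qed
  qed
  then show "\<exists>T. openin (top_of_set (cspace n)) T \<and> b \<in> T \<and> T \<subseteq> S \<and> hol_on n T (cpartial j f)"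
    using openin_polydisc e by blast
qed

lemma cpartial_commute:
  assumes S: "openin (top_of_set (cspace n)) S" and f: "hol_on n S f" and ij: "i < n" "j < n" and a: "a \<in> S"
  shows "cpartial i (cpartial j f) a = cpartial j (cpartial i f) a"
proof (cases "i = j")
  case False
  obtain d where d: "d > 0" "polydisc n a d \<subseteq> S" "a \<in> polydisc n a d"
    by (rule polydisc_around[OF S a]) (rule that)
  interpret two_variable_holomorphic "\<lambda>w t. f (a(i := w, j := t))" "a i" "a j" d
    by (rule two_variable_slice[OF f d(2,3) ij False])
  have "deriv (\<lambda>w. deriv (\<lambda>t. f (a(i := w, j := t))) (a j)) (a i) =
      deriv (\<lambda>t. deriv (\<lambda>w. f (a(i := w, j := t))) (a i)) (a j)"
    by (rule deriv_deriv_commute) (use d(1) in auto)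
  then show ?thesis using False by (simp add: cpartial_def fun_upd_twist)
qed simp

lemma cpartial_derivative:
  assumes "hol_on n S f" "a \<in> S" "j < n"
  shows "((\<lambda>w. f (a(j := w))) has_field_derivative cpartial j f a) (at (a j))"
  using assms unfolding hol_on_def cpartial_def by (auto intro: field_differentiable_derivI)

lemma cpartial_eqI:
  "((\<lambda>w. f (a(j := w))) has_field_derivative D) (at (a j)) \<Longrightarrow> cpartial j f a = D"
  unfolding cpartial_def by (rule DERIV_imp_deriv)

lemma cpartial_mult:
  assumes "hol_on n S f" "hol_on n S g" "a \<in> S" "j < n"
  shows "cpartial j (\<lambda>z. f z * g z) a = f a * cpartial j g a + cpartial j f a * g a"
proof (rule cpartial_eqI)
  show "((\<lambda>w. f (a(j := w)) * g (a(j := w))) has_field_derivative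
      f a * cpartial j g a + cpartial j f a * g a) (at (a j))"
    using DERIV_mult[OF cpartial_derivative[OF assms(1,3,4)] cpartial_derivative[OF assms(2,3,4)]]
    by (simp add: algebra_simps)
qed

lemma cpartial_add:
  assumes "hol_on n S f" "hol_on n S g" "a \<in> S" "j < n"
  shows "cpartial j (\<lambda>z. f z + g z) a = cpartial j f a + cpartial j g a"
  by (rule cpartial_eqI, rule DERIV_add[OF cpartial_derivative[OF assms(1,3,4)] cpartial_derivative[OF assms(2,3,4)]])

lemma cpartial_const: "cpartial j (\<lambda>z. c) a = 0"
  by (simp add: cpartial_def)

lemma cpartial_coord: "cpartial j (\<lambda>z. z i) a = (if i = j then 1 else 0)"
  by (simp add: cpartial_def)

lemma cpartial_cong:
  assumes S: "openin (top_of_set (cspace n)) S" and "\<And>z. z \<in> S \<Longrightarrow> f z = g z" "a \<in> S" "j < n"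
  shows "cpartial j f a = cpartial j g a"
  unfolding cpartial_def
proof (rule deriv_cong_ev)
  show "\<forall>\<^sub>F w in nhds (a j). f (a(j := w)) = g (a(j := w))"
    using eventually_upd_in[OF S assms(3,4)] by eventually_elim (rule assms(2))
qed simp

lemma cpartial_power:
  assumes "hol_on n S f" "a \<in> S" "j < n"
  shows "cpartial j (\<lambda>z. f z ^ k) a = of_nat k * f a ^ (k - 1) * cpartial j f a"
  by (rule cpartial_eqI, rule DERIV_cong[OF DERIV_power[OF cpartial_derivative[OF assms]]]) simp

text \<open>Continuity of the partial derivative makes the linear approximation in direction j
  uniform over a polydisc, also for increments starting away from a. Both the division lemma and the
  chain rule depend on this uniformity.\<close>

lemma cpartial_approx:
  assumes S: "openin (top_of_set (cspace n)) S" and f: "hol_on n S f" and a: "a \<in> S" and j: "j < n" and eps: "eps > 0"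
  obtains e where "e > 0" "polydisc n a e \<subseteq> S"
    "\<forall>z\<in>polydisc n a e. cmod (cpartial j f z - cpartial j f a) \<le> eps"
    "\<forall>z\<in>polydisc n a e. \<forall>v\<in>ball (a j) e. \<forall>w\<in>ball (a j) e.
      cmod (f (z(j := v)) - f (z(j := w)) - cpartial j f a * (v - w)) \<le> eps * cmod (v - w)"
proof -
  let ?T = "S \<inter> cpartial j f -` ball (cpartial j f a) eps"
  have "openin (top_of_set S) ?T"
    using hol_on_cpartial[OF S f j] by (intro continuous_openin_preimage_gen) (auto simp: hol_on_def)
  then have "openin (top_of_set (cspace n)) ?T" using S by (rule openin_trans)
  moreover have "a \<in> ?T" using a eps by simp
  ultimately obtain e where e: "e > 0" "polydisc n a e \<subseteq> ?T"
    by (rule openin_contains_polydisc) (rule that)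
  have bound: "cmod (cpartial j f z - cpartial j f a) \<le> eps" if "z \<in> polydisc n a e" for z
  proof -
    have "z \<in> ?T" using that e(2) by blast
    then show ?thesis by (simp add: dist_norm norm_minus_commute)
  qed
  have approx: "cmod (f (z(j := v)) - f (z(j := w)) - cpartial j f a * (v - w)) \<le> eps * cmod (v - w)"
    if z: "z \<in> polydisc n a e" and vw: "v \<in> ball (a j) e" "w \<in> ball (a j) e" for z v w
  proof (rule field_differentiable_approx[OF convex_ball _ _ vw, where g = "\<lambda>t. f (z(j := t))"])
    fix t assume "t \<in> ball (a j) e"
    then have zt: "z(j := t) \<in> polydisc n a e" by (rule polydisc_upd[OF z j])
    then have "z(j := t) \<in> S" using e(2) by blast
    from cpartial_derivative[OF f this j]
    have d: "((\<lambda>w. f (z(j := w))) has_field_derivative cpartial j f (z(j := t))) (at t)" by simp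
    then show "(\<lambda>t. f (z(j := t))) field_differentiable at t"
      unfolding field_differentiable_def by blast
    show "cmod (deriv (\<lambda>t. f (z(j := t))) t - cpartial j f a) \<le> eps"
      unfolding DERIV_imp_deriv[OF d] by (rule bound[OF zt])
  qed
  show ?thesis
    by (rule that[of e]) (use e bound approx in auto)
qed

lemma continuous_on_polydiscI:
  fixes f :: "(nat \<Rightarrow> complex) \<Rightarrow> complex"
  assumes "S \<subseteq> cspace n"
    and "\<And>a eps. a \<in> S \<Longrightarrow> eps > 0 \<Longrightarrow> \<exists>e>0. \<forall>z\<in>polydisc n a e \<inter> S. cmod (f z - f a) \<le> eps"
  shows "continuous_on S f"
  unfolding continuous_on_def tendsto_iff
proof (intro ballI allI impI)
  fix a and eps :: real assume a: "a \<in> S" and eps: "eps > 0"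
  obtain e where e: "e > 0" "\<forall>z\<in>polydisc n a e \<inter> S. cmod (f z - f a) \<le> eps / 2"
    using assms(2)[OF a, of "eps / 2"] eps by auto
  obtain U where U: "open U" "polydisc n a e = cspace n \<inter> U"
    using openin_polydisc[of n a e] by (auto simp: openin_open)
  have "a \<in> polydisc n a e" using a assms(1) e(1) by (intro centre_in_polydisc) auto
  then have "a \<in> U" using U by blast
  moreover have "dist (f z) (f a) < eps" if "z \<in> U" "z \<in> S" for z
  proof -
    have "z \<in> polydisc n a e \<inter> S" using that U assms(1) by blast
    then have "cmod (f z - f a) \<le> eps / 2" using e(2) by blast
    then show ?thesis using eps by (simp add: dist_norm)
  qed
  ultimately show "\<forall>\<^sub>F z in at a within S. dist (f z) (f a) < eps"
    unfolding eventually_at_topological using U(1) by blast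
qed

text \<open>The quotient is extended over the hyperplane z_j = 0 by the partial derivative;
  \<open>cpartial_approx\<close> shows that the extension is continuous. Along the hyperplane
  holomorphy is that of the partial derivative, transversally it is the removable singularity
  theorem.\<close>

lemma divisible_by_coordinate:
  assumes S: "openin (top_of_set (cspace n)) S" and f: "hol_on n S f" and j: "j < n"
    and zero: "\<And>z. z \<in> S \<Longrightarrow> z j = 0 \<Longrightarrow> f z = 0"
  obtains q where "hol_on n S q" "\<forall>z\<in>S. f z = z j * q z"
proof -
  have Sc: "S \<subseteq> cspace n" by (rule openin_imp_subset[OF S])
  define q where "q z = (if z j = 0 then cpartial j f z else f z / z j)" for z
  have q: "f z = z j * q z" if "z \<in> S" for z
    using that zero by (simp add: q_def)
  let ?S = "{z \<in> S. z j \<noteq> 0}"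
  have "openin (top_of_set S) (S \<inter> (\<lambda>z. z j) -` (- {0}))"
    by (rule continuous_openin_preimage_gen[OF continuous_on_subset[OF continuous_on_product_coordinates]]) auto
  then have S': "openin (top_of_set (cspace n)) ?S"
    using openin_trans[OF _ S] by (simp add: Collect_conj_eq vimage_def)
  have q': "hol_on n ?S q"
  proof (rule hol_on_cong[OF S'])
    show "hol_on n ?S (\<lambda>z. f z / z j)"
      by (rule hol_on_divide[OF hol_on_subset[OF f] hol_on_coord]) auto
  qed (simp add: q_def)
  have cont: "continuous_on S q"
  proof (rule continuous_on_polydiscI[OF Sc])
    fix a and eps :: real assume a: "a \<in> S" and eps: "eps > 0"
    show "\<exists>e>0. \<forall>z\<in>polydisc n a e \<inter> S. cmod (q z - q a) \<le> eps"
    proof (cases "a j = 0")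
      case False
      then have a': "a \<in> ?S" using a by simp
      have "openin (top_of_set ?S) (?S \<inter> q -` ball (q a) eps)"
        using q' by (intro continuous_openin_preimage_gen) (auto simp: hol_on_def)
      then have "openin (top_of_set (cspace n)) (?S \<inter> q -` ball (q a) eps)" using S' by (rule openin_trans)
      then obtain e where e: "e > 0" "polydisc n a e \<subseteq> ?S \<inter> q -` ball (q a) eps"
        by (rule openin_contains_polydisc) (use a' eps in auto)
      have "cmod (q z - q a) \<le> eps" if "z \<in> polydisc n a e" for z
      proof -
        have "q z \<in> ball (q a) eps" using that e(2) by blast
        then show ?thesis by (simp add: dist_norm norm_minus_commute)
      qed
      then show ?thesis using e(1) by blast
    next
      case True
      obtain e where e: "e > 0" "polydisc n a e \<subseteq> S"
        "\<forall>z\<in>polydisc n a e. cmod (cpartial j f z - cpartial j f a) \<le> eps"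
        "\<forall>z\<in>polydisc n a e. \<forall>v\<in>ball (a j) e. \<forall>w\<in>ball (a j) e.
          cmod (f (z(j := v)) - f (z(j := w)) - cpartial j f a * (v - w)) \<le> eps * cmod (v - w)"
        by (rule cpartial_approx[OF S f a j eps]) (rule that)
      have "cmod (q z - q a) \<le> eps" if z: "z \<in> polydisc n a e" for z
      proof (cases "z j = 0")
        case z0: True
        then show ?thesis using e(3) z True by (simp add: q_def)
      next
        case False
        have zero_in: "0 \<in> ball (a j) e" using e(1) True by simp
        have "z(j := 0) \<in> S" using polydisc_upd[OF z j zero_in] e(2) by blast
        then have "f (z(j := 0)) = 0" by (intro zero) auto
        moreover have "cmod (f (z(j := z j)) - f (z(j := 0)) - cpartial j f a * (z j - 0)) \<le> eps * cmod (z j - 0)"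
          using e(4) z polydisc_coord[OF z j] zero_in by blast
        ultimately have "cmod (f z - cpartial j f a * z j) \<le> eps * cmod (z j)" by simp
        moreover have "q z - q a = (f z - cpartial j f a * z j) / z j"
          using False True by (simp add: q_def diff_divide_distrib)
        ultimately show ?thesis using False by (simp add: norm_divide divide_le_eq)
      qed
      then show ?thesis using e(1) by blast
    qed
  qed
  have "hol_on n S q"
    unfolding hol_on_def
  proof (intro conjI ballI allI impI cont)
    fix a i assume a: "a \<in> S" and i: "i < n"
    consider "a j \<noteq> 0" | "a j = 0" "i \<noteq> j" | "a j = 0" "i = j" by blast
    then show "(\<lambda>w. q (a(i := w))) field_differentiable at (a i)"
    proof cases
      case 1
      then show ?thesis using q' a i by (simp add: hol_on_def)
    next
      case 2
      then have "(\<lambda>w. q (a(i := w))) = (\<lambda>w. cpartial j f (a(i := w)))" by (simp add: q_def)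
      then show ?thesis using hol_on_cpartial[OF S f j] a i by (simp add: hol_on_def)
    next
      case 3
      obtain e where e: "e > 0" "polydisc n a e \<subseteq> S" "a \<in> polydisc n a e"
        by (rule polydisc_around[OF S a]) (rule that)
      have upd: "a(j := w) \<in> S" if "w \<in> ball (a j) e" for w
        using polydisc_upd[OF e(3) j that] e(2) by blast
      \<comment> \<open>The slice is holomorphic away from w = 0 and continuous on the whole disc,
        so the singularity is removable.\<close>
      have "(\<lambda>w. q (a(j := w))) holomorphic_on ball (a j) e"
      proof (rule no_isolated_singularity[of _ _ "{0}"])
        show "continuous_on (ball (a j) e) (\<lambda>w. q (a(j := w)))"
        proof (rule continuous_on_compose2[OF cont])
          show "continuous_on (ball (a j) e) (\<lambda>w. a(j := w))"
          proof (rule continuous_on_coordinatewise_then_product)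
            show "continuous_on (ball (a j) e) (\<lambda>w. (a(j := w)) k)" for k
              by (cases "k = j") (auto intro!: continuous_intros)
          qed
        qed (use upd in blast)
        show "(\<lambda>w. q (a(j := w))) holomorphic_on ball (a j) e - {0}"
        proof (rule holomorphic_onI, rule field_differentiable_at_within)
          fix w assume w: "w \<in> ball (a j) e - {0}"
          then have "a(j := w) \<in> ?S" using upd by simp
          then have "(\<lambda>v. q ((a(j := w))(j := v))) field_differentiable at ((a(j := w)) j)"
            using q' j unfolding hol_on_def by blast
          then show "(\<lambda>w. q (a(j := w))) field_differentiable at w" by simp
        qed
      qed auto
      then show ?thesis
        using holomorphic_on_imp_differentiable_at[of _ "ball (a j) e" "a j"] e(1) 3 by simp
    qed
  qed
  then show ?thesis using q by (intro that) blast+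
qed

text \<open>Chain rule from continuity and separate holomorphy. The increment of f along the curve
  is telescoped through the points \<open>p k w\<close>, whose first k coordinates come from the
  curve and the remaining ones from a, so that each summand changes one coordinate.\<close>

lemma field_differentiable_along_curve:
  fixes c :: "complex \<Rightarrow> nat \<Rightarrow> complex"
  assumes S: "openin (top_of_set (cspace n)) S" and f: "hol_on n S f"
    and c: "\<And>j. j < n \<Longrightarrow> (\<lambda>w. c w j) field_differentiable at w0"
    and inS: "\<forall>\<^sub>F w in nhds w0. c w \<in> S"
  shows "(\<lambda>w. f (c w)) field_differentiable at w0"
proof -
  define a where "a = c w0"
  have a: "a \<in> S" using eventually_nhds_x_imp_x[OF inS] by (simp add: a_def)
  have ac: "a \<in> cspace n" using a openin_imp_subset[OF S] by blast
  have ev: "\<forall>\<^sub>F w in nhds w0. c w \<in> polydisc n a e" if e: "e > 0" for e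
  proof -
    have "\<forall>\<^sub>F w in nhds w0. c w j \<in> ball (a j) e" if "j < n" for j
    proof -
      have "isCont (\<lambda>w. c w j) w0" using c[OF that] by (rule field_differentiable_imp_continuous_at)
      then have "((\<lambda>w. c w j) \<longlongrightarrow> a j) (nhds w0)" by (simp add: a_def isCont_def tendsto_nhds_iff)
      then have "\<forall>\<^sub>F w in nhds w0. dist (c w j) (a j) < e" using e unfolding tendsto_iff by blast
      then show ?thesis by eventually_elim (simp add: dist_commute)
    qed
    then have "\<forall>\<^sub>F w in nhds w0. \<forall>j\<in>{..<n}. c w j \<in> ball (a j) e" by (intro eventually_ball_finite) auto
    with inS show ?thesis
    proof eventually_elim
      case (elim w)
      then show ?case using openin_imp_subset[OF S] by (auto simp: polydisc_def)
    qed
  qed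
  define p where "p k w = (\<lambda>i. if i < k then c w i else a i)" for k w
  have p0: "p k w0 = a" for k by (auto simp: p_def a_def)
  have pdisc: "p k w \<in> polydisc n a e" if "c w \<in> polydisc n a e" "e > 0" for k w e
    using that ac by (auto simp: p_def polydisc_def cspace_def)
  have step: "(\<lambda>w. f ((p k w)(k := c w k)) - f ((p k w)(k := a k))) field_differentiable at w0"
    if k: "k < n" for k
  proof -
    let ?T = "\<lambda>w. f ((p k w)(k := c w k)) - f ((p k w)(k := a k))" and ?D = "cpartial k f a"
    \<comment> \<open>Slope of the k-th increment, in Caratheodory's form of differentiability.
      Where the curve returns to its initial k-th coordinate the partial derivative is inserted,
      which keeps the slope continuous at w0.\<close>
    define \<Phi> where "\<Phi> w = (if c w k = a k then ?D else ?T w / (c w k - a k))" for w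
    have "isCont \<Phi> w0"
      unfolding isCont_def tendsto_iff
    proof (intro allI impI)
      fix eps :: real assume eps: "eps > 0"
      then have "eps / 2 > 0" by simp
      then obtain e where e: "e > 0" "polydisc n a e \<subseteq> S"
        "\<forall>z\<in>polydisc n a e. cmod (cpartial k f z - cpartial k f a) \<le> eps / 2"
        "\<forall>z\<in>polydisc n a e. \<forall>v\<in>ball (a k) e. \<forall>w\<in>ball (a k) e.
          cmod (f (z(k := v)) - f (z(k := w)) - cpartial k f a * (v - w)) \<le> eps / 2 * cmod (v - w)"
        by (rule cpartial_approx[OF S f a k]) (rule that)
      have "\<forall>\<^sub>F w in nhds w0. dist (\<Phi> w) (\<Phi> w0) < eps"
        using ev[OF e(1)]
      proof eventually_elim
        case (elim w)
        have \<Phi>0: "\<Phi> w0 = ?D" by (simp add: \<Phi>_def a_def)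
        show ?case
        proof (cases "c w k = a k")
          case True
          then show ?thesis using eps \<Phi>0 by (simp add: \<Phi>_def)
        next
          case False
          have "cmod (f ((p k w)(k := c w k)) - f ((p k w)(k := a k)) - ?D * (c w k - a k)) \<le> eps / 2 * cmod (c w k - a k)"
            using e(4) pdisc[OF elim e(1)] polydisc_coord[OF elim k] e(1) by simp
          moreover have "\<Phi> w - ?D = (?T w - ?D * (c w k - a k)) / (c w k - a k)"
            using False by (simp add: \<Phi>_def diff_divide_distrib)
          ultimately have "cmod (\<Phi> w - ?D) \<le> eps / 2"
            using False by (simp add: norm_divide divide_le_eq)
          then show ?thesis using eps \<Phi>0 by (simp add: dist_norm)
        qed
      qed
      then show "\<forall>\<^sub>F w in at w0. dist (\<Phi> w) (\<Phi> w0) < eps"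
        by (auto simp: eventually_at_filter elim: eventually_mono)
    qed
    moreover obtain D' where "((\<lambda>w. c w k) has_field_derivative D') (at w0)"
      using c[OF k] unfolding field_differentiable_def by blast
    then obtain g where g: "\<forall>w. c w k - a k = g w * (w - w0)" "isCont g w0"
      unfolding CARAT_DERIV a_def by blast
    moreover have "\<forall>w. ?T w - ?T w0 = (\<Phi> w * g w) * (w - w0)"
    proof
      fix w
      have "?T w = \<Phi> w * (c w k - a k)" by (simp add: \<Phi>_def)
      moreover have "?T w0 = 0" by (simp add: a_def)
      ultimately show "?T w - ?T w0 = (\<Phi> w * g w) * (w - w0)" using g(1) by simp
    qed
    ultimately have "(?T has_field_derivative \<Phi> w0 * g w0) (at w0)"
      unfolding CARAT_DERIV by (intro exI[of _ "\<lambda>w. \<Phi> w * g w"]) (simp add: isCont_mult)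
    then show ?thesis unfolding field_differentiable_def by blast
  qed
  have "(\<lambda>w. f (p k w)) field_differentiable at w0" if "k \<le> n" for k
    using that
  proof (induction k)
    case 0
    then show ?case by (simp add: p_def)
  next
    case (Suc k)
    have eq: "f (p (Suc k) w) = f (p k w) + (f ((p k w)(k := c w k)) - f ((p k w)(k := a k)))" for w
    proof -
      have "(p k w)(k := c w k) = p (Suc k) w" "(p k w)(k := a k) = p k w" by (auto simp: p_def)
      then show ?thesis by simp
    qed
    show ?case unfolding eq using Suc step[of k] by (intro field_differentiable_add) auto
  qed
  then have "(\<lambda>w. f (p n w)) field_differentiable at w0" by simp
  then obtain D where D: "((\<lambda>w. f (p n w)) has_field_derivative D) (at w0)"
    unfolding field_differentiable_def by blast
  have "\<forall>\<^sub>F w in nhds w0. f (p n w) = f (c w)"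
    using inS
  proof eventually_elim
    case (elim w)
    then have "c w \<in> cspace n" using openin_imp_subset[OF S] by blast
    then have "p n w = c w" using ac by (auto simp: p_def cspace_def)
    then show ?case by simp
  qed
  from DERIV_cong_ev[OF refl this refl] D show ?thesis unfolding field_differentiable_def by blast
qed

lemma hol_on_compose:
  assumes S: "openin (top_of_set (cspace n)) S" and T: "openin (top_of_set (cspace m)) T" and f: "hol_on m T f"
    and g: "\<And>j. j < m \<Longrightarrow> hol_on n S (\<lambda>z. g z j)" and gT: "\<And>z. z \<in> S \<Longrightarrow> g z \<in> T"
  shows "hol_on n S (\<lambda>z. f (g z))"
  unfolding hol_on_def
proof (intro conjI ballI allI impI)
  have cont_f: "continuous_on T f" using f by (simp add: hol_on_def)
  have "continuous_on S g"
  proof (rule continuous_on_coordinatewise_then_product)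
    fix j
    show "continuous_on S (\<lambda>z. g z j)"
    proof (cases "j < m")
      case True
      then show ?thesis using g by (simp add: hol_on_def)
    next
      case False
      have "g z j = 0" if "z \<in> S" for z
        using gT[OF that] openin_imp_subset[OF T] False by (auto simp: cspace_def)
      then show ?thesis using continuous_on_cong[of S S "\<lambda>z. g z j" "\<lambda>z. 0"] by simp
    qed
  qed
  then show "continuous_on S (\<lambda>z. f (g z))"
    by (rule continuous_on_compose2[OF cont_f]) (use gT in auto)
next
  fix a i assume a: "a \<in> S" and i: "i < n"
  show "(\<lambda>w. f (g (a(i := w)))) field_differentiable at (a i)"
  proof (rule field_differentiable_along_curve[OF T f])
    show "(\<lambda>w. g (a(i := w)) j) field_differentiable at (a i)" if "j < m" for j
      using g[OF that] a i by (simp add: hol_on_def)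
    show "\<forall>\<^sub>F w in nhds (a i). g (a(i := w)) \<in> T"
      using eventually_upd_in[OF S a i] by eventually_elim (rule gT)
  qed
qed

section \<open>Differential operators on a complex manifold\<close>

lemma chart_openin:
  assumes "is_chart (n, U, x)" "open W" "W \<subseteq> U"
  shows "openin (top_of_set (cspace n)) (x ` W)"
proof -
  have x: "openin (top_of_set (cspace n)) (x ` U)" "homeomorphism U (x ` U) x (inv_into U x)"
    using assms(1) by (auto simp: is_chart_def)
  have "openin (top_of_set U) W" using assms(2,3) by (auto simp: openin_open)
  then have "openin (top_of_set (x ` U)) (x ` W)" by (rule homeomorphism_imp_open_map[OF x(2)])
  then show ?thesis using x(1) by (rule openin_trans)
qed

lemma chart_inv: "is_chart (n, U, x) \<Longrightarrow> y \<in> U \<Longrightarrow> inv_into U x (x y) = y"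
  by (auto simp: is_chart_def homeomorphism_def)

lemma hol_on_transition:
  assumes c: "is_chart (n, U, x)" "is_chart (m, V, v)" "hol_transition (n, U, x) (m, V, v)"
    and W: "open W" and f: "hol_on m (v ` (W \<inter> V)) (\<lambda>z. f (inv_into V v z))"
  shows "hol_on n (x ` (W \<inter> U \<inter> V)) (\<lambda>z. f (inv_into U x z))"
proof -
  have op: "open U" "open V" using c by (auto simp: is_chart_def)
  have S: "openin (top_of_set (cspace n)) (x ` (W \<inter> U \<inter> V))"
    by (rule chart_openin[OF c(1)]) (use W op in auto)
  have T: "openin (top_of_set (cspace m)) (v ` (W \<inter> V))"
    by (rule chart_openin[OF c(2)]) (use W op in auto)
  have "hol_on n (x ` (W \<inter> U \<inter> V)) (\<lambda>z. (\<lambda>z. f (inv_into V v z)) (v (inv_into U x z)))"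
  proof (rule hol_on_compose[OF S T f])
    fix j assume "j < m"
    then have "hol_on n (x ` (U \<inter> V)) (\<lambda>z. v (inv_into U x z) j)"
      using c(3) by (simp add: hol_transition_def)
    then show "hol_on n (x ` (W \<inter> U \<inter> V)) (\<lambda>z. v (inv_into U x z) j)"
      by (rule hol_on_subset) auto
  next
    fix z assume "z \<in> x ` (W \<inter> U \<inter> V)"
    then show "v (inv_into U x z) \<in> v ` (W \<inter> V)" using chart_inv[OF c(1)] by auto
  qed
  then show ?thesis
    by (rule hol_on_cong[OF S, rotated]) (auto simp: chart_inv[OF c(1)] chart_inv[OF c(2)])
qed

lemma opens_iff: "W \<in> opens U \<longleftrightarrow> open W \<and> W \<subseteq> U"
  by (simp add: opens_def)

lemma hol_funs_extensional: "f \<in> hol_funs A W \<Longrightarrow> f \<in> extensional W"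
  by (simp add: hol_funs_def)

locale complex_atlas =
  fixes A :: "'y::{t2_space, second_countable_topology} chart set"
  assumes atlas: "complex_manifold A"
begin

lemma atlas_chart: "c \<in> A \<Longrightarrow> is_chart c"
  using atlas by (simp add: complex_manifold_def)

lemma hol_funsI:
  assumes "f \<in> extensional W"
    and "\<And>n V x. (n, V, x) \<in> A \<Longrightarrow> hol_on n (x ` (W \<inter> V)) (\<lambda>z. f (inv_into V x z))"
  shows "f \<in> hol_funs A W"
  using assms by (auto simp: hol_funs_def)

lemma hol_funsD:
  "f \<in> hol_funs A W \<Longrightarrow> (n, V, x) \<in> A \<Longrightarrow> hol_on n (x ` (W \<inter> V)) (\<lambda>z. f (inv_into V x z))"
  by (auto simp: hol_funs_def)

lemma atlas_openin: "(n, V, x) \<in> A \<Longrightarrow> open W \<Longrightarrow> openin (top_of_set (cspace n)) (x ` (W \<inter> V))"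
  by (rule chart_openin[OF atlas_chart]) (use atlas_chart in \<open>auto simp: is_chart_def intro: open_Int\<close>)

text \<open>Transfers a pointwise operation from open subsets of \<open>cspace n\<close> to the
  manifold. \<open>K\<close> restricts the second argument, so that division by a function without
  zeros is included.\<close>

lemma hol_funs_lift:
  assumes W: "open W" and fg: "f \<in> hol_funs A W" "g \<in> hol_funs A W"
    and op: "\<And>n S F G. hol_on n S F \<Longrightarrow> hol_on n S G \<Longrightarrow> (\<And>z. z \<in> S \<Longrightarrow> G z \<in> K) \<Longrightarrow>
      hol_on n S (\<lambda>z. h (F z) (G z))"
    and K: "\<And>y. y \<in> W \<Longrightarrow> g y \<in> K"
  shows "(\<lambda>y\<in>W. h (f y) (g y)) \<in> hol_funs A W"
proof (rule hol_funsI)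
  fix n V x assume c: "(n, V, x) \<in> A"
  have inv: "inv_into V x z \<in> W" if "z \<in> x ` (W \<inter> V)" for z
    using that chart_inv[OF atlas_chart[OF c]] by auto
  have "hol_on n (x ` (W \<inter> V)) (\<lambda>z. h (f (inv_into V x z)) (g (inv_into V x z)))"
    by (rule op[OF hol_funsD[OF fg(1) c] hol_funsD[OF fg(2) c]]) (use inv K in auto)
  then show "hol_on n (x ` (W \<inter> V)) (\<lambda>z. (\<lambda>y\<in>W. h (f y) (g y)) (inv_into V x z))"
    by (rule hol_on_cong[OF atlas_openin[OF c W], rotated]) (simp add: inv)
qed simp

lemma hol_funs_const:
  assumes W: "open W" shows "(\<lambda>y\<in>W. c) \<in> hol_funs A W"
proof (rule hol_funsI)
  fix n V x assume ch: "(n, V, x) \<in> A"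
  have inv: "inv_into V x z \<in> W" if "z \<in> x ` (W \<inter> V)" for z
    using that chart_inv[OF atlas_chart[OF ch]] by auto
  show "hol_on n (x ` (W \<inter> V)) (\<lambda>z. (\<lambda>y\<in>W. c) (inv_into V x z))"
    by (rule hol_on_cong[OF atlas_openin[OF ch W] _ hol_on_const[of _ _ c]]) (simp add: inv)
qed simp

lemma hol_funs_mult:
  "open W \<Longrightarrow> f \<in> hol_funs A W \<Longrightarrow> g \<in> hol_funs A W \<Longrightarrow> (\<lambda>y\<in>W. f y * g y) \<in> hol_funs A W"
  by (rule hol_funs_lift[where K = UNIV and h = "(*)"]) (auto intro: hol_on_mult)

lemma hol_funs_divide:
  "open W \<Longrightarrow> f \<in> hol_funs A W \<Longrightarrow> g \<in> hol_funs A W \<Longrightarrow> (\<And>y. y \<in> W \<Longrightarrow> g y \<noteq> 0) \<Longrightarrow>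
    (\<lambda>y\<in>W. f y / g y) \<in> hol_funs A W"
  by (rule hol_funs_lift[where K = "- {0}" and h = "(/)"]) (auto intro: hol_on_divide)

lemma hol_funs_cmult:
  "open W \<Longrightarrow> f \<in> hol_funs A W \<Longrightarrow> (\<lambda>y\<in>W. c * f y) \<in> hol_funs A W"
  by (rule hol_funs_lift[of W f f UNIV "\<lambda>a b. c * a"]) (auto intro: hol_on_mult hol_on_const)

lemma hol_funs_lincomb:
  assumes "open W" "f \<in> hol_funs A W" "g \<in> hol_funs A W"
  shows "(\<lambda>y\<in>W. c * f y + g y) \<in> hol_funs A W"
  by (rule hol_funs_lift[OF assms, of UNIV "\<lambda>a b. c * a + b"])
    (simp_all add: hol_on_add hol_on_mult hol_on_const)

lemma hol_funs_restrict:
  assumes f: "f \<in> hol_funs A W" and W': "open W'" "W' \<subseteq> W"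
  shows "restrict f W' \<in> hol_funs A W'"
proof (rule hol_funsI)
  fix n V x assume c: "(n, V, x) \<in> A"
  have "hol_on n (x ` (W' \<inter> V)) (\<lambda>z. f (inv_into V x z))"
    by (rule hol_on_subset[OF hol_funsD[OF f c]]) (use W' in auto)
  then show "hol_on n (x ` (W' \<inter> V)) (\<lambda>z. restrict f W' (inv_into V x z))"
    by (rule hol_on_cong[OF atlas_openin[OF c W'(1)], rotated]) (use chart_inv[OF atlas_chart[OF c]] in auto)
qed simp

text \<open>A coordinate system need not belong to the atlas. Holomorphy in it is checked locally,
  through an atlas chart around each point and the transition map to that chart.\<close>

lemma hol_funs_in_coordinates:
  assumes c: "coordinate_system A (n, U, x)" and W: "open W" "W \<subseteq> U"
  shows "f \<in> hol_funs A W \<longleftrightarrow> f \<in> extensional W \<and> hol_on n (x ` W) (\<lambda>z. f (inv_into U x z))"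
proof (intro iffI conjI; (elim conjE)?)
  have ch: "is_chart (n, U, x)" using c by (simp add: coordinate_system_def)
  {
    assume f: "f \<in> hol_funs A W"
    show "hol_on n (x ` W) (\<lambda>z. f (inv_into U x z))"
    proof (rule hol_on_local)
      show "x ` W \<subseteq> cspace n" by (rule openin_imp_subset[OF chart_openin[OF ch W]])
      fix a assume "a \<in> x ` W"
      then obtain y where y: "y \<in> W" "a = x y" by blast
      have "\<exists>c\<in>A. case c of (m, V, v) \<Rightarrow> y \<in> V" using atlas by (simp add: complex_manifold_def)
      then obtain e where e: "e \<in> A" "case e of (m, V, v) \<Rightarrow> y \<in> V" by blast
      obtain m V v where "e = (m, V, v)" by (cases e)
      with e have d: "(m, V, v) \<in> A" "y \<in> V" by simp_all
      have "hol_transition (n, U, x) (m, V, v)" using c d(1) by (simp add: coordinate_system_def)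
      from hol_on_transition[OF ch atlas_chart[OF d(1)] this W(1) hol_funsD[OF f d(1)]]
      have "hol_on n (x ` (W \<inter> U \<inter> V)) (\<lambda>z. f (inv_into U x z))" .
      moreover have "open (W \<inter> U \<inter> V)" using W(1) ch atlas_chart[OF d(1)] by (auto simp: is_chart_def)
      then have "openin (top_of_set (cspace n)) (x ` (W \<inter> U \<inter> V))" by (rule chart_openin[OF ch]) auto
      ultimately show "\<exists>T. openin (top_of_set (cspace n)) T \<and> a \<in> T \<and> T \<subseteq> x ` W \<and>
          hol_on n T (\<lambda>z. f (inv_into U x z))"
        using y d(2) W(2) by (intro exI[of _ "x ` (W \<inter> U \<inter> V)"]) auto
    qed
    show "f \<in> extensional W" using f by (rule hol_funs_extensional)
  }
  assume f: "f \<in> extensional W" "hol_on n (x ` W) (\<lambda>z. f (inv_into U x z))"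
  show "f \<in> hol_funs A W"
  proof (rule hol_funsI[OF f(1)])
    fix m V v assume d: "(m, V, v) \<in> A"
    have t: "hol_transition (m, V, v) (n, U, x)" using c d(1) by (simp add: coordinate_system_def)
    have "hol_on n (x ` (W \<inter> U)) (\<lambda>z. f (inv_into U x z))" using f(2) W(2) by (simp add: Int_absorb2)
    from hol_on_transition[OF atlas_chart[OF d] ch t W(1) this]
    show "hol_on m (v ` (W \<inter> V)) (\<lambda>z. f (inv_into V v z))"
      by (rule hol_on_subset) (use W(2) in auto)
  qed
qed

lemma coordinate_hol_fun:
  assumes c: "coordinate_system A (n, U, x)" and W: "open W" "W \<subseteq> U"
  shows "(\<lambda>y\<in>W. x y j) \<in> hol_funs A W"
  unfolding hol_funs_in_coordinates[OF assms]
proof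
  have ch: "is_chart (n, U, x)" using c by (simp add: coordinate_system_def)
  show "hol_on n (x ` W) (\<lambda>z. (\<lambda>y\<in>W. x y j) (inv_into U x z))"
    by (rule hol_on_cong[OF chart_openin[OF ch W] _ hol_on_coord[of _ _ j]])
      (use W(2) chart_inv[OF ch] in auto)
qed simp

lemma hol_funs_pull_back:
  assumes c: "coordinate_system A (n, U, x)" and W: "open W" "W \<subseteq> U" and g: "hol_on n (x ` W) g"
  shows "(\<lambda>y\<in>W. g (x y)) \<in> hol_funs A W"
  unfolding hol_funs_in_coordinates[OF c W]
proof
  have ch: "is_chart (n, U, x)" using c by (simp add: coordinate_system_def)
  show "hol_on n (x ` W) (\<lambda>z. (\<lambda>y\<in>W. g (x y)) (inv_into U x z))"
    by (rule hol_on_cong[OF chart_openin[OF ch W] _ g]) (use W(2) chart_inv[OF ch] in auto)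
qed simp

section \<open>Operators on the structure sheaf\<close>

lemma mk_op_apply: "W \<in> opens U \<Longrightarrow> f \<in> hol_funs A W \<Longrightarrow> mk_op A U F W f = (\<lambda>y\<in>W. F W f y)"
  by (simp add: mk_op_def)

lemma mk_op_lin_endos:
  assumes "\<And>W f. W \<in> opens U \<Longrightarrow> f \<in> hol_funs A W \<Longrightarrow> (\<lambda>y\<in>W. F W f y) \<in> hol_funs A W"
    and "\<And>W f g c y. W \<in> opens U \<Longrightarrow> f \<in> hol_funs A W \<Longrightarrow> g \<in> hol_funs A W \<Longrightarrow> y \<in> W \<Longrightarrow>
      F W (\<lambda>y\<in>W. c * f y + g y) y = c * F W f y + F W g y"
    and "\<And>W W' f y. W \<in> opens U \<Longrightarrow> W' \<in> opens W \<Longrightarrow> f \<in> hol_funs A W \<Longrightarrow> y \<in> W' \<Longrightarrow>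
      F W' (restrict f W') y = F W f y"
  shows "mk_op A U F \<in> lin_endos A U"
  unfolding lin_endos_def
proof (intro CollectI conjI ballI allI)
  show "mk_op A U F \<in> extensional (opens U)" by (simp add: mk_op_def)
  fix W assume W: "W \<in> opens U"
  then have oW: "open W" by (simp add: opens_iff)
  show "mk_op A U F W \<in> hol_funs A W \<rightarrow>\<^sub>E hol_funs A W"
    using assms(1)[OF W] W by (auto simp: mk_op_def)
  show "mk_op A U F W (\<lambda>y\<in>W. c * f y + g y) = (\<lambda>y\<in>W. c * mk_op A U F W f y + mk_op A U F W g y)"
    if fg: "f \<in> hol_funs A W" "g \<in> hol_funs A W" for f g c
  proof -
    have "mk_op A U F W (\<lambda>y\<in>W. c * f y + g y) = (\<lambda>y\<in>W. F W (\<lambda>y\<in>W. c * f y + g y) y)"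
      by (rule mk_op_apply[OF W hol_funs_lincomb[OF oW fg]])
    also have "\<dots> = (\<lambda>y\<in>W. c * F W f y + F W g y)" using assms(2)[OF W fg] by (auto intro!: restrict_ext)
    also have "\<dots> = (\<lambda>y\<in>W. c * mk_op A U F W f y + mk_op A U F W g y)"
      using mk_op_apply[OF W fg(1), of F] mk_op_apply[OF W fg(2), of F] by (auto intro!: restrict_ext)
    finally show ?thesis .
  qed
  show "mk_op A U F W' (restrict f W') = restrict (mk_op A U F W f) W'"
    if W': "W' \<in> opens W" and f: "f \<in> hol_funs A W" for W' f
  proof -
    have "W' \<in> opens U" using W W' by (auto simp: opens_iff)
    moreover have "restrict f W' \<in> hol_funs A W'" using hol_funs_restrict[OF f] W' by (simp add: opens_iff)
    ultimately have "mk_op A U F W' (restrict f W') = (\<lambda>y\<in>W'. F W' (restrict f W') y)" by (rule mk_op_apply)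
    also have "\<dots> = (\<lambda>y\<in>W'. F W f y)" using assms(3)[OF W W' f] by (auto intro!: restrict_ext)
    also have "\<dots> = restrict (mk_op A U F W f) W'"
      unfolding mk_op_apply[OF W f] using W' by (auto simp: opens_iff restrict_def fun_eq_iff)
    finally show ?thesis .
  qed
qed

lemma lin_endos_hol: "P \<in> lin_endos A U \<Longrightarrow> W \<in> opens U \<Longrightarrow> f \<in> hol_funs A W \<Longrightarrow> P W f \<in> hol_funs A W"
  by (auto simp: lin_endos_def)

text \<open>Operators are extensional in the open set, the function and the point, so an identity
  between them may be verified on values.\<close>

lemma lin_endos_eqI:
  assumes P: "P \<in> lin_endos A U" and Q: "Q \<in> lin_endos A U"
    and eq: "\<And>W f y. W \<in> opens U \<Longrightarrow> f \<in> hol_funs A W \<Longrightarrow> y \<in> W \<Longrightarrow> P W f y = Q W f y"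
  shows "P = Q"
proof (rule extensionalityI[of _ "opens U"])
  show "P \<in> extensional (opens U)" "Q \<in> extensional (opens U)" using P Q by (auto simp: lin_endos_def)
  fix W assume W: "W \<in> opens U"
  show "P W = Q W"
  proof (rule extensionalityI[of _ "hol_funs A W"])
    show "P W \<in> extensional (hol_funs A W)" "Q W \<in> extensional (hol_funs A W)"
      using P Q W by (auto simp: lin_endos_def PiE_def)
    fix f assume f: "f \<in> hol_funs A W"
    show "P W f = Q W f"
      by (rule extensionalityI[of _ W])
        (use eq[OF W f] hol_funs_extensional[OF lin_endos_hol[OF P W f]]
          hol_funs_extensional[OF lin_endos_hol[OF Q W f]] in auto)
  qed
qed

lemma lin_endos_cmult:
  assumes P: "P \<in> lin_endos A U" and W: "W \<in> opens U" and f: "f \<in> hol_funs A W"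
  shows "P W (\<lambda>y\<in>W. c * f y) = (\<lambda>y\<in>W. c * P W f y)"
proof -
  have oW: "open W" using W by (simp add: opens_iff)
  have lin: "P W (\<lambda>y\<in>W. c * f y + g y) = (\<lambda>y\<in>W. c * P W f y + P W g y)"
    if "f \<in> hol_funs A W" "g \<in> hol_funs A W" for f g c
    using P W that by (auto simp: lin_endos_def)
  let ?z = "\<lambda>y\<in>W. 0 :: complex"
  have z: "?z \<in> hol_funs A W" by (rule hol_funs_const[OF oW])
  \<comment> \<open>Linearity is stated for combinations c * f + g only. That the zero function is
    mapped to zero follows by writing it as 1 * z + z.\<close>
  have "(\<lambda>y\<in>W. 1 * ?z y + ?z y) = ?z" by (auto intro!: restrict_ext)
  then have Pz_eq: "P W ?z = (\<lambda>y\<in>W. 1 * P W ?z y + P W ?z y)" using lin[OF z z, of 1] by simp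
  have Pz: "P W ?z y = 0" if "y \<in> W" for y
    using fun_cong[OF Pz_eq, of y] that by simp
  have "(\<lambda>y\<in>W. c * f y + ?z y) = (\<lambda>y\<in>W. c * f y)" by (auto intro!: restrict_ext)
  then have "P W (\<lambda>y\<in>W. c * f y) = (\<lambda>y\<in>W. c * P W f y + P W ?z y)" using lin[OF f z, of c] by simp
  also have "\<dots> = (\<lambda>y\<in>W. c * P W f y)" using Pz by (auto intro!: restrict_ext)
  finally show ?thesis .
qed

lemma res_mk_op: "W \<subseteq> U \<Longrightarrow> res_op U W (mk_op A U F) = mk_op A W F"
  by (auto simp: res_op_def mk_op_def opens_def restrict_def fun_eq_iff)

lemma res_res_op: "W' \<subseteq> W \<Longrightarrow> W \<subseteq> U \<Longrightarrow> res_op W W' (res_op U W P) = res_op U W' P"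
  by (auto simp: res_op_def opens_def restrict_def fun_eq_iff)

lemma res_op_apply: "W' \<in> opens W \<Longrightarrow> res_op U W P W' = P W'"
  by (simp add: res_op_def)

lemma mk_op_cong:
  "(\<And>W f y. W \<in> opens U \<Longrightarrow> f \<in> hol_funs A W \<Longrightarrow> y \<in> W \<Longrightarrow> F W f y = G W f y) \<Longrightarrow> mk_op A U F = mk_op A U G"
  by (auto simp: mk_op_def intro!: restrict_ext)

lemma mult_op_restrict: "mult_op A W (restrict h W) = mult_op A W h"
  unfolding mult_op_def by (rule mk_op_cong) (auto simp: opens_iff)

lemma opens_trans: "W' \<in> opens W \<Longrightarrow> W \<in> opens U \<Longrightarrow> W' \<in> opens U"
  by (auto simp: opens_iff)

lemma lin_endos_res:
  assumes P: "P \<in> lin_endos A U" and W: "W \<in> opens U"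
  shows "res_op U W P \<in> lin_endos A W"
  unfolding lin_endos_def
proof (intro CollectI conjI ballI)
  show "res_op U W P \<in> extensional (opens W)" by (simp add: res_op_def)
  fix W1 assume W1: "W1 \<in> opens W"
  have W1U: "W1 \<in> opens U" by (rule opens_trans[OF W1 W])
  have eq: "res_op U W P W1 = P W1" by (rule res_op_apply[OF W1])
  have P1: "P W1 \<in> hol_funs A W1 \<rightarrow>\<^sub>E hol_funs A W1"
    "\<forall>f\<in>hol_funs A W1. \<forall>g\<in>hol_funs A W1. \<forall>c.
      P W1 (\<lambda>y\<in>W1. c * f y + g y) = (\<lambda>y\<in>W1. c * P W1 f y + P W1 g y)"
    "\<forall>W2\<in>opens W1. \<forall>f\<in>hol_funs A W1. P W2 (restrict f W2) = restrict (P W1 f) W2"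
    using P W1U by (auto simp: lin_endos_def)
  show "res_op U W P W1 \<in> hol_funs A W1 \<rightarrow>\<^sub>E hol_funs A W1" unfolding eq by (rule P1(1))
  show "\<forall>c. res_op U W P W1 (\<lambda>y\<in>W1. c * f y + g y) = (\<lambda>y\<in>W1. c * res_op U W P W1 f y + res_op U W P W1 g y)"
    if "f \<in> hol_funs A W1" "g \<in> hol_funs A W1" for f g
    unfolding eq using P1(2) that by simp
  show "res_op U W P W2 (restrict f W2) = restrict (res_op U W P W1 f) W2"
    if "W2 \<in> opens W1" "f \<in> hol_funs A W1" for W2 f
    unfolding eq res_op_apply[OF opens_trans[OF that(1) W1]] using P1(3) that by simp
qed

lemma diff_gen_res:
  assumes "P \<in> diff_gen A U" and W: "W \<in> opens U"
  shows "res_op U W P \<in> diff_gen A W"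
  using assms(1)
proof induction
  case (1 h)
  have "restrict h W \<in> hol_funs A W" using hol_funs_restrict[OF 1] W by (simp add: opens_iff)
  then have "mult_op A W (restrict h W) \<in> diff_gen A W" by (rule diff_gen.intros)
  then show ?case using W unfolding mult_op_restrict by (simp add: mult_op_def res_mk_op opens_iff)
next
  case (2 P)
  have vf: "\<forall>W\<in>opens U. \<forall>f\<in>hol_funs A W. \<forall>g\<in>hol_funs A W.
     P W (\<lambda>y\<in>W. f y * g y) = (\<lambda>y\<in>W. f y * P W g y + P W f y * g y)" and "P \<in> lin_endos A U"
    using 2 by (simp_all add: vector_fields_def)
  have "res_op U W P \<in> vector_fields A W"
    unfolding vector_fields_def
  proof (intro CollectI conjI ballI)
    show "res_op U W P \<in> lin_endos A W" by (rule lin_endos_res[OF \<open>P \<in> lin_endos A U\<close> W])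
    fix W1 f g assume W1: "W1 \<in> opens W" and "f \<in> hol_funs A W1" "g \<in> hol_funs A W1"
    then show "res_op U W P W1 (\<lambda>y\<in>W1. f y * g y) =
        (\<lambda>y\<in>W1. f y * res_op U W P W1 g y + res_op U W P W1 f y * g y)"
      unfolding res_op_apply[OF W1] using vf opens_trans[OF W1 W] by simp
  qed
  then show ?case by (rule diff_gen.intros)
next
  case (3 P Q)
  have "res_op U W (add_op A U P Q) = add_op A W (res_op U W P) (res_op U W Q)"
    using W unfolding add_op_def by (subst res_mk_op) (auto simp: opens_iff res_op_apply intro!: mk_op_cong)
  then show ?case using 3 by (simp add: diff_gen.intros)
next
  case (4 P Q)
  have "res_op U W (comp_op A U P Q) = comp_op A W (res_op U W P) (res_op U W Q)"
    using W unfolding comp_op_def by (subst res_mk_op) (auto simp: opens_iff res_op_apply intro!: mk_op_cong)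
  then show ?case using 4 by (simp add: diff_gen.intros)
qed

lemma diff_ops_res:
  assumes P: "P \<in> diff_ops A U" and W: "W \<in> opens U"
  shows "res_op U W P \<in> diff_ops A W"
  unfolding diff_ops_def
proof (intro CollectI conjI ballI)
  show "res_op U W P \<in> lin_endos A W" using P lin_endos_res[OF _ W] by (simp add: diff_ops_def)
  fix y assume y: "y \<in> W"
  then have "y \<in> U" using W by (auto simp: opens_iff)
  then obtain W1 where W1: "W1 \<in> opens U" "y \<in> W1" "res_op U W1 P \<in> diff_gen A W1"
    using P unfolding diff_ops_def by blast
  have sub: "W1 \<inter> W \<in> opens W1" "W1 \<inter> W \<in> opens W" "W1 \<subseteq> U" "W \<subseteq> U"
    using W W1 by (auto simp: opens_iff)
  have "res_op W1 (W1 \<inter> W) (res_op U W1 P) \<in> diff_gen A (W1 \<inter> W)"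
    by (rule diff_gen_res[OF W1(3) sub(1)])
  then have "res_op W (W1 \<inter> W) (res_op U W P) \<in> diff_gen A (W1 \<inter> W)"
    using sub by (simp add: res_res_op)
  then show "\<exists>W'\<in>opens W. y \<in> W' \<and> res_op W W' (res_op U W P) \<in> diff_gen A W'"
    using sub(2) y W1(2) by blast
qed

lemma V_ops_res:
  assumes P: "P \<in> V_ops A r E n U" and W: "W \<in> opens U"
  shows "res_op U W P \<in> V_ops A r E n W"
  unfolding V_ops_def V_ops1_def
proof (intro CollectI conjI allI impI ballI)
  have P': "P \<in> diff_ops A U" and V: "\<forall>i<r. P \<in> V_ops1 A (E i) (n i) U"
    using P by (simp_all add: V_ops_def)
  show res: "res_op U W P \<in> diff_ops A W" by (rule diff_ops_res[OF P' W])
  show "res_op U W P \<in> diff_ops A W" by (rule res)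
  fix i k W1 f assume i: "i < r" and k: "0 \<le> k" and W1: "W1 \<in> opens W" and f: "f \<in> ideal_power A (E i) k W1"
  show "res_op U W P W1 f \<in> ideal_power A (E i) (k + n i) W1"
    unfolding res_op_apply[OF W1] using V i k opens_trans[OF W1 W] f by (simp add: V_ops1_def)
qed

lemma diff_gen_diff_ops: "P \<in> diff_gen A U \<Longrightarrow> P \<in> lin_endos A U \<Longrightarrow> open U \<Longrightarrow> P \<in> diff_ops A U"
proof -
  assume P: "P \<in> diff_gen A U" "P \<in> lin_endos A U" and U: "open U"
  have "P \<in> extensional (opens U)" using P(2) by (auto simp: lin_endos_def)
  then have "res_op U U P = P" by (simp add: res_op_def extensional_restrict)
  moreover have "U \<in> opens U" using U by (simp add: opens_iff)
  ultimately show ?thesis using P unfolding diff_ops_def by (intro CollectI conjI ballI bexI[of _ U]) simp_all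
qed

lemma mult_op_apply:
  "W \<in> opens U \<Longrightarrow> f \<in> hol_funs A W \<Longrightarrow> mult_op A U h W f = (\<lambda>y\<in>W. h y * f y)"
  by (simp add: mult_op_def mk_op_apply)

lemma mult_op_lin_endos:
  assumes h: "h \<in> hol_funs A U"
  shows "mult_op A U h \<in> lin_endos A U"
  unfolding mult_op_def
proof (rule mk_op_lin_endos)
  fix W f assume W: "W \<in> opens U" and f: "f \<in> hol_funs A W"
  then have oW: "open W" "W \<subseteq> U" by (auto simp: opens_iff)
  have "(\<lambda>y\<in>W. restrict h W y * f y) \<in> hol_funs A W"
    by (rule hol_funs_mult[OF oW(1) hol_funs_restrict[OF h oW] f])
  moreover have "(\<lambda>y\<in>W. restrict h W y * f y) = (\<lambda>y\<in>W. h y * f y)" by (auto intro!: restrict_ext)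
  ultimately show "(\<lambda>y\<in>W. h y * f y) \<in> hol_funs A W" by (simp only:)
qed (auto simp: opens_iff algebra_simps)

lemma mult_op_diff_ops: "open U \<Longrightarrow> h \<in> hol_funs A U \<Longrightarrow> mult_op A U h \<in> diff_ops A U"
  by (intro diff_gen_diff_ops diff_gen.intros mult_op_lin_endos)

lemma const_op_eq: "const_op A U c = mult_op A U (\<lambda>y\<in>U. c)"
  unfolding const_op_def by (rule mult_op_restrict[symmetric])

lemma const_op_diff_ops: "open U \<Longrightarrow> const_op A U c \<in> diff_ops A U"
  unfolding const_op_eq by (intro mult_op_diff_ops hol_funs_const)

lemma const_op_apply:
  "W \<in> opens U \<Longrightarrow> f \<in> hol_funs A W \<Longrightarrow> const_op A U c W f = (\<lambda>y\<in>W. c * f y)"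
  by (simp add: const_op_def mult_op_apply)

lemma diff_ops_lin_endos: "P \<in> diff_ops A U \<Longrightarrow> P \<in> lin_endos A U"
  by (simp add: diff_ops_def)

lemma add_op_apply:
  "W \<in> opens U \<Longrightarrow> f \<in> hol_funs A W \<Longrightarrow> add_op A U P Q W f = (\<lambda>y\<in>W. P W f y + Q W f y)"
  by (simp add: add_op_def mk_op_apply)

lemma comp_op_apply:
  assumes "W \<in> opens U" "f \<in> hol_funs A W" "P \<in> lin_endos A U" "Q \<in> lin_endos A U"
  shows "comp_op A U P Q W f = P W (Q W f)"
proof -
  have "comp_op A U P Q W f = restrict (P W (Q W f)) W"
    using assms by (simp add: comp_op_def mk_op_apply)
  then show ?thesis
    using hol_funs_extensional[OF lin_endos_hol[OF assms(3,1) lin_endos_hol[OF assms(4,1,2)]]]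
    by (simp add: extensional_restrict)
qed

end

section \<open>Operators in a coordinate system\<close>

locale holomorphic_coordinates = complex_atlas A
  for A :: "'y::{t2_space, second_countable_topology} chart set" +
  fixes n :: nat and U :: "'y set" and x :: "'y \<Rightarrow> nat \<Rightarrow> complex"
  assumes coords: "coordinate_system A (n, U, x)"
begin

lemma chart: "is_chart (n, U, x)"
  using coords by (simp add: coordinate_system_def)

lemma open_U: "open U"
  using chart by (simp add: is_chart_def)

lemma inv_chart [simp]: "y \<in> U \<Longrightarrow> inv_into U x (x y) = y"
  by (rule chart_inv[OF chart])

lemma openin_image: "W \<in> opens U \<Longrightarrow> openin (top_of_set (cspace n)) (x ` W)"
  by (rule chart_openin[OF chart]) (simp_all add: opens_iff)

abbreviation push :: "('y \<Rightarrow> complex) \<Rightarrow> (nat \<Rightarrow> complex) \<Rightarrow> complex" where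
  "push f \<equiv> (\<lambda>z. f (inv_into U x z))"

lemma push_hol: "W \<in> opens U \<Longrightarrow> f \<in> hol_funs A W \<Longrightarrow> hol_on n (x ` W) (push f)"
  using hol_funs_in_coordinates[OF coords] by (simp add: opens_iff)

lemma pull_hol: "W \<in> opens U \<Longrightarrow> hol_on n (x ` W) g \<Longrightarrow> (\<lambda>y\<in>W. g (x y)) \<in> hol_funs A W"
  using hol_funs_pull_back[OF coords] by (simp add: opens_iff)

lemma cpartial_chart_cong:
  assumes W: "W \<in> opens U" and eq: "\<And>y. y \<in> W \<Longrightarrow> F (x y) = G (x y)" and y: "y \<in> W" and j: "j < n"
  shows "cpartial j F (x y) = cpartial j G (x y)"
  by (rule cpartial_cong[OF openin_image[OF W] _ _ j]) (use eq y in auto)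

lemma hol_partial:
  "W \<in> opens U \<Longrightarrow> f \<in> hol_funs A W \<Longrightarrow> j < n \<Longrightarrow> (\<lambda>y\<in>W. cpartial j (push f) (x y)) \<in> hol_funs A W"
  by (intro pull_hol hol_on_cpartial openin_image push_hol)

lemma partial_op_eq: "partial_op A (n, U, x) j = mk_op A U (\<lambda>W f y. cpartial j (push f) (x y))"
  by (simp add: partial_op_def cpartial_def)

lemma partial_op_apply:
  "W \<in> opens U \<Longrightarrow> f \<in> hol_funs A W \<Longrightarrow>
    partial_op A (n, U, x) j W f = (\<lambda>y\<in>W. cpartial j (push f) (x y))"
  by (simp add: partial_op_eq mk_op_apply)

lemma in_U: "W \<in> opens U \<Longrightarrow> y \<in> W \<Longrightarrow> y \<in> U"
  by (auto simp: opens_iff)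

lemma partial_op_lin_endos:
  assumes j: "j < n"
  shows "partial_op A (n, U, x) j \<in> lin_endos A U"
  unfolding partial_op_eq
proof (rule mk_op_lin_endos)
  show "(\<lambda>y\<in>W. cpartial j (push f) (x y)) \<in> hol_funs A W" if "W \<in> opens U" "f \<in> hol_funs A W" for W f
    by (rule hol_partial[OF that j])
next
  fix W f g c y assume W: "W \<in> opens U" and f: "f \<in> hol_funs A W" and g: "g \<in> hol_funs A W" and y: "y \<in> W"
  have xy: "x y \<in> x ` W" using y by simp
  note pf = push_hol[OF W f] and pg = push_hol[OF W g]
  have "cpartial j (push (\<lambda>y\<in>W. c * f y + g y)) (x y) = cpartial j (\<lambda>z. c * push f z + push g z) (x y)"
    by (rule cpartial_chart_cong[OF W _ y j]) (simp add: in_U[OF W])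
  also have "\<dots> = cpartial j (\<lambda>z. c * push f z) (x y) + cpartial j (push g) (x y)"
    by (rule cpartial_add[OF hol_on_mult[OF hol_on_const pf] pg xy j])
  also have "cpartial j (\<lambda>z. c * push f z) (x y) = c * cpartial j (push f) (x y)"
    using cpartial_mult[OF hol_on_const pf xy j, of c] by (simp add: cpartial_const)
  finally show "cpartial j (push (\<lambda>y\<in>W. c * f y + g y)) (x y) = c * cpartial j (push f) (x y) + cpartial j (push g) (x y)" .
next
  fix W W' f y assume W: "W \<in> opens U" and W': "W' \<in> opens W" and y: "y \<in> W'"
  have W'U: "W' \<in> opens U" by (rule opens_trans[OF W' W])
  show "cpartial j (push (restrict f W')) (x y) = cpartial j (push f) (x y)"
    by (rule cpartial_chart_cong[OF W'U _ y j]) (simp add: in_U[OF W'U])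
qed

lemma partial_op_vector_field:
  assumes j: "j < n"
  shows "partial_op A (n, U, x) j \<in> vector_fields A U"
  unfolding vector_fields_def
proof (intro CollectI conjI ballI partial_op_lin_endos[OF j])
  fix W f g assume W: "W \<in> opens U" and f: "f \<in> hol_funs A W" and g: "g \<in> hol_funs A W"
  have fg: "(\<lambda>y\<in>W. f y * g y) \<in> hol_funs A W" using W f g by (intro hol_funs_mult) (simp_all add: opens_iff)
  have "cpartial j (push (\<lambda>y\<in>W. f y * g y)) (x y) =
      f y * cpartial j (push g) (x y) + cpartial j (push f) (x y) * g y" if y: "y \<in> W" for y
  proof -
    have xy: "x y \<in> x ` W" using y by simp
    have "cpartial j (push (\<lambda>y\<in>W. f y * g y)) (x y) = cpartial j (\<lambda>z. push f z * push g z) (x y)"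
      by (rule cpartial_chart_cong[OF W _ y j]) (simp add: in_U[OF W])
    then show ?thesis
      using cpartial_mult[OF push_hol[OF W f] push_hol[OF W g] xy j] in_U[OF W y] by simp
  qed
  then show "partial_op A (n, U, x) j W (\<lambda>y\<in>W. f y * g y) =
      (\<lambda>y\<in>W. f y * partial_op A (n, U, x) j W g y + partial_op A (n, U, x) j W f y * g y)"
    unfolding partial_op_apply[OF W fg] partial_op_apply[OF W f] partial_op_apply[OF W g]
    by (auto intro!: restrict_ext)
qed

lemma partial_op_diff_ops: "j < n \<Longrightarrow> partial_op A (n, U, x) j \<in> diff_ops A U"
  by (intro diff_gen_diff_ops diff_gen.intros(2) partial_op_vector_field partial_op_lin_endos open_U)

abbreviation coord :: "nat \<Rightarrow> 'y \<Rightarrow> complex" where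
  "coord j \<equiv> (\<lambda>y\<in>U. x y j)"

lemma coord_hol: "coord j \<in> hol_funs A U"
  by (rule coordinate_hol_fun[OF coords open_U order.refl])

lemma mult_coord_apply:
  "W \<in> opens U \<Longrightarrow> f \<in> hol_funs A W \<Longrightarrow> mult_op A U (coord j) W f = (\<lambda>y\<in>W. x y j * f y)"
  by (auto simp: mult_op_apply intro!: restrict_ext dest: in_U)

lemma mult_coord_hol: "W \<in> opens U \<Longrightarrow> f \<in> hol_funs A W \<Longrightarrow> (\<lambda>y\<in>W. x y j * f y) \<in> hol_funs A W"
  using lin_endos_hol[OF mult_op_lin_endos[OF coord_hol, of j], of W f] mult_coord_apply by simp

text \<open>This is \<partial>_j x_j, the negative of the operator s_j; the sign is restored when
  the affine forms are built.\<close>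

definition euler :: "nat \<Rightarrow> 'y oper" where
  "euler j = comp_op A U (partial_op A (n, U, x) j) (mult_op A U (coord j))"

lemma euler_apply:
  assumes "W \<in> opens U" "f \<in> hol_funs A W" "j < n"
  shows "euler j W f = (\<lambda>y\<in>W. cpartial j (\<lambda>z. z j * push f z) (x y))"
proof -
  have "euler j W f = (\<lambda>y\<in>W. cpartial j (push (\<lambda>y\<in>W. x y j * f y)) (x y))"
    unfolding euler_def comp_op_apply[OF assms(1,2) partial_op_lin_endos[OF assms(3)] mult_op_lin_endos[OF coord_hol]]
      mult_coord_apply[OF assms(1,2)]
    by (rule partial_op_apply[OF assms(1) mult_coord_hol[OF assms(1,2)]])
  also have "\<dots> = (\<lambda>y\<in>W. cpartial j (\<lambda>z. z j * push f z) (x y))"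
  proof (rule restrict_ext)
    fix y assume y: "y \<in> W"
    show "cpartial j (push (\<lambda>y\<in>W. x y j * f y)) (x y) = cpartial j (\<lambda>z. z j * push f z) (x y)"
      by (rule cpartial_chart_cong[OF assms(1) _ y assms(3)]) (simp add: in_U[OF assms(1)])
  qed
  finally show ?thesis .
qed

lemma partial_partial_commute:
  assumes ij: "i < n" "j < n" and W: "W \<in> opens U" and f: "f \<in> hol_funs A W" and y: "y \<in> W"
  shows "comp_op A U (partial_op A (n, U, x) i) (partial_op A (n, U, x) j) W f y =
    comp_op A U (partial_op A (n, U, x) j) (partial_op A (n, U, x) i) W f y"
proof -
  have eq: "comp_op A U (partial_op A (n, U, x) i) (partial_op A (n, U, x) j) W f y =
      cpartial i (cpartial j (push f)) (x y)" if ij: "i < n" "j < n" for i j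
  proof -
    have "comp_op A U (partial_op A (n, U, x) i) (partial_op A (n, U, x) j) W f y =
        cpartial i (push (\<lambda>y\<in>W. cpartial j (push f) (x y))) (x y)"
      using W f y ij by (simp add: comp_op_apply partial_op_lin_endos partial_op_apply hol_partial)
    also have "\<dots> = cpartial i (cpartial j (push f)) (x y)"
      by (rule cpartial_chart_cong[OF W _ y ij(1)]) (simp add: in_U[OF W])
    finally show ?thesis .
  qed
  have "x y \<in> x ` W" using y by simp
  then show ?thesis
    using cpartial_commute[OF openin_image[OF W] push_hol[OF W f] ij] eq[OF ij] eq[OF ij(2,1)] by simp
qed

lemma partial_mult_commute:
  assumes ij: "i < n" "i \<noteq> j" and W: "W \<in> opens U" and f: "f \<in> hol_funs A W" and y: "y \<in> W"
  shows "comp_op A U (partial_op A (n, U, x) i) (mult_op A U (coord j)) W f y =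
    comp_op A U (mult_op A U (coord j)) (partial_op A (n, U, x) i) W f y"
proof -
  have xy: "x y \<in> x ` W" using y by simp
  have "comp_op A U (partial_op A (n, U, x) i) (mult_op A U (coord j)) W f y =
      cpartial i (push (\<lambda>y\<in>W. x y j * f y)) (x y)"
    using W f y ij by (simp add: comp_op_apply partial_op_lin_endos mult_op_lin_endos[OF coord_hol]
        mult_coord_apply partial_op_apply mult_coord_hol)
  also have "\<dots> = cpartial i (\<lambda>z. z j * push f z) (x y)"
    by (rule cpartial_chart_cong[OF W _ y ij(1)]) (simp add: in_U[OF W])
  also have "\<dots> = x y j * cpartial i (push f) (x y)"
    using cpartial_mult[OF hol_on_coord push_hol[OF W f] xy ij(1), of j] ij(2) by (simp add: cpartial_coord)
  also have "\<dots> = comp_op A U (mult_op A U (coord j)) (partial_op A (n, U, x) i) W f y"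
    using W f y ij by (simp add: comp_op_apply partial_op_lin_endos mult_op_lin_endos[OF coord_hol]
        mult_coord_apply partial_op_apply hol_partial)
  finally show ?thesis .
qed

text \<open>The vector field x_j \<partial>_j is tangent to Z: for i = j its coefficient vanishes on
  Z, and for i \<noteq> j motion in the direction x_j stays inside Z, where t is zero.\<close>

lemma tangential_derivative:
  assumes Z: "Z \<inter> U = {y \<in> U. x y i = 0}" and W: "W \<in> opens U" and t: "local_equation A Z W t"
    and y: "y \<in> W" "y \<in> Z" and j: "j < n"
  shows "x y j = 0 \<or> cpartial j (push t) (x y) = 0"
proof (cases "i = j")
  case True
  then show ?thesis using Z y in_U[OF W] by blast
next
  case False
  have xi: "x y i = 0" using Z y in_U[OF W] by blast
  have "x y \<in> x ` W" using y by simp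
  from eventually_upd_in[OF openin_image[OF W] this j]
  have "\<forall>\<^sub>F w in nhds (x y j). push t ((x y)(j := w)) = 0"
  proof eventually_elim
    case (elim w)
    then obtain y' where y': "y' \<in> W" "(x y)(j := w) = x y'" by blast
    have "x y' i = 0" using fun_cong[OF y'(2), of i] False xi by simp
    then have "y' \<in> Z" using Z in_U[OF W y'(1)] by blast
    then have "t y' = 0" using t y'(1) unfolding local_equation_def by blast
    then show ?case unfolding y'(2) using in_U[OF W y'(1)] by simp
  qed
  then have "deriv (\<lambda>w. push t ((x y)(j := w))) (x y j) = deriv (\<lambda>w. 0) (x y j)"
    by (rule deriv_cong_ev) simp
  then show ?thesis by (simp add: cpartial_def)
qed

text \<open>The local equation t may come from a different coordinate system, so it need not equal
  x_i. Still x_j \<partial>_j t vanishes on Z by tangency, and in the coordinates belonging to t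
  this is divisibility by a coordinate. Where Z is absent, t has no zeros and one divides
  directly.\<close>

lemma log_derivative_divisible:
  assumes Z: "Z \<inter> U \<noteq> {} \<Longrightarrow> Z \<inter> U = {y \<in> U. x y i = 0}" and W: "W \<in> opens U"
    and t: "local_equation A Z W t" and j: "j < n"
  obtains q where "q \<in> hol_funs A W" "\<forall>y\<in>W. x y j * cpartial j (push t) (x y) = t y * q y"
proof -
  have oW: "open W" using W by (simp add: opens_iff)
  have th: "t \<in> hol_funs A W" and tZ: "Z \<inter> W = {y \<in> W. t y = 0}" using t by (auto simp: local_equation_def)
  define u where "u = (\<lambda>y\<in>W. x y j * cpartial j (push t) (x y))"
  have "(\<lambda>y\<in>W. x y j * (\<lambda>y\<in>W. cpartial j (push t) (x y)) y) \<in> hol_funs A W"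
    by (rule mult_coord_hol[OF W hol_partial[OF W th j]])
  moreover have "(\<lambda>y\<in>W. x y j * (\<lambda>y\<in>W. cpartial j (push t) (x y)) y) = u"
    unfolding u_def by (auto intro!: restrict_ext)
  ultimately have u: "u \<in> hol_funs A W" by (simp only:)
  show ?thesis
  proof (cases "Z \<inter> W = {}")
    case True
    then have "t y \<noteq> 0" if "y \<in> W" for y using that tZ by blast
    then have "(\<lambda>y\<in>W. u y / t y) \<in> hol_funs A W" "\<forall>y\<in>W. u y = t y * (\<lambda>y\<in>W. u y / t y) y"
      using hol_funs_divide[OF oW u th] by auto
    then show ?thesis by (intro that[of "\<lambda>y\<in>W. u y / t y"]) (auto simp: u_def)
  next
    case False
    then obtain n' x' j' where c': "coordinate_system A (n', W, x')" "j' < n'" "t = (\<lambda>y\<in>W. x' y j')"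
      using t unfolding local_equation_def by blast
    interpret c': holomorphic_coordinates A n' W x' by unfold_locales (rule c'(1))
    have WW: "W \<in> opens W" using oW by (simp add: opens_iff)
    have Zeq: "Z \<inter> U = {y \<in> U. x y i = 0}" by (rule Z) (use False in_U[OF W] in blast)
    have zero: "c'.push u z = 0" if z: "z \<in> x' ` W" "z j' = 0" for z
    proof -
      obtain y where y: "y \<in> W" "z = x' y" using z(1) by blast
      then have "t y = 0" using z(2) c'(3) by simp
      then have "y \<in> Z" using tZ y(1) by blast
      from tangential_derivative[OF Zeq W t y(1) this j]
      have "u y = 0" using y(1) by (auto simp: u_def)
      then show ?thesis using y by simp
    qed
    obtain q where q: "hol_on n' (x' ` W) q" "\<forall>z\<in>x' ` W. c'.push u z = z j' * q z"
      by (rule divisible_by_coordinate[OF c'.openin_image[OF WW] c'.push_hol[OF WW u] c'(2) zero]) (assumption | rule that)+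
    have "(\<lambda>y\<in>W. q (x' y)) \<in> hol_funs A W" by (rule c'.pull_hol[OF WW q(1)])
    moreover have "\<forall>y\<in>W. u y = t y * (\<lambda>y\<in>W. q (x' y)) y" using q(2) c'(3) by simp
    ultimately show ?thesis by (intro that[of "\<lambda>y\<in>W. q (x' y)"]) (auto simp: u_def)
  qed
qed

text \<open>Leibniz rule: \<partial>_j x_j applied to \<open>t ^ K * g\<close> is
  \<open>t ^ K\<close> times the sum of \<open>euler j W' g\<close> and K q g, where x_j
  \<partial>_j t = t q. This shows that the operator preserves every power of the ideal.\<close>

lemma euler_ideal_power:
  assumes Z: "Z \<inter> U \<noteq> {} \<Longrightarrow> Z \<inter> U = {y \<in> U. x y i = 0}" and W: "W \<in> opens U" and j: "j < n"
    and f: "f \<in> ideal_power A Z k W" and fW: "euler j W f \<in> hol_funs A W"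
  shows "euler j W f \<in> ideal_power A Z k W"
  unfolding ideal_power_def
proof (intro CollectI conjI ballI fW)
  fix y assume y: "y \<in> W"
  obtain W' t g where W': "W' \<in> opens W" "y \<in> W'" and t: "local_equation A Z W' t" and g: "g \<in> hol_funs A W'"
    and fg: "\<forall>z\<in>W'. f z = t z ^ nat k * g z" and fh: "f \<in> hol_funs A W"
    using f y unfolding ideal_power_def by blast
  define K where "K = nat k"
  have W'U: "W' \<in> opens U" by (rule opens_trans[OF W'(1) W])
  have oW': "open W'" using W'(1) by (simp add: opens_iff)
  have th: "t \<in> hol_funs A W'" using t by (simp add: local_equation_def)
  obtain q where q: "q \<in> hol_funs A W'" "\<forall>y\<in>W'. x y j * cpartial j (push t) (x y) = t y * q y"
    by (rule log_derivative_divisible[OF Z W'U t j]) (assumption | rule that)+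
  define h where "h = (\<lambda>y\<in>W'. euler j W' g y + of_nat K * (q y * g y))"
  have eg: "euler j W' g \<in> hol_funs A W'"
  proof -
    have "euler j W' g = (\<lambda>y\<in>W'. cpartial j (push (\<lambda>y\<in>W'. x y j * g y)) (x y))"
      unfolding euler_apply[OF W'U g j]
      by (intro restrict_ext cpartial_chart_cong[OF W'U _ _ j]) (auto simp: in_U[OF W'U])
    then show ?thesis using hol_partial[OF W'U mult_coord_hol[OF W'U g] j] by simp
  qed
  have "(\<lambda>y\<in>W'. of_nat K * (\<lambda>y\<in>W'. q y * g y) y + euler j W' g y) \<in> hol_funs A W'"
    by (rule hol_funs_lincomb[OF oW' hol_funs_mult[OF oW' q(1) g] eg])
  moreover have "(\<lambda>y\<in>W'. of_nat K * (\<lambda>y\<in>W'. q y * g y) y + euler j W' g y) = h"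
    unfolding h_def by (auto intro!: restrict_ext)
  ultimately have h: "h \<in> hol_funs A W'" by (simp only:)
  have "euler j W f z = t z ^ nat k * h z" if z: "z \<in> W'" for z
  proof -
    have zW: "z \<in> W" and zU: "z \<in> U" using z W'(1) in_U[OF W'U] by (auto simp: opens_iff)
    have xz: "x z \<in> x ` W'" using z by simp
    let ?T = "push t" and ?G = "push g"
    note T = push_hol[OF W'U th] and G = push_hol[OF W'U g]
    have zG: "hol_on n (x ` W') (\<lambda>w. w j * ?G w)" by (rule hol_on_mult[OF hol_on_coord G])
    have "euler j W f z = cpartial j (\<lambda>w. w j * push f w) (x z)"
      using zW by (simp add: euler_apply[OF W fh j])
    also have "\<dots> = cpartial j (\<lambda>w. ?T w ^ K * (w j * ?G w)) (x z)"
      by (rule cpartial_chart_cong[OF W'U _ z j]) (use fg in \<open>simp add: in_U[OF W'U] K_def\<close>)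
    also have "\<dots> = ?T (x z) ^ K * cpartial j (\<lambda>w. w j * ?G w) (x z) +
        cpartial j (\<lambda>w. ?T w ^ K) (x z) * (x z j * ?G (x z))"
      by (rule cpartial_mult[OF hol_on_power[OF T] zG xz j])
    also have "cpartial j (\<lambda>w. ?T w ^ K) (x z) = of_nat K * ?T (x z) ^ (K - 1) * cpartial j ?T (x z)"
      by (rule cpartial_power[OF T xz j])
    also have "of_nat K * ?T (x z) ^ (K - 1) * cpartial j ?T (x z) * (x z j * ?G (x z)) =
        of_nat K * t z ^ (K - 1) * (x z j * cpartial j ?T (x z)) * g z"
      using zU by simp
    also have "\<dots> = of_nat K * (t z ^ (K - 1) * t z) * (q z * g z)" using q(2) z by simp
    \<comment> \<open>For K = 0 the truncated exponent K - 1 does not combine to K, but then the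
      factor \<open>of_nat K\<close> vanishes.\<close>
    also have "\<dots> = t z ^ K * (of_nat K * (q z * g z))" by (cases K) simp_all
    also have "?T (x z) ^ K * cpartial j (\<lambda>w. w j * ?G w) (x z) = t z ^ K * euler j W' g z"
      using zU z by (simp add: euler_apply[OF W'U g j])
    finally show ?thesis using z by (simp add: h_def K_def algebra_simps)
  qed
  then show "\<exists>W'\<in>opens W. y \<in> W' \<and> (\<exists>t g. local_equation A Z W' t \<and> g \<in> hol_funs A W' \<and>
      (\<forall>z\<in>W'. euler j W f z = t z ^ nat k * g z))"
    using W' t h by blast
qed

end

lemma (in complex_atlas) const_op_ideal_power:
  assumes W: "W \<in> opens U" and f: "f \<in> ideal_power A Z k W"
  shows "const_op A U c W f \<in> ideal_power A Z k W"
proof -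
  have oW: "open W" using W by (simp add: opens_iff)
  have fh: "f \<in> hol_funs A W" using f by (simp add: ideal_power_def)
  have eq: "const_op A U c W f = (\<lambda>y\<in>W. c * f y)" by (rule const_op_apply[OF W fh])
  show ?thesis
    unfolding ideal_power_def eq
  proof (intro CollectI conjI ballI hol_funs_cmult[OF oW fh])
    fix y assume y: "y \<in> W"
    obtain W' t g where W': "W' \<in> opens W" "y \<in> W'" and t: "local_equation A Z W' t" and g: "g \<in> hol_funs A W'"
      and fg: "\<forall>z\<in>W'. f z = t z ^ nat k * g z"
      using f y unfolding ideal_power_def by blast
    have "open W'" using W'(1) by (simp add: opens_iff)
    then have "(\<lambda>y\<in>W'. c * g y) \<in> hol_funs A W'" by (rule hol_funs_cmult[OF _ g])
    moreover have "\<forall>z\<in>W'. (\<lambda>y\<in>W. c * f y) z = t z ^ nat k * (\<lambda>y\<in>W'. c * g y) z"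
      using fg W'(1) by (auto simp: opens_iff)
    ultimately show "\<exists>W'\<in>opens W. y \<in> W' \<and> (\<exists>t g. local_equation A Z W' t \<and> g \<in> hol_funs A W' \<and>
        (\<forall>z\<in>W'. (\<lambda>y\<in>W. c * f y) z = t z ^ nat k * g z))"
      using W' t by blast
  qed
qed

text \<open>\<open>H\<close> and the carrier are independent: a sum formed in the sections of one
  filtration step can be located in a step of another filtration.\<close>

lemma finsum_lessThan_in:
  fixes G (structure)
  assumes "abelian_monoid G" "\<zero> \<in> H" "\<And>a b. a \<in> H \<Longrightarrow> b \<in> H \<Longrightarrow> a \<oplus> b \<in> H"
    and "\<And>i. i < (k::nat) \<Longrightarrow> f i \<in> carrier G" "\<And>i. i < k \<Longrightarrow> f i \<in> H"
  shows "(\<Oplus>i\<in>{..<k}. f i) \<in> H"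
  using assms(4,5)
proof (induction k)
  case 0
  interpret abelian_monoid G by fact
  show ?case using assms(2) by simp
next
  case (Suc k)
  interpret abelian_monoid G by fact
  have "(\<Oplus>i\<in>{..<Suc k}. f i) = f k \<oplus> (\<Oplus>i\<in>{..<k}. f i)"
    unfolding lessThan_Suc by (rule finsum_insert) (use Suc.prems in auto)
  then show ?case using Suc assms(3) by simp
qed

text \<open>\<open>finsum\<close> depends on the carrier of its structure, so sums in the
  commutative subring have to be matched with sums in the ring of all differential
  operators.\<close>

lemma (in ring) finsum_subring:
  assumes H: "subring H R" and "finite I" "f \<in> I \<rightarrow> H"
  shows "finsum (R\<lparr>carrier := H\<rparr>) f I = finsum R f I"
  using assms(2,3)
proof (induction I)
  case empty
  interpret H: ring "R\<lparr>carrier := H\<rparr>" by (rule subring_is_ring[OF H])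
  show ?case using H.finsum_empty by simp
next
  case (insert i I)
  interpret H: ring "R\<lparr>carrier := H\<rparr>" by (rule subring_is_ring[OF H])
  have sub: "H \<subseteq> carrier R" by (rule subringE(1)[OF H])
  have "finsum (R\<lparr>carrier := H\<rparr>) f (insert i I) = f i \<oplus> finsum (R\<lparr>carrier := H\<rparr>) f I"
    using H.finsum_insert[OF insert(1,2), of f] insert.prems by auto
  also have "\<dots> = f i \<oplus> finsum R f I" using insert by simp
  also have "\<dots> = finsum R f (insert i I)"
    by (rule finsum_insert[OF insert(1,2), symmetric]) (use insert.prems sub in auto)
  finally show ?case .
qed

text \<open>
  The bicommutant inside \<open>H\<close> of commuting elements serves as the ring of polynomials in the \<open>s\<^sub>i\<close>.
\<close>

definition (in ring) bicommutant :: "'a set \<Rightarrow> 'a set \<Rightarrow> 'a set" where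
  "bicommutant H B = {P \<in> H. \<forall>Q\<in>carrier R. (\<forall>b\<in>B. Q \<otimes> b = b \<otimes> Q) \<longrightarrow> P \<otimes> Q = Q \<otimes> P}"

text \<open>Elements of B commute with each other, so each element of the bicommutant commutes with
  B, and hence with every other element of the bicommutant. Commutativity thus follows without
  expressing elements as polynomials.\<close>

lemma (in ring) bicommutant_subcring:
  assumes H: "subring H R" and B: "B \<subseteq> H" and comm: "\<And>a b. a \<in> B \<Longrightarrow> b \<in> B \<Longrightarrow> a \<otimes> b = b \<otimes> a"
  shows "subcring (bicommutant H B) R" "B \<subseteq> bicommutant H B"
proof -
  have sub: "H \<subseteq> carrier R" by (rule subringE(1)[OF H])
  have mem: "P \<in> H" "P \<in> carrier R" if "P \<in> bicommutant H B" for P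
    using that sub by (auto simp: bicommutant_def)
  have com: "P \<otimes> Q = Q \<otimes> P"
    if "P \<in> bicommutant H B" "Q \<in> carrier R" "\<And>b. b \<in> B \<Longrightarrow> Q \<otimes> b = b \<otimes> Q" for P Q
    using that by (simp add: bicommutant_def)
  have intro: "P \<in> bicommutant H B"
    if "P \<in> H" "\<And>Q. Q \<in> carrier R \<Longrightarrow> (\<And>b. b \<in> B \<Longrightarrow> Q \<otimes> b = b \<otimes> Q) \<Longrightarrow> P \<otimes> Q = Q \<otimes> P" for P
    using that by (simp add: bicommutant_def)
  show "subcring (bicommutant H B) R"
  proof (rule subcringI, rule subringI)
    show "bicommutant H B \<subseteq> carrier R" using mem(2) by blast
    show "\<one> \<in> bicommutant H B" by (rule intro) (use subringE(3)[OF H] in auto)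
    show "\<ominus> P \<in> bicommutant H B" if P: "P \<in> bicommutant H B" for P
      by (rule intro) (use subringE(5)[OF H mem(1)[OF P]] com[OF P] mem(2)[OF P] in \<open>auto simp: l_minus r_minus\<close>)
    show "P \<otimes> P' \<in> bicommutant H B" if P: "P \<in> bicommutant H B" "P' \<in> bicommutant H B" for P P'
    proof (rule intro)
      show "P \<otimes> P' \<in> H" using subringE(6)[OF H] mem P by blast
      fix Q assume Q: "Q \<in> carrier R" "\<And>b. b \<in> B \<Longrightarrow> Q \<otimes> b = b \<otimes> Q"
      have "(P \<otimes> P') \<otimes> Q = P \<otimes> (Q \<otimes> P')" using com[OF P(2) Q] mem(2) P Q(1) by (simp add: m_assoc)
      also have "\<dots> = (Q \<otimes> P) \<otimes> P'" using com[OF P(1) Q] mem(2) P Q(1) by (simp add: m_assoc[symmetric])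
      also have "\<dots> = Q \<otimes> (P \<otimes> P')" using mem(2) P Q(1) by (simp add: m_assoc)
      finally show "(P \<otimes> P') \<otimes> Q = Q \<otimes> (P \<otimes> P')" .
    qed
    show "P \<oplus> P' \<in> bicommutant H B" if P: "P \<in> bicommutant H B" "P' \<in> bicommutant H B" for P P'
    proof (rule intro)
      show "P \<oplus> P' \<in> H" using subringE(7)[OF H] mem P by blast
      fix Q assume Q: "Q \<in> carrier R" "\<And>b. b \<in> B \<Longrightarrow> Q \<otimes> b = b \<otimes> Q"
      show "(P \<oplus> P') \<otimes> Q = Q \<otimes> (P \<oplus> P')"
        using com[OF P(1) Q] com[OF P(2) Q] mem(2) P Q(1) by (simp add: l_distr r_distr)
    qed
    show "P \<otimes> P' = P' \<otimes> P" if P: "P \<in> bicommutant H B" "P' \<in> bicommutant H B" for P P'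
    proof (rule com[OF P(1) mem(2)[OF P(2)]])
      fix b assume b: "b \<in> B"
      then have "b \<in> carrier R" using B sub by blast
      then show "P' \<otimes> b = b \<otimes> P'" by (rule com[OF P(2)]) (rule comm[OF b])
    qed
  qed
  show "B \<subseteq> bicommutant H B"
  proof
    fix b assume b: "b \<in> B"
    then show "b \<in> bicommutant H B" by (intro intro) (use B in auto)
  qed
qed

lemma of_real_of_rat: "of_real (of_rat q) = (of_rat q :: complex)"
  by (cases q) (simp add: of_rat_rat)

text \<open>Shrinking the domain replaces \<open>inv_into U x\<close> by
  \<open>inv_into W x\<close>; by injectivity of x both agree on the image of W, so the chart
  properties carry over.\<close>

lemma (in complex_atlas) coordinate_system_restrict:
  assumes c: "coordinate_system A (n, U, x)" and W: "W \<in> opens U"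
  shows "coordinate_system A (n, W, x)"
proof -
  have ch: "is_chart (n, U, x)" using c by (simp add: coordinate_system_def)
  have oW: "open W" "W \<subseteq> U" using W by (auto simp: opens_iff)
  have inj: "inj_on x U" by (rule inj_on_inverseI[where g = "inv_into U x"]) (rule chart_inv[OF ch])
  have inv: "inv_into W x (x y) = y" if "y \<in> W" for y
    using inv_into_f_f[OF inj_on_subset[OF inj oW(2)] that] .
  have ch': "is_chart (n, W, x)"
    unfolding is_chart_def prod.case
  proof (intro conjI oW(1) chart_openin[OF ch oW])
    have "homeomorphism W (x ` W) x (inv_into U x)"
      by (rule homeomorphism_of_subsets[of U "x ` U" _ _ _ "{}"]) (use ch oW in \<open>auto simp: is_chart_def\<close>)
    then show "homeomorphism W (x ` W) x (inv_into W x)"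
      by (rule homeomorphism_cong) (use inv chart_inv[OF ch] oW in auto)
  qed
  have "hol_transition (n, W, x) d \<and> hol_transition d (n, W, x)" if d: "d \<in> A" for d
  proof -
    obtain m V v where deq: "d = (m, V, v)" by (cases d)
    have oV: "open V" using atlas_chart[OF d] by (simp add: deq is_chart_def)
    have t: "hol_transition (n, U, x) (m, V, v)" "hol_transition (m, V, v) (n, U, x)"
      using c d by (auto simp: coordinate_system_def deq)
    have S: "openin (top_of_set (cspace n)) (x ` (W \<inter> V))"
      by (rule chart_openin[OF ch]) (use oW oV in auto)
    have "hol_on n (x ` (W \<inter> V)) (\<lambda>z. v (inv_into W x z) j)" if j: "j < m" for j
    proof (rule hol_on_cong[OF S])
      have "hol_on n (x ` (U \<inter> V)) (\<lambda>z. v (inv_into U x z) j)" using t(1) j by (simp add: hol_transition_def)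
      then show "hol_on n (x ` (W \<inter> V)) (\<lambda>z. v (inv_into U x z) j)"
        by (rule hol_on_subset) (use oW in auto)
      fix z assume "z \<in> x ` (W \<inter> V)"
      then show "v (inv_into U x z) j = v (inv_into W x z) j" using inv chart_inv[OF ch] oW(2) by auto
    qed
    moreover have "hol_on m (v ` (V \<inter> W)) (\<lambda>z. x (inv_into V v z) j)" if j: "j < n" for j
    proof (rule hol_on_subset)
      show "hol_on m (v ` (V \<inter> U)) (\<lambda>z. x (inv_into V v z) j)" using t(2) j by (simp add: hol_transition_def)
    qed (use oW in auto)
    ultimately show ?thesis by (simp add: hol_transition_def deq)
  qed
  with ch' show ?thesis by (simp add: coordinate_system_def)
qed

lemma (in complex_atlas) adapted_coordinates_restrict:
  assumes c: "adapted_coordinates A r E (n, U, x) \<sigma>" and W: "W \<in> opens U"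
  shows "adapted_coordinates A r E (n, W, x) \<sigma>"
proof -
  have c': "coordinate_system A (n, U, x)" "inj_on \<sigma> {i. i < r \<and> E i \<inter> U \<noteq> {}}"
    "\<forall>i<r. E i \<inter> U \<noteq> {} \<longrightarrow> \<sigma> i < n \<and> E i \<inter> U = {y\<in>U. x y (\<sigma> i) = 0}"
    using c by (auto simp: adapted_coordinates_def)
  have sub: "W \<subseteq> U" using W by (simp add: opens_iff)
  show ?thesis
    unfolding adapted_coordinates_def prod.case
  proof (intro conjI allI impI coordinate_system_restrict[OF c'(1) W])
    show "inj_on \<sigma> {i. i < r \<and> E i \<inter> W \<noteq> {}}"
      by (rule inj_on_subset[OF c'(2)]) (use sub in auto)
    fix i assume i: "i < r" "E i \<inter> W \<noteq> {}"
    then have "E i \<inter> U \<noteq> {}" using sub by blast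
    then have e: "\<sigma> i < n" "E i \<inter> U = {y\<in>U. x y (\<sigma> i) = 0}" using c'(3) i by auto
    then show "\<sigma> i < n" by simp
    have "E i \<inter> W = (E i \<inter> U) \<inter> W" using sub by blast
    also have "\<dots> = {y\<in>W. x y (\<sigma> i) = 0}" unfolding e(2) using sub by blast
    finally show "E i \<inter> W = {y\<in>W. x y (\<sigma> i) = 0}" .
  qed
qed

text \<open>The ring hypothesis will be supplied by the module structure of M; closure under sums
  and products is read off it. Constants are central because differential operators are linear over
  the complex numbers.\<close>

lemma const_op_diff_ring_hom:
  assumes "complex_atlas A" "ring (diff_ring A U)" "open U"
  shows "const_op A U (c + d) = const_op A U c \<oplus>\<^bsub>diff_ring A U\<^esub> const_op A U d"
    and "const_op A U (c * d) = const_op A U c \<otimes>\<^bsub>diff_ring A U\<^esub> const_op A U d"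
    and "P \<in> diff_ops A U \<Longrightarrow> const_op A U c \<otimes>\<^bsub>diff_ring A U\<^esub> P = P \<otimes>\<^bsub>diff_ring A U\<^esub> const_op A U c"
proof -
  interpret complex_atlas A by fact
  interpret R: ring "diff_ring A U" by fact
  have [simp]: "carrier (diff_ring A U) = diff_ops A U" by (simp add: diff_ring_def)
  have cst: "const_op A U c \<in> diff_ops A U" for c by (rule const_op_diff_ops[OF assms(3)])
  have lin: "P \<in> lin_endos A U" if "P \<in> diff_ops A U" for P using that by (rule diff_ops_lin_endos)
  have "const_op A U c \<oplus>\<^bsub>diff_ring A U\<^esub> const_op A U d \<in> diff_ops A U"
    using R.a_closed[of "const_op A U c" "const_op A U d"] cst by simp
  then have sum: "add_op A U (const_op A U c) (const_op A U d) \<in> diff_ops A U" by (simp add: diff_ring_def)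
  have "const_op A U (c + d) = add_op A U (const_op A U c) (const_op A U d)"
    by (rule lin_endos_eqI[OF lin[OF cst] lin[OF sum]])
      (simp add: const_op_apply add_op_apply algebra_simps)
  then show "const_op A U (c + d) = const_op A U c \<oplus>\<^bsub>diff_ring A U\<^esub> const_op A U d" by (simp add: diff_ring_def)
  have comp: "comp_op A U P Q \<in> diff_ops A U" if "P \<in> diff_ops A U" "Q \<in> diff_ops A U" for P Q
    using R.m_closed[of P Q] that by (simp add: diff_ring_def)
  have "const_op A U (c * d) = comp_op A U (const_op A U c) (const_op A U d)"
  proof (rule lin_endos_eqI[OF lin[OF cst] lin[OF comp[OF cst cst]]])
    fix W f y assume W: "W \<in> opens U" and f: "f \<in> hol_funs A W" and y: "y \<in> W"
    have "(\<lambda>y\<in>W. d * f y) \<in> hol_funs A W" using hol_funs_cmult[OF _ f] W by (simp add: opens_iff)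
    then show "const_op A U (c * d) W f y = comp_op A U (const_op A U c) (const_op A U d) W f y"
      using W f y by (simp add: comp_op_apply lin[OF cst] const_op_apply)
  qed
  then show "const_op A U (c * d) = const_op A U c \<otimes>\<^bsub>diff_ring A U\<^esub> const_op A U d" by (simp add: diff_ring_def)
  show "const_op A U c \<otimes>\<^bsub>diff_ring A U\<^esub> P = P \<otimes>\<^bsub>diff_ring A U\<^esub> const_op A U c" if P: "P \<in> diff_ops A U"
  proof -
    have "comp_op A U (const_op A U c) P = comp_op A U P (const_op A U c)"
    proof (rule lin_endos_eqI[OF lin[OF comp[OF cst P]] lin[OF comp[OF P cst]]])
      fix W f y assume W: "W \<in> opens U" and f: "f \<in> hol_funs A W" and y: "y \<in> W"
      show "comp_op A U (const_op A U c) P W f y = comp_op A U P (const_op A U c) W f y"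
        using W f y lin_endos_cmult[OF lin[OF P] W f, of c] lin_endos_hol[OF lin[OF P] W f]
        by (simp add: comp_op_apply lin[OF cst] lin[OF P] const_op_apply)
    qed
    then show ?thesis by (simp add: diff_ring_def)
  qed
qed

section \<open>Euler operators as commuting operators of degree 0\<close>

context holomorphic_coordinates
begin

lemma euler_diff_ops:
  assumes "ring (diff_ring A U)" "j < n"
  shows "euler j \<in> diff_ops A U"
proof -
  interpret R: ring "diff_ring A U" by fact
  have "partial_op A (n, U, x) j \<otimes>\<^bsub>diff_ring A U\<^esub> mult_op A U (coord j) \<in> carrier (diff_ring A U)"
    by (rule R.m_closed)
      (simp_all add: diff_ring_def partial_op_diff_ops[OF assms(2)] mult_op_diff_ops[OF open_U coord_hol])
  then show ?thesis by (simp add: diff_ring_def euler_def)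
qed

lemma euler_V_ops:
  assumes ring: "ring (diff_ring A U)" and c: "adapted_coordinates A r E (n, U, x) \<sigma>" and j: "j < n"
  shows "euler j \<in> V_ops A r E (\<lambda>i. 0) U"
  unfolding V_ops_def V_ops1_def
proof (intro CollectI conjI allI impI ballI euler_diff_ops[OF ring j])
  fix i k W f assume i: "i < r" and k: "0 \<le> (k::int)" and W: "W \<in> opens U" and f: "f \<in> ideal_power A (E i) k W"
  have fh: "f \<in> hol_funs A W" using f by (simp add: ideal_power_def)
  have "E i \<inter> U \<noteq> {} \<Longrightarrow> E i \<inter> U = {y \<in> U. x y (\<sigma> i) = 0}"
    using c i by (auto simp: adapted_coordinates_def)
  from euler_ideal_power[OF this W j f
      lin_endos_hol[OF diff_ops_lin_endos[OF euler_diff_ops[OF ring j]] W fh]]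
  show "euler j W f \<in> ideal_power A (E i) (k + 0) W" by simp
qed

text \<open>For i \<noteq> j the factors \<partial>_i and x_i each commute with \<partial>_j and
  x_j, so the two pairs can be interchanged without touching the order inside a pair.\<close>

lemma euler_commute:
  assumes ring: "ring (diff_ring A U)" and ij: "i < n" "j < n"
  shows "euler i \<otimes>\<^bsub>diff_ring A U\<^esub> euler j = euler j \<otimes>\<^bsub>diff_ring A U\<^esub> euler i"
proof (cases "i = j")
  case False
  interpret R: ring "diff_ring A U" by fact
  let ?R = "diff_ring A U"
  define d where "d k = partial_op A (n, U, x) k" for k
  define m where "m k = mult_op A U (coord k)" for k
  have carr: "d i \<in> carrier ?R" "d j \<in> carrier ?R" "m k \<in> carrier ?R" for k
    using ij by (simp_all add: d_def m_def diff_ring_def partial_op_diff_ops mult_op_diff_ops[OF open_U coord_hol])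
  have eu: "euler k = d k \<otimes>\<^bsub>?R\<^esub> m k" for k by (simp add: euler_def d_def m_def diff_ring_def)
  have eqI: "P \<otimes>\<^bsub>?R\<^esub> Q = Q \<otimes>\<^bsub>?R\<^esub> P" if "P \<in> carrier ?R" "Q \<in> carrier ?R"
    "\<And>W f y. W \<in> opens U \<Longrightarrow> f \<in> hol_funs A W \<Longrightarrow> y \<in> W \<Longrightarrow> comp_op A U P Q W f y = comp_op A U Q P W f y"
    for P Q
  proof -
    have "P \<otimes>\<^bsub>?R\<^esub> Q \<in> lin_endos A U" "Q \<otimes>\<^bsub>?R\<^esub> P \<in> lin_endos A U"
      using R.m_closed[OF that(1,2)] R.m_closed[OF that(2,1)] diff_ops_lin_endos by (simp_all add: diff_ring_def)
    then show ?thesis by (rule lin_endos_eqI) (simp add: diff_ring_def that(3))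
  qed
  have dd: "d i \<otimes>\<^bsub>?R\<^esub> d j = d j \<otimes>\<^bsub>?R\<^esub> d i"
    by (rule eqI[OF carr(1,2)]) (simp add: d_def partial_partial_commute[OF ij])
  have mm: "m i \<otimes>\<^bsub>?R\<^esub> m j = m j \<otimes>\<^bsub>?R\<^esub> m i"
    by (rule eqI[OF carr(3,3)])
      (simp add: m_def comp_op_apply mult_op_lin_endos[OF coord_hol] mult_coord_apply mult_coord_hol)
  have dm: "d i \<otimes>\<^bsub>?R\<^esub> m j = m j \<otimes>\<^bsub>?R\<^esub> d i"
    by (rule eqI[OF carr(1,3)]) (simp add: d_def m_def partial_mult_commute[OF ij(1) False])
  have md: "d j \<otimes>\<^bsub>?R\<^esub> m i = m i \<otimes>\<^bsub>?R\<^esub> d j"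
    by (rule eqI[OF carr(2,3)]) (simp add: d_def m_def partial_mult_commute[OF ij(2)] False[symmetric])
  have "euler i \<otimes>\<^bsub>?R\<^esub> euler j = d i \<otimes>\<^bsub>?R\<^esub> (m i \<otimes>\<^bsub>?R\<^esub> d j) \<otimes>\<^bsub>?R\<^esub> m j"
    using carr by (simp add: eu R.m_assoc)
  also have "\<dots> = (d i \<otimes>\<^bsub>?R\<^esub> d j) \<otimes>\<^bsub>?R\<^esub> (m i \<otimes>\<^bsub>?R\<^esub> m j)"
    unfolding md[symmetric] using carr by (simp add: R.m_assoc)
  also have "\<dots> = d j \<otimes>\<^bsub>?R\<^esub> (d i \<otimes>\<^bsub>?R\<^esub> m j) \<otimes>\<^bsub>?R\<^esub> m i"
    unfolding dd mm using carr by (simp add: R.m_assoc)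
  also have "\<dots> = euler j \<otimes>\<^bsub>?R\<^esub> euler i"
    unfolding dm using carr by (simp add: eu R.m_assoc)
  finally show ?thesis .
qed simp

end

section \<open>Uniqueness of the V-filtration\<close>

locale d_module = complex_atlas A
  for A :: "'y::{t2_space, second_countable_topology} chart set" +
  fixes r :: nat and E :: "nat \<Rightarrow> 'y set"
    and M :: "'y set \<Rightarrow> ('y oper, 'm) module" and rM :: "'y set \<Rightarrow> 'y set \<Rightarrow> 'm \<Rightarrow> 'm"
  assumes snc: "snc_divisor A r E"
    and coherent: "coherent_sheaf (diff_ring A) res_op M rM"
begin

lemma sheaf: "module_sheaf (diff_ring A) res_op M rM"
  using coherent by (simp add: coherent_sheaf_def)

lemma sections_module: "open U \<Longrightarrow> left_module (diff_ring A U) (M U)"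
  using sheaf by (simp add: module_sheaf_def)

lemma restriction:
  assumes "open U" "W \<in> opens U" "s \<in> carrier (M U)"
  shows "rM U W s \<in> carrier (M W)"
    and "W' \<in> opens W \<Longrightarrow> rM W W' (rM U W s) = rM U W' s"
    and "t \<in> carrier (M U) \<Longrightarrow> rM U W (s \<oplus>\<^bsub>M U\<^esub> t) = rM U W s \<oplus>\<^bsub>M W\<^esub> rM U W t"
    and "P \<in> diff_ops A U \<Longrightarrow> rM U W (P \<odot>\<^bsub>M U\<^esub> s) = res_op U W P \<odot>\<^bsub>M W\<^esub> rM U W s"
proof -
  have "\<forall>U. open U \<longrightarrow> (\<forall>W\<in>opens U. \<forall>s\<in>carrier (M U).
        rM U W s \<in> carrier (M W) \<and>
        (\<forall>W'\<in>opens W. rM W W' (rM U W s) = rM U W' s) \<and>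
        (\<forall>t\<in>carrier (M U). rM U W (s \<oplus>\<^bsub>M U\<^esub> t) = rM U W s \<oplus>\<^bsub>M W\<^esub> rM U W t) \<and>
        (\<forall>a\<in>carrier (diff_ring A U). rM U W (a \<odot>\<^bsub>M U\<^esub> s) = res_op U W a \<odot>\<^bsub>M W\<^esub> rM U W s))"
    using sheaf unfolding module_sheaf_def by (elim conjE)
  then have *: "rM U W s \<in> carrier (M W) \<and>
        (\<forall>W'\<in>opens W. rM W W' (rM U W s) = rM U W' s) \<and>
        (\<forall>t\<in>carrier (M U). rM U W (s \<oplus>\<^bsub>M U\<^esub> t) = rM U W s \<oplus>\<^bsub>M W\<^esub> rM U W t) \<and>
        (\<forall>a\<in>carrier (diff_ring A U). rM U W (a \<odot>\<^bsub>M U\<^esub> s) = res_op U W a \<odot>\<^bsub>M W\<^esub> rM U W s)"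
    using assms by simp
  then show "rM U W s \<in> carrier (M W)" by simp
  show "W' \<in> opens W \<Longrightarrow> rM W W' (rM U W s) = rM U W' s" using * by simp
  show "t \<in> carrier (M U) \<Longrightarrow> rM U W (s \<oplus>\<^bsub>M U\<^esub> t) = rM U W s \<oplus>\<^bsub>M W\<^esub> rM U W t" using * by simp
  show "P \<in> diff_ops A U \<Longrightarrow> rM U W (P \<odot>\<^bsub>M U\<^esub> s) = res_op U W P \<odot>\<^bsub>M W\<^esub> rM U W s"
    using * by (simp add: diff_ring_def)
qed

end

locale good_filtered_module = d_module A r E M rM
  for A :: "'y::{t2_space, second_countable_topology} chart set" and r E
    and M :: "'y set \<Rightarrow> ('y oper, 'm) module" and rM +
  fixes F :: "('y, 'm) filtr"
  assumes good: "good_filtration A r E M rM F"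
begin

lemma wall_chamber: "wall_chamber_filtration r M rM F"
  using good unfolding good_filtration_def by (elim conjE)

lemma F_subsheaf: "\<alpha> \<in> rspace r \<Longrightarrow> subsheaf M rM (F \<alpha>)"
  using wall_chamber unfolding wall_chamber_filtration_def by (elim conjE) simp

lemma F_subgroup: "\<alpha> \<in> rspace r \<Longrightarrow> open U \<Longrightarrow> subgroup (F \<alpha> U) (add_monoid (M U))"
  using F_subsheaf unfolding subsheaf_def by simp

lemma F_carrier: "\<alpha> \<in> rspace r \<Longrightarrow> open U \<Longrightarrow> s \<in> F \<alpha> U \<Longrightarrow> s \<in> carrier (M U)"
  using subgroup.subset[OF F_subgroup] by fastforce

lemma F_add: "\<alpha> \<in> rspace r \<Longrightarrow> open U \<Longrightarrow> s \<in> F \<alpha> U \<Longrightarrow> t \<in> F \<alpha> U \<Longrightarrow> s \<oplus>\<^bsub>M U\<^esub> t \<in> F \<alpha> U"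
  using subgroup.m_closed[OF F_subgroup] by fastforce

lemma F_zero: "\<alpha> \<in> rspace r \<Longrightarrow> open U \<Longrightarrow> \<zero>\<^bsub>M U\<^esub> \<in> F \<alpha> U"
  using subgroup.one_closed[OF F_subgroup] by fastforce

lemma F_res: "\<alpha> \<in> rspace r \<Longrightarrow> open U \<Longrightarrow> s \<in> F \<alpha> U \<Longrightarrow> W \<in> opens U \<Longrightarrow> rM U W s \<in> F \<alpha> W"
  using F_subsheaf unfolding subsheaf_def by simp

lemma F_local:
  assumes "\<alpha> \<in> rspace r" "open U" "s \<in> carrier (M U)"
    and "\<And>y. y \<in> U \<Longrightarrow> \<exists>W\<in>opens U. y \<in> W \<and> rM U W s \<in> F \<alpha> W"
  shows "s \<in> F \<alpha> U"
  using F_subsheaf[OF assms(1)] assms(2-4) unfolding subsheaf_def by simp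

lemma F_antimono: "\<alpha> \<in> rspace r \<Longrightarrow> \<beta> \<in> rspace r \<Longrightarrow> \<alpha> \<le> \<beta> \<Longrightarrow> open U \<Longrightarrow> F \<beta> U \<subseteq> F \<alpha> U"
  using wall_chamber unfolding wall_chamber_filtration_def by (elim conjE) simp

lemma F_walls: "\<exists>U. open U \<and> y \<in> U \<and> (\<exists>\<W>. walls_of_filtration r F U \<W>)"
  using wall_chamber unfolding wall_chamber_filtration_def by (elim conjE) (rule spec)

lemma F_exhaustive:
  "open U \<Longrightarrow> s \<in> carrier (M U) \<Longrightarrow> y \<in> U \<Longrightarrow> \<exists>W\<in>opens U. y \<in> W \<and> (\<exists>\<alpha>\<in>rspace r. rM U W s \<in> F \<alpha> W)"
  using good unfolding good_filtration_def by (elim conjE) simp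

lemma F_smult:
  "n \<in> zspace r \<Longrightarrow> \<alpha> \<in> rspace r \<Longrightarrow> open U \<Longrightarrow> P \<in> V_ops A r E n U \<Longrightarrow> u \<in> F \<alpha> U \<Longrightarrow>
    P \<odot>\<^bsub>M U\<^esub> u \<in> F (vshift n \<alpha>) U"
  using good unfolding good_filtration_def by (elim conjE) simp

lemma F_smult_0:
  "\<alpha> \<in> rspace r \<Longrightarrow> open U \<Longrightarrow> P \<in> V_ops A r E (\<lambda>i. 0) U \<Longrightarrow> u \<in> F \<alpha> U \<Longrightarrow> P \<odot>\<^bsub>M U\<^esub> u \<in> F \<alpha> U"
  using F_smult[of "\<lambda>i. 0" \<alpha> U P u] by (simp add: zspace_def vshift_def)

lemma F_coherent:
  "\<alpha> \<in> rspace r \<Longrightarrow> coherent_sheaf (V0_ring A r E) res_op (\<lambda>U. (M U)\<lparr>carrier := F \<alpha> U\<rparr>) rM"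
  using good unfolding good_filtration_def by (elim conjE) simp

lemma F_left_module: "\<alpha> \<in> rspace r \<Longrightarrow> open U \<Longrightarrow> left_module (V0_ring A r E U) ((M U)\<lparr>carrier := F \<alpha> U\<rparr>)"
  using F_coherent unfolding coherent_sheaf_def module_sheaf_def by simp

lemma F_box:
  "\<exists>U a b. open U \<and> y \<in> U \<and> a \<le> b \<and> (\<forall>\<alpha>\<in>rspace r. \<forall>W\<in>opens U.
     F \<alpha> W = {s\<in>carrier (M W). \<forall>z\<in>W. \<exists>W'\<in>opens W. z \<in> W' \<and>
       rM W W' s \<in> box_combinations A r E M F a b \<alpha> W'})"
  using good unfolding good_filtration_def by (elim conjE) (rule spec)

lemma F_finite_type:
  assumes "\<alpha> \<in> rspace r"
  shows "\<exists>W. open W \<and> y \<in> W \<and> (\<exists>k g. generated_on (V0_ring A r E) (\<lambda>U. (M U)\<lparr>carrier := F \<alpha> U\<rparr>) rM W k g)"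
proof -
  have "finite_type_on (V0_ring A r E) (\<lambda>U. (M U)\<lparr>carrier := F \<alpha> U\<rparr>) rM UNIV"
    using F_coherent[OF assms] unfolding coherent_sheaf_def by (elim conjE)
  from bspec[OF this[unfolded finite_type_on_def] UNIV_I[of y]]
  obtain W where W: "W \<in> opens UNIV" "y \<in> W"
    and gen: "\<exists>k g. generated_on (V0_ring A r E) (\<lambda>U. (M U)\<lparr>carrier := F \<alpha> U\<rparr>) rM W k g"
    by (elim bexE conjE) (rule that)
  have "open W" using W(1) by (simp add: opens_iff)
  then show ?thesis using W(2) gen by (intro exI[of _ W] conjI)
qed

text \<open>The ring structure is part of the coherence of a filtration step over
  \<open>V0_ring\<close>; the step at index 0 is an arbitrary choice.\<close>

lemma V0_subring:
  assumes "open U"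
  shows "subring (V_ops A r E (\<lambda>i. 0) U) (diff_ring A U)"
proof -
  interpret R: ring "diff_ring A U" using left_module.axioms(1)[OF sections_module[OF assms]] .
  have "(\<lambda>i. 0 :: real) \<in> rspace r" by (simp add: rspace_def)
  from left_module.axioms(1)[OF F_left_module[OF this assms]] have "ring (V0_ring A r E U)" .
  then have "ring ((diff_ring A U)\<lparr>carrier := V_ops A r E (\<lambda>i. 0) U\<rparr>)" by (simp add: V0_ring_def)
  then show ?thesis
    by (intro R.ring_incl_imp_subring) (auto simp: V_ops_def diff_ring_def)
qed

text \<open>The stalk at y of the step \<mu>, pulled back to sections over U. All steps thereby
  become subsets of the single module \<open>M U\<close>, on which the operators over U act.\<close>

definition germ :: "'y set \<Rightarrow> 'y \<Rightarrow> (nat \<Rightarrow> real) \<Rightarrow> 'm set" where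
  "germ U y \<mu> = {v \<in> carrier (M U). \<exists>W\<in>opens U. y \<in> W \<and> rM U W v \<in> F \<mu> W}"

lemma germ_subgroup:
  assumes \<mu>: "\<mu> \<in> rspace r" and U: "open U" and y: "y \<in> U"
  shows "subgroup (germ U y \<mu>) (add_monoid (M U))"
proof -
  interpret left_module "diff_ring A U" "M U" by (rule sections_module[OF U])
  have UU: "U \<in> opens U" using U by (simp add: opens_iff)
  have one: "\<one>\<^bsub>diff_ring A U\<^esub> \<in> V_ops A r E (\<lambda>i. 0) U" by (rule subringE(3)[OF V0_subring[OF U]])
  show ?thesis
  proof (rule M.add.subgroupI)
    show "germ U y \<mu> \<subseteq> carrier (M U)" by (auto simp: germ_def)
    have "rM U U \<zero>\<^bsub>M U\<^esub> \<in> F \<mu> U" by (rule F_res[OF \<mu> U F_zero[OF \<mu> U] UU])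
    then have "\<zero>\<^bsub>M U\<^esub> \<in> germ U y \<mu>" using UU y by (auto simp: germ_def)
    then show "germ U y \<mu> \<noteq> {}" by blast
  next
    fix v assume "v \<in> germ U y \<mu>"
    then obtain W where v: "v \<in> carrier (M U)" and W: "W \<in> opens U" "y \<in> W" "rM U W v \<in> F \<mu> W"
      unfolding germ_def by blast
    have oW: "open W" using W(1) by (simp add: opens_iff)
    interpret W: left_module "diff_ring A W" "M W" by (rule sections_module[OF oW])
    have vW: "rM U W v \<in> carrier (M W)" by (rule restriction(1)[OF U W(1) v])
    have mv: "\<ominus>\<^bsub>M U\<^esub> v \<in> carrier (M U)" using v by simp
    \<comment> \<open>Restriction is only given as additive; compatibility with negation and with
      zero is deduced by cancellation.\<close>
    have "rM U W (\<ominus>\<^bsub>M U\<^esub> v) \<oplus>\<^bsub>M W\<^esub> rM U W v = rM U W (\<ominus>\<^bsub>M U\<^esub> v \<oplus>\<^bsub>M U\<^esub> v)"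
      by (rule restriction(3)[OF U W(1) mv v, symmetric])
    also have "\<dots> = rM U W \<zero>\<^bsub>M U\<^esub>" using v by (simp add: M.l_neg)
    also have "\<dots> = \<zero>\<^bsub>M W\<^esub>"
    proof -
      have "rM U W \<zero>\<^bsub>M U\<^esub> \<oplus>\<^bsub>M W\<^esub> rM U W \<zero>\<^bsub>M U\<^esub> = rM U W \<zero>\<^bsub>M U\<^esub>"
        using restriction(3)[OF U W(1), of "\<zero>\<^bsub>M U\<^esub>" "\<zero>\<^bsub>M U\<^esub>"] by simp
      then show ?thesis
        using W.M.add.l_cancel_one[of "rM U W \<zero>\<^bsub>M U\<^esub>" "rM U W \<zero>\<^bsub>M U\<^esub>"] restriction(1)[OF U W(1), of "\<zero>\<^bsub>M U\<^esub>"]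
        by simp
    qed
    finally have "\<ominus>\<^bsub>M W\<^esub> rM U W v = rM U W (\<ominus>\<^bsub>M U\<^esub> v)"
      by (rule W.M.minus_equality) (use vW restriction(1)[OF U W(1) mv] in auto)
    moreover have "\<ominus>\<^bsub>M W\<^esub> rM U W v \<in> F \<mu> W"
      using subgroup.m_inv_closed[OF F_subgroup[OF \<mu> oW] W(3)] by (simp add: a_inv_def)
    ultimately show "\<ominus>\<^bsub>M U\<^esub> v \<in> germ U y \<mu>" using mv W by (auto simp: germ_def)
  next
    fix v w assume "v \<in> germ U y \<mu>" "w \<in> germ U y \<mu>"
    then obtain W W' where v: "v \<in> carrier (M U)" "w \<in> carrier (M U)"
      and W: "W \<in> opens U" "y \<in> W" "rM U W v \<in> F \<mu> W"
      and W': "W' \<in> opens U" "y \<in> W'" "rM U W' w \<in> F \<mu> W'"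
      unfolding germ_def by blast
    define X where "X = W \<inter> W'"
    have X: "X \<in> opens U" "X \<in> opens W" "X \<in> opens W'" "y \<in> X" and op: "open X" "open W" "open W'"
      using W W' by (auto simp: X_def opens_iff)
    have "rM U X v \<in> F \<mu> X" "rM U X w \<in> F \<mu> X"
      using F_res[OF \<mu> op(2) W(3) X(2)] F_res[OF \<mu> op(3) W'(3) X(3)]
        restriction(2)[OF U W(1) v(1) X(2)] restriction(2)[OF U W'(1) v(2) X(3)] by simp_all
    then have "rM U X (v \<oplus>\<^bsub>M U\<^esub> w) \<in> F \<mu> X"
      unfolding restriction(3)[OF U X(1) v] by (rule F_add[OF \<mu> op(1)])
    then show "v \<oplus>\<^bsub>M U\<^esub> w \<in> germ U y \<mu>" using v X by (auto simp: germ_def)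
  qed
qed

lemma germ_smult:
  assumes \<mu>: "\<mu> \<in> rspace r" and U: "open U" and P: "P \<in> V_ops A r E (\<lambda>i. 0) U" and v: "v \<in> germ U y \<mu>"
  shows "P \<odot>\<^bsub>M U\<^esub> v \<in> germ U y \<mu>"
proof -
  interpret left_module "diff_ring A U" "M U" by (rule sections_module[OF U])
  obtain W where v: "v \<in> carrier (M U)" and W: "W \<in> opens U" "y \<in> W" "rM U W v \<in> F \<mu> W"
    using v unfolding germ_def by blast
  have oW: "open W" using W(1) by (simp add: opens_iff)
  have PD: "P \<in> diff_ops A U" using P by (simp add: V_ops_def)
  have "res_op U W P \<odot>\<^bsub>M W\<^esub> rM U W v \<in> F \<mu> W"
    by (rule F_smult_0[OF \<mu> oW V_ops_res[OF P W(1)] W(3)])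
  then have "rM U W (P \<odot>\<^bsub>M U\<^esub> v) \<in> F \<mu> W" using restriction(4)[OF U W(1) v PD] by simp
  moreover have "P \<odot>\<^bsub>M U\<^esub> v \<in> carrier (M U)" using smult_closed[of P v] PD v by (simp add: diff_ring_def)
  ultimately show ?thesis using W by (auto simp: germ_def)
qed

end

text \<open>By coherence the step of F at (a,...,a) is generated near y by finitely many sections
  over operators of degree 0, and by exhaustion each generator lies in some step of F'. So this step
  lies in one step of F'. It contains all steps of F with index in the box [a,b]^r, and these
  generate every step through operators of the matching degree, so one shift N serves all
  \<mu>.\<close>

lemma (in d_module) good_filtrations_comparable:
  assumes F: "good_filtration A r E M rM F" and F': "good_filtration A r E M rM F'"
  obtains U N where "open U" "y \<in> U" "N \<ge> 0"
    "\<forall>\<mu>\<in>rspace r. \<forall>W\<in>opens U. F \<mu> W \<subseteq> F' (diag_shift r (- N) \<mu>) W"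
proof -
  interpret F: good_filtered_module A r E M rM F by unfold_locales (rule F)
  interpret F': good_filtered_module A r E M rM F' by unfold_locales (rule F')
  define corner where "corner c = diag_shift r c (\<lambda>i. 0)" for c
  have corner: "corner c \<in> rspace r" for c unfolding corner_def diag_shift_rspace by (simp add: rspace_def)
  obtain U a b where U: "open U" "y \<in> U" and box: "\<forall>\<alpha>\<in>rspace r. \<forall>W\<in>opens U.
     F \<alpha> W = {s\<in>carrier (M W). \<forall>z\<in>W. \<exists>W'\<in>opens W. z \<in> W' \<and>
       rM W W' s \<in> box_combinations A r E M F a b \<alpha> W'}"
    using F.F_box[of y] by (elim exE conjE) (rule that)
  let ?MF = "\<lambda>U. (M U)\<lparr>carrier := F (corner a) U\<rparr>"
  obtain W1 k g where W1: "open W1" "y \<in> W1" and gen: "generated_on (V0_ring A r E) ?MF rM W1 k g"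
    using F.F_finite_type[OF corner, of y a] by (elim exE conjE) (rule that)
  have g: "g i \<in> F (corner a) W1" if "i < k" for i using gen that by (simp add: generated_on_def)
  have gM: "g i \<in> carrier (M W1)" if "i < k" for i by (rule F.F_carrier[OF corner W1(1) g[OF that]])
  have "\<forall>i\<in>{..<k}. \<exists>p. fst p \<in> opens W1 \<and> y \<in> fst p \<and> snd p \<in> rspace r \<and> rM W1 (fst p) (g i) \<in> F' (snd p) (fst p)"
  proof
    fix i assume "i \<in> {..<k}"
    then have "i < k" by simp
    from F'.F_exhaustive[OF W1(1) gM[OF this] W1(2)]
    obtain W \<alpha> where "W \<in> opens W1" "y \<in> W" "\<alpha> \<in> rspace r" "rM W1 W (g i) \<in> F' \<alpha> W" by blast
    then show "\<exists>p. fst p \<in> opens W1 \<and> y \<in> fst p \<and> snd p \<in> rspace r \<and> rM W1 (fst p) (g i) \<in> F' (snd p) (fst p)"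
      by (intro exI[of _ "(W, \<alpha>)"]) simp
  qed
  then have "\<exists>p. \<forall>i\<in>{..<k}. fst (p i) \<in> opens W1 \<and> y \<in> fst (p i) \<and> snd (p i) \<in> rspace r \<and>
      rM W1 (fst (p i)) (g i) \<in> F' (snd (p i)) (fst (p i))"
    by (rule bchoice)
  then obtain p where p: "\<forall>i\<in>{..<k}. fst (p i) \<in> opens W1 \<and> y \<in> fst (p i) \<and> snd (p i) \<in> rspace r \<and>
      rM W1 (fst (p i)) (g i) \<in> F' (snd (p i)) (fst (p i))" ..
  define W2 where "W2 = W1 \<inter> (\<Inter>i\<in>{..<k}. fst (p i))"
  have oW2: "open W2" unfolding W2_def using p W1(1) by (intro open_Int open_INT) (auto simp: opens_iff)
  have yW2: "y \<in> W2" using p W1(2) by (simp add: W2_def)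
  have W2: "W2 \<in> opens W1" using oW2 by (auto simp: opens_iff W2_def)
  \<comment> \<open>Minus the sum of all absolute values is below every coordinate of every index
    involved, so all generators lie in the one step of F' at (D,...,D).\<close>
  define D where "D = - (\<Sum>i<k. \<Sum>l<r. \<bar>snd (p i) l\<bar>)"
  have D: "corner D \<le> snd (p i)" if i: "i < k" for i
  proof -
    have "D \<le> snd (p i) l" if l: "l < r" for l
    proof -
      have "\<bar>snd (p i) l\<bar> \<le> (\<Sum>l<r. \<bar>snd (p i) l\<bar>)" using l by (intro member_le_sum) auto
      also have "\<dots> \<le> (\<Sum>i<k. \<Sum>l<r. \<bar>snd (p i) l\<bar>)"
        using i by (intro member_le_sum[where f = "\<lambda>i. \<Sum>l<r. \<bar>snd (p i) l\<bar>"]) (auto intro: sum_nonneg)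
      finally show ?thesis unfolding D_def by linarith
    qed
    moreover have "snd (p i) \<in> rspace r" using p i by simp
    ultimately show ?thesis by (auto simp: corner_def diag_shift_def le_fun_def rspace_def)
  qed
  have gD: "rM W1 W (g i) \<in> F' (corner D) W" if i: "i < k" and W: "W \<in> opens W2" for i W
  proof -
    have pi: "fst (p i) \<in> opens W1" "snd (p i) \<in> rspace r" "rM W1 (fst (p i)) (g i) \<in> F' (snd (p i)) (fst (p i))"
      using p i by simp_all
    have Wp: "W \<in> opens (fst (p i))" using W i by (auto simp: opens_iff W2_def)
    have op: "open W" "open (fst (p i))" using W pi(1) by (simp_all add: opens_iff)
    have "rM W1 W (g i) \<in> F' (snd (p i)) W"
      using F'.F_res[OF pi(2) op(2) pi(3) Wp] restriction(2)[OF W1(1) pi(1) gM[OF i] Wp] by simp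
    then show ?thesis using F'.F_antimono[OF corner pi(2) D[OF i] op(1)] by blast
  qed
  have corner_sub: "F (corner a) W \<subseteq> F' (corner D) W" if W: "W \<in> opens W2" for W
  proof
    fix s assume s: "s \<in> F (corner a) W"
    have oW: "open W" using W by (simp add: opens_iff)
    have WW1: "W \<in> opens W1" by (rule opens_trans[OF W W2])
    show "s \<in> F' (corner D) W"
    proof (rule F'.F_local[OF corner oW F.F_carrier[OF corner oW s]])
      fix z assume z: "z \<in> W"
      have "\<forall>W\<in>opens W1. \<forall>s\<in>carrier (?MF W). \<forall>y\<in>W. \<exists>W'\<in>opens W. y \<in> W' \<and>
        (\<exists>c \<in> {..<k} \<rightarrow> carrier (V0_ring A r E W').
           rM W W' s = (\<Oplus>\<^bsub>?MF W'\<^esub>i\<in>{..<k}. c i \<odot>\<^bsub>?MF W'\<^esub> rM W1 W' (g i)))"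
        using gen unfolding generated_on_def by (elim conjE)
      from bspec[OF bspec[OF bspec[OF this WW1], of s] z] s
      obtain W' c where W': "W' \<in> opens W" "z \<in> W'" and c: "c \<in> {..<k} \<rightarrow> carrier (V0_ring A r E W')"
        and eq: "rM W W' s = (\<Oplus>\<^bsub>?MF W'\<^esub>i\<in>{..<k}. c i \<odot>\<^bsub>M W'\<^esub> rM W1 W' (g i))" by auto
      have oW': "open W'" using W'(1) by (simp add: opens_iff)
      have W'2: "W' \<in> opens W2" by (rule opens_trans[OF W'(1) W])
      have W'1: "W' \<in> opens W1" by (rule opens_trans[OF W'2 W2])
      interpret MF: left_module "V0_ring A r E W'" "?MF W'" by (rule F.F_left_module[OF corner oW'])
      have cV: "c i \<in> V_ops A r E (\<lambda>i. 0) W'" if "i < k" for i using c that by (auto simp: V0_ring_def)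
      have "(\<Oplus>\<^bsub>?MF W'\<^esub>i\<in>{..<k}. c i \<odot>\<^bsub>M W'\<^esub> rM W1 W' (g i)) \<in> F' (corner D) W'"
      proof (rule finsum_lessThan_in[OF MF.M.abelian_monoid_axioms])
        show "\<zero>\<^bsub>?MF W'\<^esub> \<in> F' (corner D) W'" using F'.F_zero[OF corner oW'] by simp
        show "s \<oplus>\<^bsub>?MF W'\<^esub> t \<in> F' (corner D) W'" if "s \<in> F' (corner D) W'" "t \<in> F' (corner D) W'" for s t
          using F'.F_add[OF corner oW' that] by simp
        show "c i \<odot>\<^bsub>M W'\<^esub> rM W1 W' (g i) \<in> carrier (?MF W')" if "i < k" for i
          using F.F_smult_0[OF corner oW' cV[OF that] F.F_res[OF corner W1(1) g[OF that] W'1]] by simp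
        show "c i \<odot>\<^bsub>M W'\<^esub> rM W1 W' (g i) \<in> F' (corner D) W'" if "i < k" for i
          by (rule F'.F_smult_0[OF corner oW' cV[OF that] gD[OF that W'2]])
      qed
      then have "rM W W' s \<in> F' (corner D) W'" unfolding eq .
      then show "\<exists>W'\<in>opens W. z \<in> W' \<and> rM W W' s \<in> F' (corner D) W'" using W' by blast
    qed
  qed
  \<comment> \<open>An index of the box is at most b in each coordinate, so lowering it by b - D
    brings it below (D,...,D); the maximum keeps the shift nonnegative.\<close>
  define N where "N = max 0 (b - D)"
  have sub: "F \<mu> W \<subseteq> F' (diag_shift r (- N) \<mu>) W" if \<mu>: "\<mu> \<in> rspace r" and W: "W \<in> opens (W2 \<inter> U)" for \<mu> W
  proof
    let ?\<mu> = "diag_shift r (- N) \<mu>"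
    have \<mu>': "?\<mu> \<in> rspace r" using \<mu> by simp
    fix s assume s: "s \<in> F \<mu> W"
    have oW: "open W" and WU: "W \<in> opens U" and WW2: "W \<in> opens W2" using W by (auto simp: opens_iff)
    show "s \<in> F' ?\<mu> W"
    proof (rule F'.F_local[OF \<mu>' oW F.F_carrier[OF \<mu> oW s]])
      fix z assume z: "z \<in> W"
      have "s \<in> {s\<in>carrier (M W). \<forall>z\<in>W. \<exists>W'\<in>opens W. z \<in> W' \<and>
          rM W W' s \<in> box_combinations A r E M F a b \<mu> W'}"
        using s bspec[OF bspec[OF box \<mu>] WU] by simp
      then obtain W' where W': "W' \<in> opens W" "z \<in> W'" and "rM W W' s \<in> box_combinations A r E M F a b \<mu> W'"
        using z by blast
      then obtain l P u where eq: "rM W W' s = (\<Oplus>\<^bsub>M W'\<^esub>j\<in>{..<l::nat}. P j \<odot>\<^bsub>M W'\<^esub> u j)"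
        and Pu: "\<forall>j<l. \<exists>n\<in>zspace r. \<exists>\<gamma>\<in>rspace r. (\<forall>i<r. \<gamma> i \<in> {a..b}) \<and> \<mu> \<le> vshift n \<gamma> \<and>
          P j \<in> V_ops A r E n W' \<and> u j \<in> F \<gamma> W'"
        unfolding box_combinations_def by blast
      have oW': "open W'" using W'(1) by (simp add: opens_iff)
      have W'2: "W' \<in> opens W2" by (rule opens_trans[OF W'(1) WW2])
      interpret M: left_module "diff_ring A W'" "M W'" by (rule sections_module[OF oW'])
      have term_in: "P j \<odot>\<^bsub>M W'\<^esub> u j \<in> F' ?\<mu> W'" if j: "j < l" for j
      proof -
        obtain n \<gamma> where n: "n \<in> zspace r" and \<gamma>: "\<gamma> \<in> rspace r" "\<forall>i<r. \<gamma> i \<in> {a..b}" "\<mu> \<le> vshift n \<gamma>"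
          and Pj: "P j \<in> V_ops A r E n W'" and uj: "u j \<in> F \<gamma> W'"
          using Pu j by blast
        let ?\<gamma> = "diag_shift r (- N) \<gamma>"
        have \<gamma>': "?\<gamma> \<in> rspace r" using \<gamma>(1) by simp
        have "corner a \<le> \<gamma>" using \<gamma>(1,2) by (auto simp: corner_def diag_shift_def le_fun_def rspace_def)
        then have "u j \<in> F (corner a) W'" using F.F_antimono[OF corner \<gamma>(1) _ oW'] uj by blast
        then have "u j \<in> F' (corner D) W'" using corner_sub[OF W'2] by blast
        moreover have "?\<gamma> \<le> corner D"
          using \<gamma>(1,2) by (auto simp: corner_def diag_shift_def le_fun_def rspace_def N_def)
        ultimately have "u j \<in> F' ?\<gamma> W'" using F'.F_antimono[OF \<gamma>' corner _ oW'] by blast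
        then have "P j \<odot>\<^bsub>M W'\<^esub> u j \<in> F' (vshift n ?\<gamma>) W'" by (rule F'.F_smult[OF n \<gamma>' oW' Pj])
        moreover have "vshift n ?\<gamma> = diag_shift r (- N) (vshift n \<gamma>)"
          by (auto simp: vshift_def diag_shift_def)
        ultimately have mem: "P j \<odot>\<^bsub>M W'\<^esub> u j \<in> F' (diag_shift r (- N) (vshift n \<gamma>)) W'" by simp
        have "diag_shift r (- N) (vshift n \<gamma>) \<in> rspace r" using vshift_rspace[OF n \<gamma>(1)] by simp
        from F'.F_antimono[OF \<mu>' this diag_shift_mono[OF order.refl \<gamma>(3)] oW'] mem
        show ?thesis by (rule subsetD)
      qed
      have "(\<Oplus>\<^bsub>M W'\<^esub>j\<in>{..<l}. P j \<odot>\<^bsub>M W'\<^esub> u j) \<in> F' ?\<mu> W'"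
      proof (rule finsum_lessThan_in[OF M.M.abelian_monoid_axioms F'.F_zero[OF \<mu>' oW']])
        show "s \<oplus>\<^bsub>M W'\<^esub> t \<in> F' ?\<mu> W'" if "s \<in> F' ?\<mu> W'" "t \<in> F' ?\<mu> W'" for s t
          by (rule F'.F_add[OF \<mu>' oW' that])
        show "P j \<odot>\<^bsub>M W'\<^esub> u j \<in> carrier (M W')" if "j < l" for j
          by (rule F'.F_carrier[OF \<mu>' oW' term_in[OF that]])
        show "P j \<odot>\<^bsub>M W'\<^esub> u j \<in> F' ?\<mu> W'" if "j < l" for j by (rule term_in[OF that])
      qed
      then have "rM W W' s \<in> F' ?\<mu> W'" unfolding eq .
      then show "\<exists>W'\<in>opens W. z \<in> W' \<and> rM W W' s \<in> F' ?\<mu> W'" using W' by blast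
    qed
  qed
  show ?thesis
  proof (rule that)
    show "open (W2 \<inter> U)" "y \<in> W2 \<inter> U" "N \<ge> 0" using oW2 U yW2 by (auto simp: N_def)
    show "\<forall>\<mu>\<in>rspace r. \<forall>W\<in>opens (W2 \<inter> U). F \<mu> W \<subseteq> F' (diag_shift r (- N) \<mu>) W" using sub by blast
  qed
qed

section \<open>Comparison of two V-filtrations\<close>

lemma V_filtration_good: "multivariate_V_filtration A r E M rM F \<Longrightarrow> good_filtration A r E M rM F"
  unfolding multivariate_V_filtration_def by (elim conjE)

lemma V_filtration_nilpotent:
  assumes "multivariate_V_filtration A r E M rM F" "adapted_coordinates A r E (n, U, x) \<sigma>"
    "walls_of_filtration r F U \<W>" "\<alpha> \<in> rspace r" "\<beta> \<in> rspace r" "\<alpha> \<le> \<beta>" "wall_normal r L"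
    "{H\<in>\<W>. separates r H \<alpha> \<beta>} = {wall r L \<gamma>}" "y \<in> U"
  shows "\<exists>U'\<in>opens U. y \<in> U' \<and> (\<exists>gs. (\<forall>g\<in>set gs. Re g = \<gamma>) \<and>
    (\<forall>W\<in>opens U'. \<forall>u\<in>F \<alpha> W. res_op U W (L_prod A r E (n, U, x) \<sigma> L gs) \<odot>\<^bsub>M W\<^esub> u \<in> F \<beta> W))"
  by (rule assms(1)[unfolded multivariate_V_filtration_def, THEN conjunct2, rule_format, OF _ assms(9)])
    (rule conjI assms(2-8))+

text \<open>Adapted coordinates, walls for both filtrations and the shift N are obtained on one
  neighbourhood \<open>U0\<close> of y. There \<open>wall_filtration_subset\<close> is applied to
  the germs at y, with the sections over \<open>U0\<close> as a module over the bicommutant of the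
  constants and the s_i.\<close>

lemma (in d_module) V_filtration_germ_subset:
  assumes F: "multivariate_V_filtration A r E M rM F" and F': "multivariate_V_filtration A r E M rM F'"
    and \<alpha>: "\<alpha> \<in> rspace r" and U: "open U" and u: "u \<in> F \<alpha> U" and y: "y \<in> U"
  shows "\<exists>W\<in>opens U. y \<in> W \<and> rM U W u \<in> F' \<alpha> W"
proof -
  note gF = V_filtration_good[OF F] and gF' = V_filtration_good[OF F']
  interpret F: good_filtered_module A r E M rM F by unfold_locales (rule gF)
  interpret F': good_filtered_module A r E M rM F' by unfold_locales (rule gF')
  obtain n Uc x \<sigma> where Uc: "y \<in> Uc" "adapted_coordinates A r E (n, Uc, x) \<sigma>"
    using snc unfolding snc_divisor_def by meson
  obtain U1 \<W> where U1: "open U1" "y \<in> U1" "walls_of_filtration r F U1 \<W>"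
    using F.F_walls[of y] by (elim exE conjE) (rule that)
  obtain U2 \<W>' where U2: "open U2" "y \<in> U2" "walls_of_filtration r F' U2 \<W>'"
    using F'.F_walls[of y] by (elim exE conjE) (rule that)
  obtain U3 N where U3: "open U3" "y \<in> U3" and N: "N \<ge> 0"
    "\<forall>\<mu>\<in>rspace r. \<forall>W\<in>opens U3. F \<mu> W \<subseteq> F' (diag_shift r (- N) \<mu>) W"
    by (rule good_filtrations_comparable[OF gF gF', of y]) (rule that)
  have "open Uc" using Uc(2) by (simp add: adapted_coordinates_def coordinate_system_def is_chart_def)
  define U0 where "U0 = U \<inter> Uc \<inter> U1 \<inter> U2 \<inter> U3"
  have U0: "open U0" "y \<in> U0" "U0 \<in> opens U" "U0 \<in> opens Uc" "U0 \<in> opens U1" "U0 \<in> opens U2" "U0 \<in> opens U3"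
    using U y Uc(1) \<open>open Uc\<close> U1 U2 U3 by (auto simp: U0_def opens_iff)
  have adapted: "adapted_coordinates A r E (n, U0, x) \<sigma>"
    by (rule adapted_coordinates_restrict[OF Uc(2) U0(4)])
  interpret holomorphic_coordinates A n U0 x
    by unfold_locales (use adapted in \<open>simp add: adapted_coordinates_def\<close>)
  have walls: "walls_of_filtration r F U0 \<W>" "walls_of_filtration r F' U0 \<W>'"
    using U1(3) U2(3) opens_trans[OF _ U0(5)] opens_trans[OF _ U0(6)] by (simp_all add: walls_of_filtration_def)

  let ?R = "diff_ring A U0"
  interpret MU: left_module ?R "M U0" by (rule sections_module[OF U0(1)])
  have carrier_R: "carrier ?R = diff_ops A U0" by (simp add: diff_ring_def)
  note hom = const_op_diff_ring_hom[OF complex_atlas_axioms MU.R.ring_axioms U0(1)]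
  let ?V0 = "V_ops A r E (\<lambda>i. 0) U0"
  have V0: "subring ?V0 ?R" by (rule F.V0_subring[OF U0(1)])
  have V0_carrier: "?V0 \<subseteq> carrier ?R" by (rule subringE(1)[OF V0])
  define cst where "cst = const_op A U0"
  define I where "I = {i. i < r \<and> E i \<inter> U0 \<noteq> {}}"
  \<comment> \<open>Components that miss \<open>U0\<close> contribute zero, in agreement with
    \<open>L_op\<close>, so that the algebra can use all r indices alike.\<close>
  define s where "s i = (if i \<in> I then s_op A (n, U0, x) (\<sigma> i) else \<zero>\<^bsub>?R\<^esub>)" for i
  have I: "\<sigma> i < n" if "i \<in> I" for i
    using adapted that by (auto simp: adapted_coordinates_def I_def)
  have s_euler: "s i = \<ominus>\<^bsub>?R\<^esub> euler (\<sigma> i)" if "i \<in> I" for i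
    using that by (simp add: s_def s_op_def euler_def diff_ring_def)
  have eulV0: "euler (\<sigma> i) \<in> ?V0" if "i \<in> I" for i
    by (rule euler_V_ops[OF MU.R.ring_axioms adapted I[OF that]])
  have sV0: "s i \<in> ?V0" for i
  proof (cases "i \<in> I")
    case True
    then show ?thesis using subringE(5)[OF V0 eulV0[OF True]] by (simp add: s_euler)
  next
    case False
    then show ?thesis using subringE(2)[OF V0] by (simp add: s_def)
  qed
  have cV0: "cst c \<in> ?V0" for c
    unfolding V_ops_def V_ops1_def cst_def
    by (auto intro: const_op_diff_ops[OF U0(1)] const_op_ideal_power)
  \<comment> \<open>Constants are included so that the scalars, too, lie in the commutative
    ring.\<close>
  define B where "B = range cst \<union> range s"
  have BV0: "B \<subseteq> ?V0" using sV0 cV0 by (auto simp: B_def)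
  have s_comm: "s i \<otimes>\<^bsub>?R\<^esub> s j = s j \<otimes>\<^bsub>?R\<^esub> s i" for i j
  proof (cases "i \<in> I \<and> j \<in> I")
    case True
    then have e: "euler (\<sigma> i) \<in> carrier ?R" "euler (\<sigma> j) \<in> carrier ?R" using eulV0 V0_carrier by blast+
    show ?thesis
      using True e euler_commute[OF MU.R.ring_axioms I I, of i j]
      by (simp add: s_euler MU.R.l_minus MU.R.r_minus)
  next
    case False
    then have "s i = \<zero>\<^bsub>?R\<^esub> \<or> s j = \<zero>\<^bsub>?R\<^esub>" by (auto simp: s_def)
    moreover have "s i \<in> carrier ?R" "s j \<in> carrier ?R" using sV0 V0_carrier by blast+
    ultimately show ?thesis by auto
  qed
  have B_comm: "a \<otimes>\<^bsub>?R\<^esub> b = b \<otimes>\<^bsub>?R\<^esub> a" if ab: "a \<in> B" "b \<in> B" for a b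
  proof -
    have carr: "a \<in> diff_ops A U0" "b \<in> diff_ops A U0" using ab BV0 V0_carrier carrier_R by blast+
    consider c where "a = cst c" | c where "b = cst c" | i j where "a = s i" "b = s j"
      using ab unfolding B_def by blast
    then show ?thesis
    proof cases
      case 1
      then show ?thesis using hom(3)[OF carr(2)] by (simp add: cst_def)
    next
      case 2
      then show ?thesis using hom(3)[OF carr(1), symmetric] by (simp add: cst_def)
    next
      case 3
      then show ?thesis using s_comm by simp
    qed
  qed
  \<comment> \<open>Taken inside \<open>?V0\<close>, the bicommutant consists of operators that
    preserve every step of both filtrations.\<close>
  define H where "H = MU.R.bicommutant ?V0 B"
  have H: "subcring H ?R" "B \<subseteq> H"
    unfolding H_def by (rule MU.R.bicommutant_subcring[OF V0 BV0 B_comm], assumption+)+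
  have HV0: "H \<subseteq> ?V0" by (auto simp: H_def MU.R.bicommutant_def)
  then have H_carrier: "H \<subseteq> carrier ?R" using V0_carrier by blast
  have H_ring: "subring H ?R" using H(1) by (simp add: subcring_def)
  let ?S = "?R\<lparr>carrier := H\<rparr>"
  interpret S: cring ?S using H(1) MU.R.subcring_iff[OF H_carrier] by simp
  have sH: "s i \<in> H" and cH: "cst c \<in> H" for i c using H(2) by (auto simp: B_def)
  interpret affine_forms ?S "M U0" r s cst
  proof (unfold_locales)
    show "a \<odot>\<^bsub>M U0\<^esub> v \<in> carrier (M U0)" if "a \<in> carrier ?S" "v \<in> carrier (M U0)" for a v
      using MU.smult_closed that H_carrier by auto
    show "(a \<oplus>\<^bsub>?S\<^esub> b) \<odot>\<^bsub>M U0\<^esub> v = a \<odot>\<^bsub>M U0\<^esub> v \<oplus>\<^bsub>M U0\<^esub> b \<odot>\<^bsub>M U0\<^esub> v"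
      if "a \<in> carrier ?S" "b \<in> carrier ?S" "v \<in> carrier (M U0)" for a b v
      using MU.smult_l_distr[of a b v] that H_carrier by auto
    show "a \<odot>\<^bsub>M U0\<^esub> (v \<oplus>\<^bsub>M U0\<^esub> w) = a \<odot>\<^bsub>M U0\<^esub> v \<oplus>\<^bsub>M U0\<^esub> a \<odot>\<^bsub>M U0\<^esub> w"
      if "a \<in> carrier ?S" "v \<in> carrier (M U0)" "w \<in> carrier (M U0)" for a v w
      using MU.smult_r_distr[of a v w] that H_carrier by auto
    show "(a \<otimes>\<^bsub>?S\<^esub> b) \<odot>\<^bsub>M U0\<^esub> v = a \<odot>\<^bsub>M U0\<^esub> (b \<odot>\<^bsub>M U0\<^esub> v)"
      if "a \<in> carrier ?S" "b \<in> carrier ?S" "v \<in> carrier (M U0)" for a b v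
      using MU.smult_assoc[of a b v] that H_carrier by auto
    show "\<one>\<^bsub>?S\<^esub> \<odot>\<^bsub>M U0\<^esub> v = v" if "v \<in> carrier (M U0)" for v
      using MU.smult_one that by simp
    show "s i \<in> carrier ?S" "cst c \<in> carrier ?S" for i c using sH cH by simp_all
    show "cst (c + d) = cst c \<oplus>\<^bsub>?S\<^esub> cst d" "cst (c * d) = cst c \<otimes>\<^bsub>?S\<^esub> cst d" for c d
      using hom(1,2) by (simp_all add: cst_def)
    show "cst 1 = \<one>\<^bsub>?S\<^esub>" by (simp add: cst_def diff_ring_def)
  qed

  \<comment> \<open>The summands outside \<open>I\<close> vanish, so the sum over all i < r, formed
    in the subring, equals the sum over the components meeting \<open>U0\<close>, formed in the full
    ring.\<close>
  have L_op: "form (\<lambda>i. of_rat (L i)) g = L_op A r E (n, U0, x) \<sigma> L \<oplus>\<^bsub>?R\<^esub> const_op A U0 g" for L g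
  proof -
    let ?t = "\<lambda>i. cst (of_rat (L i)) \<otimes>\<^bsub>?R\<^esub> s i"
    have tH: "?t \<in> {..<r} \<rightarrow> H" using sH cH subringE(6)[OF H_ring] by blast
    have "(\<Oplus>\<^bsub>?S\<^esub>i\<in>{..<r}. cst (of_real (of_rat (L i))) \<otimes>\<^bsub>?S\<^esub> s i) = finsum ?S ?t {..<r}"
      by (simp add: of_real_of_rat)
    also have "\<dots> = finsum ?R ?t {..<r}" by (rule MU.R.finsum_subring[OF H_ring finite_lessThan tH])
    also have "\<dots> = finsum ?R (\<lambda>i. const_op A U0 (of_rat (L i)) \<otimes>\<^bsub>?R\<^esub> s_op A (n, U0, x) (\<sigma> i)) I"
    proof (rule MU.R.add.finprod_mono_neutral_cong_right)
      show "?t \<in> {..<r} \<rightarrow> carrier ?R" using tH H_carrier by blast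
      show "?t i = \<zero>\<^bsub>?R\<^esub>" if "i \<in> {..<r} - I" for i
        using that cH[of "of_rat (L i)"] H_carrier by (simp add: s_def subset_iff)
      show "?t i = const_op A U0 (of_rat (L i)) \<otimes>\<^bsub>?R\<^esub> s_op A (n, U0, x) (\<sigma> i)" if "i \<in> I" for i
        using that by (simp add: s_def cst_def)
    qed (auto simp: I_def)
    finally have eq: "(\<Oplus>\<^bsub>?S\<^esub>i\<in>{..<r}. cst (of_real (of_rat (L i))) \<otimes>\<^bsub>?S\<^esub> s i) =
        finsum ?R (\<lambda>i. const_op A U0 (of_rat (L i)) \<otimes>\<^bsub>?R\<^esub> s_op A (n, U0, x) (\<sigma> i)) I" .
    show ?thesis unfolding form_def eq by (simp add: L_op_def I_def cst_def)
  qed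
  have L_prod: "form_prod L gs = L_prod A r E (n, U0, x) \<sigma> L gs" for L gs
    by (induction gs) (simp_all add: form_prod_def L_prod_def L_op)

  \<comment> \<open>Stated for an arbitrary V-filtration \<open>K\<close>, because both filtrations
    are treated over the same ring.\<close>
  have wf: "wall_filtration \<V> (good_filtered_module.germ M rM K U0 y)"
    if K: "multivariate_V_filtration A r E M rM K" and \<V>: "walls_of_filtration r K U0 \<V>" for K \<V>
  proof -
    interpret K: good_filtered_module A r E M rM K by unfold_locales (rule V_filtration_good[OF K])
    have anti: "K.germ U0 y \<nu> \<subseteq> K.germ U0 y \<mu>" if "\<mu> \<in> rspace r" "\<nu> \<in> rspace r" "\<mu> \<le> \<nu>" for \<mu> \<nu>
    proof
      fix v assume "v \<in> K.germ U0 y \<nu>"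
      then obtain W where v: "v \<in> carrier (M U0)" and W: "W \<in> opens U0" "y \<in> W" "rM U0 W v \<in> K \<nu> W"
        unfolding K.germ_def by blast
      have "open W" using W(1) by (simp add: opens_iff)
      from subsetD[OF K.F_antimono[OF that this] W(3)]
      show "v \<in> K.germ U0 y \<mu>" using v W(1,2) unfolding K.germ_def by blast
    qed
    have cross: "\<exists>gs. (\<forall>g\<in>set gs. Re g = \<gamma>) \<and> (\<forall>v\<in>K.germ U0 y \<mu>. form_prod L gs \<odot>\<^bsub>M U0\<^esub> v \<in> K.germ U0 y \<nu>)"
      if mn: "\<mu> \<in> rspace r" "\<nu> \<in> rspace r" "\<mu> \<le> \<nu>" and L: "wall_normal r L"
        and one: "{H\<in>\<V>. separates r H \<mu> \<nu>} = {wall r L \<gamma>}" for \<mu> \<nu> L \<gamma>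
    proof -
      from V_filtration_nilpotent[OF K adapted \<V> mn L one U0(2)]
      obtain U' gs where U': "U' \<in> opens U0" "y \<in> U'"
        and gs: "\<forall>g\<in>set gs. Re g = \<gamma>"
        and act: "\<forall>W\<in>opens U'. \<forall>u\<in>K \<mu> W. res_op U0 W (L_prod A r E (n, U0, x) \<sigma> L gs) \<odot>\<^bsub>M W\<^esub> u \<in> K \<nu> W"
        by (elim bexE exE conjE) (rule that)
      have "form_prod L gs \<odot>\<^bsub>M U0\<^esub> v \<in> K.germ U0 y \<nu>" if v: "v \<in> K.germ U0 y \<mu>" for v
      proof -
        obtain W where v: "v \<in> carrier (M U0)" and W: "W \<in> opens U0" "y \<in> W" "rM U0 W v \<in> K \<mu> W"
          using v unfolding K.germ_def by blast
        \<comment> \<open>The operator is known to act as required only over \<open>U'\<close>, and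
          the section is in the step only over \<open>W\<close>. Both contain y, so the intersection
          settles the matter for germs.\<close>
        define X where "X = W \<inter> U'"
        have X: "X \<in> opens U0" "X \<in> opens W" "X \<in> opens U'" "y \<in> X" and oW: "open W"
          using W U' by (auto simp: X_def opens_iff)
        have "rM U0 X v \<in> K \<mu> X"
          using K.F_res[OF mn(1) oW W(3) X(2)] restriction(2)[OF U0(1) W(1) v X(2)] by simp
        then have "res_op U0 X (form_prod L gs) \<odot>\<^bsub>M X\<^esub> rM U0 X v \<in> K \<nu> X"
          using act X(3) unfolding L_prod by blast
        moreover have fp: "form_prod L gs \<in> diff_ops A U0"
          using form_prod_closed[of L gs] H_carrier carrier_R by auto
        ultimately have "rM U0 X (form_prod L gs \<odot>\<^bsub>M U0\<^esub> v) \<in> K \<nu> X"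
          using restriction(4)[OF U0(1) X(1) v fp] by simp
        moreover have "form_prod L gs \<odot>\<^bsub>M U0\<^esub> v \<in> carrier (M U0)"
          using smult_closed[OF form_prod_closed v] .
        ultimately show ?thesis using X by (auto simp: K.germ_def)
      qed
      then show ?thesis using gs by blast
    qed
    have same: "K.germ U0 y \<mu> = K.germ U0 y \<nu>"
      if "\<mu> \<in> rspace r" "\<nu> \<in> rspace r" "same_chamber r \<V> \<mu> \<nu>" for \<mu> \<nu>
    proof -
      have "K \<mu> W = K \<nu> W" if "W \<in> opens U0" for W
        using \<V> \<open>\<mu> \<in> rspace r\<close> \<open>\<nu> \<in> rspace r\<close> \<open>same_chamber r \<V> \<mu> \<nu>\<close> that
        unfolding walls_of_filtration_def by simp
      then show ?thesis by (auto simp: K.germ_def)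
    qed
    show ?thesis
      unfolding wall_filtration_def
    proof (intro conjI ballI allI impI)
      show "set_of_walls r \<V>" using \<V> by (simp add: walls_of_filtration_def)
      show "K.germ U0 y \<mu> \<subseteq> carrier (M U0)" for \<mu> by (auto simp: K.germ_def)
    qed (rule same anti cross; assumption)+
  qed

  have "F.germ U0 y \<alpha> \<subseteq> F'.germ U0 y \<alpha>"
  proof (rule wall_filtration_subset[OF wf[OF F walls(1)] wf[OF F' walls(2)] _ _ N(1) _ \<alpha>])
    show "subgroup (F'.germ U0 y \<mu>) (add_monoid (M U0))" if "\<mu> \<in> rspace r" for \<mu>
      by (rule F'.germ_subgroup[OF that U0(1,2)])
    show "P \<odot>\<^bsub>M U0\<^esub> v \<in> F'.germ U0 y \<mu>"
      if "\<mu> \<in> rspace r" "P \<in> carrier ?S" "v \<in> F'.germ U0 y \<mu>" for \<mu> P v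
    proof (rule F'.germ_smult[OF that(1) U0(1) _ that(3)])
      show "P \<in> ?V0" using that(2) HV0 by auto
    qed
    show "F.germ U0 y \<mu> \<subseteq> F'.germ U0 y (diag_shift r (- N) \<mu>)" if \<mu>: "\<mu> \<in> rspace r" for \<mu>
    proof
      fix v assume "v \<in> F.germ U0 y \<mu>"
      then obtain W where v: "v \<in> carrier (M U0)" and W: "W \<in> opens U0" "y \<in> W" "rM U0 W v \<in> F \<mu> W"
        unfolding F.germ_def by blast
      have "F \<mu> W \<subseteq> F' (diag_shift r (- N) \<mu>) W" using N(2) \<mu> opens_trans[OF W(1) U0(7)] by simp
      then have "rM U0 W v \<in> F' (diag_shift r (- N) \<mu>) W" using W(3) by (rule subsetD)
      then show "v \<in> F'.germ U0 y (diag_shift r (- N) \<mu>)" using v W unfolding F'.germ_def by blast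
    qed
  qed
  moreover have uM: "u \<in> carrier (M U)" by (rule F.F_carrier[OF \<alpha> U u])
  have "rM U U0 u \<in> F.germ U0 y \<alpha>"
  proof -
    have UU: "U0 \<in> opens U0" using U0(1) by (simp add: opens_iff)
    have "rM U0 U0 (rM U U0 u) \<in> F \<alpha> U0"
      using F.F_res[OF \<alpha> U u U0(3)] restriction(2)[OF U U0(3) uM UU] by simp
    then show ?thesis using restriction(1)[OF U U0(3) uM] UU U0(2) unfolding F.germ_def by blast
  qed
  ultimately have "rM U U0 u \<in> F'.germ U0 y \<alpha>" by (rule subsetD)
  then obtain W where W: "W \<in> opens U0" "y \<in> W" "rM U0 W (rM U U0 u) \<in> F' \<alpha> W"
    unfolding F'.germ_def by blast
  then have "rM U W u \<in> F' \<alpha> W" using restriction(2)[OF U U0(3) uM W(1)] by simp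
  then show ?thesis using W(2) opens_trans[OF W(1) U0(3)] by blast
qed

text \<open>The steps are subsheaves, so membership can be tested near each point, where the
  inclusion of germs applies.\<close>

lemma (in d_module) V_filtration_subset:
  assumes F: "multivariate_V_filtration A r E M rM F" and F': "multivariate_V_filtration A r E M rM F'"
    and \<alpha>: "\<alpha> \<in> rspace r" and U: "open U"
  shows "F \<alpha> U \<subseteq> F' \<alpha> U"
proof
  fix u assume u: "u \<in> F \<alpha> U"
  note gF = V_filtration_good[OF F] and gF' = V_filtration_good[OF F']
  interpret F: good_filtered_module A r E M rM F by unfold_locales (rule gF)
  interpret F': good_filtered_module A r E M rM F' by unfold_locales (rule gF')
  show "u \<in> F' \<alpha> U"
    by (rule F'.F_local[OF \<alpha> U F.F_carrier[OF \<alpha> U u]]) (rule V_filtration_germ_subset[OF F F' \<alpha> U u])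
qed

theorem theorem1p5:
  fixes A :: "'y::{t2_space, second_countable_topology} chart set"
    and r :: nat and E :: "nat \<Rightarrow> 'y set"
    and M :: "'y set \<Rightarrow> ('y oper, 'm) module" and rM :: "'y set \<Rightarrow> 'y set \<Rightarrow> 'm \<Rightarrow> 'm"
    and V V' :: "('y, 'm) filtr"
  assumes "complex_manifold A"
    and "snc_divisor A r E"
    and "coherent_sheaf (diff_ring A) res_op M rM"
    and "multivariate_V_filtration A r E M rM V"
    and "multivariate_V_filtration A r E M rM V'"
  shows "\<forall>\<alpha>\<in>rspace r. \<forall>U. open U \<longrightarrow> V \<alpha> U = V' \<alpha> U"
proof -
  interpret d_module A r E M rM by unfold_locales (fact assms)+
  show ?thesis
    using V_filtration_subset[OF assms(4,5)] V_filtration_subset[OF assms(5,4)] by blast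
qed

end
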